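(* Suppose $b$ is continuous and there is a constant $L_1^*>0$ such that for all $x,y\in\mathbb R^d$ $$2\langle x-y,b(x)-b(y)\rangle+\|\sigma(x)-\sigma(y)\|^2+\int_Z|\gamma(x,z)-\gamma(y,z)|^2\nu(\mathrm dz)\le-L_1^*|x-y|^2 .$$ Then for any $\tau\in(0,1)$ and $\theta\in(1/2,1]$ with $L_1^*\theta^2\tau\le3-2\theta$, the stochastic theta method is exponentially mixing with respect to a unique invariant probability measure $\pi_\tau$.
   Context: Setting: on a complete filtered probability space $(\Omega,\mathscr F,\{\mathscr F(t)\}_{t\ge0},\mathbb P)$, $W$ is an $\mathbb R^m$-valued Wiener process and $\widetilde N$ is a compensated Poisson random measure on $[0,\infty)\times Z$ with intensity $\mathrm dt\,\nu(\mathrm dz)$, where $\nu\ne0$ and $\nu(Z)<\infty$; $W$ and $\widetilde N$ are independent. $b:\mathbb R^d\to\mathbb R^d$, $\sigma:\mathbb R^d\to\mathbb R^{d\times m}$, $\gamma:\mathbb R^d\times Z\to\mathbb R^d$ are measurable, with $\int_Z|\gamma(x,z)|^2\nu(\mathrm dz)<\infty$ for each $x$ so that the stochastic integrals below are defined. $|\cdot|,\langle\cdot,\cdot\rangle$ are Euclidean, $\|\cdot\|$ is the Hilbert--Schmidt norm. For step size $\tau\in(0,1)$ put $t_j=j\tau$, $\delta_jW=W(t_{j+1})-W(t_j)$. The stochastic theta method is the implicit recursion $$Y_{j+1}=Y_j+(1-\theta)\tau b(Y_j)+\theta\tau b(Y_{j+1})+\sigma(Y_j)\delta_jW+\int_{t_j}^{t_{j+1}}\int_Z\gamma(Y_j,z)\,\widetilde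 N(\mathrm ds,\mathrm dz),\quad j\in\mathbb N.$$ $(Y_n^x)_{n\in\mathbb N}$ denotes its $(\mathscr F(t_n))$-adapted solution with $Y_0^x=x$, a homogeneous Markov chain on $\mathbb R^d$. Exponentially mixing with respect to an invariant probability measure $\pi_\tau$ means: there are a constant $\rho>0$ and a function $c:\mathbb R^d\to[0,\infty)$ such that for every Lipschitz $\varphi:\mathbb R^d\to\mathbb R$, $x\in\mathbb R^d$, $n\in\mathbb N$, $$\Big|\mathbb E\varphi(Y_n^x)-\int_{\mathbb R^d}\varphi\,\mathrm d\pi_\tau\Big|\le c(x)\,|\varphi|_{\mathrm{Lip}}\,e^{-\rho t_n},\qquad |\varphi|_{\mathrm{Lip}}=\sup_{x\ne y}\frac{|\varphi(x)-\varphi(y)|}{|x-y|}.$$ *)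

theory Defs
  imports "HOL-Probability.Probability"
begin

section \<open>Driving noise\<close>

text \<open>Time is real-valued throughout; only times \<open>t \<ge> 0\<close> are meaningful.\<close>

locale complete_filtered_prob_space = prob_space M + complete_measure M
  for M :: "'w measure" +
  fixes F :: "real \<Rightarrow> 'w measure"
  assumes filtration_sub: "0 \<le> t \<Longrightarrow> subalgebra M (F t)"
    and filtration_mono: "0 \<le> s \<Longrightarrow> s \<le> t \<Longrightarrow> subalgebra (F t) (F s)"
    and filtration_null: "null_sets M \<subseteq> sets (F 0)"

definition wiener_future :: "'w measure \<Rightarrow> (real \<Rightarrow> 'w \<Rightarrow> real ^ 'm) \<Rightarrow> real \<Rightarrow> 'w set set" where
  "wiener_future M W s = sigma_sets (space M)
     {(\<lambda>\<omega>. W u \<omega> - W s \<omega>) -` B \<inter> space M | u B. s \<le> u \<and> B \<in> sets borel}"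

locale wiener_process = complete_filtered_prob_space M F
  for M :: "'w measure" and F +
  fixes W :: "real \<Rightarrow> 'w \<Rightarrow> real ^ 'm"
  assumes wiener_adapted: "0 \<le> t \<Longrightarrow> W t \<in> borel_measurable (F t)"
    and wiener_zero: "AE \<omega> in M. W 0 \<omega> = 0"
    and wiener_paths: "AE \<omega> in M. continuous_on {0..} (\<lambda>t. W t \<omega>)"
    and wiener_increment: "0 \<le> s \<Longrightarrow> s < t \<Longrightarrow>
      distributed M lborel (\<lambda>\<omega>. W t \<omega> - W s \<omega>)
        (\<lambda>x. ennreal (\<Prod>i\<in>UNIV. normal_density 0 (sqrt (t - s)) (x $ i)))"
    and wiener_indep: "0 \<le> s \<Longrightarrow> indep_set (sets (F s)) (wiener_future M W s)"

definition intensity :: "'z measure \<Rightarrow> (real \<times> 'z) measure" where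
  "intensity \<nu> = restrict_space lborel {0..} \<Otimes>\<^sub>M \<nu>"

definition poisson_future ::
  "'w measure \<Rightarrow> 'z measure \<Rightarrow> ('w \<Rightarrow> (real \<times> 'z) measure) \<Rightarrow> real \<Rightarrow> 'w set set" where
  "poisson_future M \<nu> N s = sigma_sets (space M)
     {(\<lambda>\<omega>. emeasure (N \<omega>) B) -` C \<inter> space M | B C.
        B \<in> sets (intensity \<nu>) \<and> B \<subseteq> {s<..} \<times> space \<nu> \<and> C \<in> sets borel}"

locale poisson_random_measure = complete_filtered_prob_space M F
  for M :: "'w measure" and F +
  fixes \<nu> :: "'z measure" and N :: "'w \<Rightarrow> (real \<times> 'z) measure"
  assumes nu_finite: "finite_measure \<nu>"
    and nu_nonzero: "emeasure \<nu> (space \<nu>) \<noteq> 0"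
    and prm_sets: "\<omega> \<in> space M \<Longrightarrow> sets (N \<omega>) = sets (intensity \<nu>)"
    and prm_measurable: "B \<in> sets (intensity \<nu>) \<Longrightarrow>
      (\<lambda>\<omega>. emeasure (N \<omega>) B) \<in> borel_measurable M"
    and prm_poisson: "B \<in> sets (intensity \<nu>) \<Longrightarrow> emeasure (intensity \<nu>) B < \<infinity> \<Longrightarrow>
      prob {\<omega> \<in> space M. emeasure (N \<omega>) B = of_nat k}
        = measure (intensity \<nu>) B ^ k / fact k * exp (- measure (intensity \<nu>) B)"
    and prm_disjoint_indep: "\<lbrakk>\<And>i. i < n \<Longrightarrow> A i \<in> sets (intensity \<nu>); disjoint_family_on A {..<n}\<rbrakk> \<Longrightarrow>
      indep_vars (\<lambda>_. borel) (\<lambda>i \<omega>. emeasure (N \<omega>) (A i)) {..<n::nat}"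
    and prm_adapted: "0 \<le> t \<Longrightarrow> B \<in> sets (intensity \<nu>) \<Longrightarrow> B \<subseteq> {0..t} \<times> space \<nu> \<Longrightarrow>
      (\<lambda>\<omega>. emeasure (N \<omega>) B) \<in> borel_measurable (F t)"
    and prm_indep: "0 \<le> s \<Longrightarrow> indep_set (sets (F s)) (poisson_future M \<nu> N s)"

text \<open>
  Independence of \<open>W\<close> and \<open>N\<close> is understood relative to the filtration: at each time \<open>s\<close>, the
  past, the future increments of \<open>W\<close> and the future points of \<open>N\<close> are mutually independent.
  This is automatic for a Wiener process and a Poisson random measure with respect to a common
  filtration, and it is what makes the recursion below a homogeneous Markov chain.
\<close>

locale levy_noise = wiener_process M F W + poisson_random_measure M F \<nu> N
  for M :: "'w measure" and F and W :: "real \<Rightarrow> 'w \<Rightarrow> real ^ 'm"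
    and \<nu> :: "'z measure" and N +
  assumes noise_indep: "0 \<le> s \<Longrightarrow>
    indep_sets (\<lambda>i. [sets (F s), wiener_future M W s, poisson_future M \<nu> N s] ! i) {..<3}"

text \<open>
  Integral over \<open>(a, b] \<times> Z\<close> against \<open>N - dt \<nu>(dz)\<close>. Since \<open>\<nu>\<close> is finite, \<open>N\<close> has almost surely
  finitely many points there, so the stochastic integral is the difference of two Lebesgue
  integrals, taken path by path; a random integrand is evaluated at the same \<open>\<omega>\<close>.
\<close>

definition compensated_integral ::
  "'z measure \<Rightarrow> ('w \<Rightarrow> (real \<times> 'z) measure) \<Rightarrow> real \<Rightarrow> real
    \<Rightarrow> ('w \<Rightarrow> real \<Rightarrow> 'z \<Rightarrow> 'e::{banach, second_countable_topology}) \<Rightarrow> 'w \<Rightarrow> 'e" where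
  "compensated_integral \<nu> N a b f \<omega> =
     (LINT p:{a<..b} \<times> space \<nu>|N \<omega>. f \<omega> (fst p) (snd p))
     - (LINT p:{a<..b} \<times> space \<nu>|intensity \<nu>. f \<omega> (fst p) (snd p))"


section \<open>The stochastic theta method\<close>

text \<open>
  The norm of \<open>real ^ 'm ^ 'd\<close> is the Hilbert--Schmidt norm of a \<open>d \<times> m\<close> matrix.
\<close>

definition admissible_coefficients ::
  "'z measure \<Rightarrow> (real ^ 'd \<Rightarrow> real ^ 'd) \<Rightarrow> (real ^ 'd \<Rightarrow> real ^ 'm ^ 'd)
    \<Rightarrow> (real ^ 'd \<Rightarrow> 'z \<Rightarrow> real ^ 'd) \<Rightarrow> bool" where
  "admissible_coefficients \<nu> b \<sigma> \<gamma> \<longleftrightarrow>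
     b \<in> borel_measurable borel \<and> \<sigma> \<in> borel_measurable borel \<and>
     (\<lambda>(x, z). \<gamma> x z) \<in> borel_measurable (borel \<Otimes>\<^sub>M \<nu>) \<and>
     (\<forall>x. integrable \<nu> (\<lambda>z. (norm (\<gamma> x z))\<^sup>2))"

definition theta_method_solution ::
  "'w measure \<Rightarrow> (real \<Rightarrow> 'w measure) \<Rightarrow> (real \<Rightarrow> 'w \<Rightarrow> real ^ 'm) \<Rightarrow> 'z measure
    \<Rightarrow> ('w \<Rightarrow> (real \<times> 'z) measure) \<Rightarrow> (real ^ 'd \<Rightarrow> real ^ 'd) \<Rightarrow> (real ^ 'd \<Rightarrow> real ^ 'm ^ 'd)
    \<Rightarrow> (real ^ 'd \<Rightarrow> 'z \<Rightarrow> real ^ 'd) \<Rightarrow> real \<Rightarrow> real \<Rightarrow> real ^ 'd \<Rightarrow> (nat \<Rightarrow> 'w \<Rightarrow> real ^ 'd) \<Rightarrow> bool" where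
  "theta_method_solution M F W \<nu> N b \<sigma> \<gamma> \<tau> \<theta> x Y \<longleftrightarrow>
     (\<forall>n. Y n \<in> borel_measurable (F (real n * \<tau>))) \<and>
     (AE \<omega> in M. Y 0 \<omega> = x) \<and>
     (\<forall>j. AE \<omega> in M.
        Y (Suc j) \<omega> = Y j \<omega> + ((1 - \<theta>) * \<tau>) *\<^sub>R b (Y j \<omega>) + (\<theta> * \<tau>) *\<^sub>R b (Y (Suc j) \<omega>)
          + \<sigma> (Y j \<omega>) *v (W (real (Suc j) * \<tau>) \<omega> - W (real j * \<tau>) \<omega>)
          + compensated_integral \<nu> N (real j * \<tau>) (real (Suc j) * \<tau>) (\<lambda>\<omega> s z. \<gamma> (Y j \<omega>) z) \<omega>)"


section \<open>Invariant measures and mixing\<close>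

text \<open>
  \<open>Y x n\<close> is the state at time \<open>n\<close> of the homogeneous Markov chain started at \<open>x\<close>, so that
  \<open>distr M borel (Y x 1)\<close> is its one-step transition probability from \<open>x\<close>.
\<close>

definition invariant_prob ::
  "'w measure \<Rightarrow> (real ^ 'd \<Rightarrow> nat \<Rightarrow> 'w \<Rightarrow> real ^ 'd) \<Rightarrow> (real ^ 'd) measure \<Rightarrow> bool" where
  "invariant_prob M Y \<pi> \<longleftrightarrow>
     prob_space \<pi> \<and> sets \<pi> = sets borel \<and>
     (\<forall>B\<in>sets borel. (\<integral>\<^sup>+x. emeasure (distr M borel (Y x 1)) B \<partial>\<pi>) = emeasure \<pi> B)"

definition lip_seminorm :: "(real ^ 'd \<Rightarrow> real) \<Rightarrow> real" where
  "lip_seminorm \<phi> = (SUP (x, y) \<in> {(x, y). x \<noteq> y}. \<bar>\<phi> x - \<phi> y\<bar> / norm (x - y))"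

text \<open>
  Integrability is part of the definition, because the Bochner integral of a non-integrable
  function is 0 and the estimate alone would not say that the expectations exist.
\<close>

definition exponentially_mixing ::
  "'w measure \<Rightarrow> real \<Rightarrow> (real ^ 'd \<Rightarrow> nat \<Rightarrow> 'w \<Rightarrow> real ^ 'd) \<Rightarrow> (real ^ 'd) measure \<Rightarrow> bool" where
  "exponentially_mixing M \<tau> Y \<pi> \<longleftrightarrow>
     (\<exists>\<rho> > 0. \<exists>c :: real ^ 'd \<Rightarrow> real. (\<forall>x. 0 \<le> c x) \<and>
       (\<forall>\<phi>. (\<exists>L. L-lipschitz_on UNIV \<phi>) \<longrightarrow>
          integrable \<pi> \<phi> \<and>
          (\<forall>x n. integrable M (\<lambda>\<omega>. \<phi> (Y x n \<omega>)) \<and>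
             \<bar>(LINT \<omega>|M. \<phi> (Y x n \<omega>)) - (LINT y|\<pi>. \<phi> y)\<bar>
               \<le> c x * lip_seminorm \<phi> * exp (- \<rho> * (real n * \<tau>)))))"

end

theory Submission
  imports Defs
begin

text \<open>
  Put \<open>D = x - y\<close>, \<open>\<Delta>b = b x - b y\<close> and let \<open>J x = x - \<theta> \<tau> b x\<close> be the implicit part of the scheme, with
  increment \<open>G = J x - J y = D - \<theta> \<tau> \<Delta>b\<close>. One step leads from \<open>x\<close> to the state at which \<open>J\<close>
  takes the value \<open>x + (1 - \<theta>) \<tau> b x\<close> plus a centred noise term, and \<open>D + (1 - \<theta>) \<tau> \<Delta>b = G + \<tau> \<Delta>b\<close>. The noise
  contributes at most \<open>\<tau> (|\<Delta>\<sigma>|\<^sup>2 + \<integral> |\<Delta>\<gamma>|\<^sup>2 d\<nu>)\<close> to the second moment, so that by dissipativity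
  the mean square of the new \<open>G\<close> is at most
  \<open>|G|\<^sup>2 - L \<tau> |D|\<^sup>2 - (2 \<theta> - 1) \<tau>\<^sup>2 |\<Delta>b|\<^sup>2\<close>. As \<open>|G|\<^sup>2 \<le> 2 |D|\<^sup>2 + 2 \<theta>\<^sup>2 \<tau>\<^sup>2 |\<Delta>b|\<^sup>2\<close> and \<open>\<theta> > 1/2\<close>, this
  is at most \<open>q |G|\<^sup>2\<close> for some \<open>q < 1\<close> (lemma \<open>drift_contraction\<close>). The drift is monotone, hence
  \<open>|D| \<le> |G|\<close>: the distance \<open>|J x - J y|\<close> dominates the Euclidean one and shrinks
  in mean at least by the factor \<open>sqrt q\<close> in every step.

  The chain is therefore an iteration of independent random maps that contract on average, and such
  an iteration is treated abstractly in the locale \<open>random_contraction\<close>. Composing the maps in the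
  reverse order does not change the law at a fixed time, but makes the iterates converge almost
  surely at a geometric rate. The law of the limit is the invariant measure, and the rate of
  convergence is the rate of mixing.

  Two things remain to connect the scheme with that iteration. The moment bound for the
  compensated integral comes from the isometry for simple integrands and Fatou's lemma
  (\<open>compensated_second_moment\<close>). The Markov property with a kernel that does not depend on
  time comes from the independence of past and future noise (\<open>nn_integral_freeze\<close>) and from the fact that
  the law of an integral against a Poisson cloud depends on its intensity alone
  (\<open>poisson_cloud_integral_law\<close>).
\<close>

section \<open>Lipschitz functions determine a law\<close>

text \<open>
  The indicator of a closed set \<open>C\<close> is the decreasing limit of the Lipschitz functions
  \<open>max 0 (1 - k * infdist x C)\<close>, and the closed sets form a generator that is stable under
  intersections.
\<close>

lemma measure_eqI_lipschitz:
  fixes \<mu> \<nu> :: "'a::metric_space measure"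
  assumes "prob_space \<mu>" "prob_space \<nu>" and sets: "sets \<mu> = sets borel" "sets \<nu> = sets borel"
    and eq: "\<And>\<phi> :: 'a \<Rightarrow> real. \<exists>C. C-lipschitz_on UNIV \<phi> \<Longrightarrow> (\<And>x. 0 \<le> \<phi> x \<and> \<phi> x \<le> 1) \<Longrightarrow>
      (\<integral>\<^sup>+x. ennreal (\<phi> x) \<partial>\<mu>) = (\<integral>\<^sup>+x. ennreal (\<phi> x) \<partial>\<nu>)"
  shows "\<mu> = \<nu>"
proof -
  interpret \<mu>: prob_space \<mu> by fact
  interpret \<nu>: prob_space \<nu> by fact
  have meas: "f \<in> borel_measurable \<mu> \<longleftrightarrow> f \<in> borel_measurable borel"
    "f \<in> borel_measurable \<nu> \<longleftrightarrow> f \<in> borel_measurable borel" for f :: "'a \<Rightarrow> ennreal"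
    by (simp_all cong: measurable_cong_sets add: sets)
  have closed_eq: "emeasure \<mu> C = emeasure \<nu> C" if C: "closed C" for C :: "'a set"
  proof (cases "C = {}")
    case False
    define \<phi> where "\<phi> k x = max 0 (1 - real k * infdist x C)" for k :: nat and x
    have lip: "(real k)-lipschitz_on UNIV (\<phi> k)" for k
    proof (rule lipschitz_onI)
      fix x y
      have "\<bar>\<phi> k x - \<phi> k y\<bar> \<le> \<bar>real k * infdist x C - real k * infdist y C\<bar>"
        unfolding \<phi>_def by linarith
      also have "\<dots> = real k * \<bar>infdist x C - infdist y C\<bar>"
        by (simp add: abs_mult flip: right_diff_distrib)
      also have "\<dots> \<le> real k * dist x y"
        using infdist_triangle_abs by (intro mult_left_mono) auto
      finally show "dist (\<phi> k x) (\<phi> k y) \<le> real k * dist x y" by (simp add: dist_real_def)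
    qed simp
    have [measurable]: "\<phi> k \<in> borel_measurable borel" for k
      by (intro borel_measurable_continuous_onI lipschitz_on_continuous_on[OF lip])
    have le1: "\<phi> k x \<le> 1" for k x
      unfolding \<phi>_def by (auto simp: infdist_nonneg)
    have lim: "(\<lambda>k. ennreal (\<phi> k x)) \<longlonglongrightarrow> indicator C x" for x
    proof (cases "x \<in> C")
      case False
      then have "infdist x C > 0"
        using C \<open>C \<noteq> {}\<close> by (simp add: infdist_pos_not_in_closed)
      then obtain K where K: "1 < real K * infdist x C"
        using reals_Archimedean3 by blast
      have "\<phi> k x = 0" if "k \<ge> K" for k
      proof -
        have "1 \<le> real k * infdist x C"
          using K that by (smt (verit) \<open>infdist x C > 0\<close> mult_right_mono of_nat_mono)
        then show ?thesis by (simp add: \<phi>_def)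
      qed
      then have "\<forall>\<^sub>F k in sequentially. ennreal (\<phi> k x) = indicator C x"
        using False by (auto simp: eventually_sequentially intro!: exI[of _ K])
      then show ?thesis by (simp add: tendsto_eventually)
    qed (simp add: \<phi>_def)
    have 1: "(\<lambda>k. \<integral>\<^sup>+x. ennreal (\<phi> k x) \<partial>\<mu>) \<longlonglongrightarrow> (\<integral>\<^sup>+x. indicator C x \<partial>\<mu>)"
      using C lim by (intro nn_integral_dominated_convergence[where w="\<lambda>_. 1"])
        (auto simp: meas \<mu>.emeasure_space_1 le1)
    have 2: "(\<lambda>k. \<integral>\<^sup>+x. ennreal (\<phi> k x) \<partial>\<nu>) \<longlonglongrightarrow> (\<integral>\<^sup>+x. indicator C x \<partial>\<nu>)"
      using C lim by (intro nn_integral_dominated_convergence[where w="\<lambda>_. 1"])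
        (auto simp: meas \<nu>.emeasure_space_1 le1)
    have "(\<integral>\<^sup>+x. ennreal (\<phi> k x) \<partial>\<mu>) = (\<integral>\<^sup>+x. ennreal (\<phi> k x) \<partial>\<nu>)" for k
      using lip le1 by (intro eq) (auto simp: \<phi>_def)
    then have "(\<integral>\<^sup>+x. indicator C x \<partial>\<mu>) = (\<integral>\<^sup>+x. indicator C x \<partial>\<nu>)"
      using LIMSEQ_unique[OF 1] 2 by simp
    then show ?thesis using C by (simp add: sets)
  qed simp
  show ?thesis
  proof (rule measure_eqI_generator_eq[where E="Collect closed" and \<Omega>=UNIV and A="\<lambda>_. UNIV"])
    show "Int_stable (Collect closed :: 'a set set)" by (auto simp: Int_stable_def)
  qed (auto simp: sets borel_eq_closed closed_eq)
qed

section \<open>Random maps that contract on average\<close>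

text \<open>
  The map \<open>J\<close> provides the distance \<open>dist (J x) (J y)\<close> in which the random map \<open>\<Phi>\<close> contracts in mean.
  Since \<open>J\<close> is expansive, sequences that are Cauchy in this distance converge, and since it is
  continuous, the distance itself passes to the limit.
\<close>

locale random_contraction = prob_space M for M :: "'w measure" +
  fixes \<Phi> :: "'a::{banach, second_countable_topology} \<Rightarrow> 'w \<Rightarrow> 'a" and J :: "'a \<Rightarrow> 'b::metric_space" and r :: real
  assumes map_measurable[measurable]: "(\<lambda>(x, \<omega>). \<Phi> x \<omega>) \<in> borel_measurable (borel \<Otimes>\<^sub>M M)"
    and J_continuous: "continuous_on UNIV J"
    and J_expansive: "dist x y \<le> dist (J x) (J y)"
    and ratio: "0 < r" "r < 1"
    and contraction: "(\<integral>\<^sup>+\<omega>. dist (J (\<Phi> x \<omega>)) (J (\<Phi> y \<omega>)) \<partial>M) \<le> ennreal r * dist (J x) (J y)"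
    and finite_displacement: "(\<integral>\<^sup>+\<omega>. dist (J x) (J (\<Phi> x \<omega>)) \<partial>M) < \<infinity>"
begin

definition noise :: "(nat \<Rightarrow> 'w) measure" where
  "noise = (\<Pi>\<^sub>M i\<in>UNIV. M)"

definition \<delta> :: "'a \<Rightarrow> 'a \<Rightarrow> real" where
  "\<delta> x y = dist (J x) (J y)"

text \<open>
  The newest map is applied first: the orbit for \<open>n + 1\<close> differs from the one for \<open>n\<close> only by an
  additional innermost map, whose effect is damped by all the others.
\<close>

primrec backward :: "'a \<Rightarrow> nat \<Rightarrow> (nat \<Rightarrow> 'w) \<Rightarrow> 'a" where
  "backward x 0 s = x"
| "backward x (Suc n) s = \<Phi> (backward x n (\<lambda>i. s (Suc i))) (s 0)"

definition average :: "('a \<Rightarrow> ennreal) \<Rightarrow> 'a \<Rightarrow> ennreal" where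
  "average f x = (\<integral>\<^sup>+\<omega>. f (\<Phi> x \<omega>) \<partial>M)"

definition stationary :: "'a measure \<Rightarrow> bool" where
  "stationary \<pi> \<longleftrightarrow> prob_space \<pi> \<and> sets \<pi> = sets borel \<and>
     (\<forall>f\<in>borel_measurable borel. (\<integral>\<^sup>+x. average f x \<partial>\<pi>) = (\<integral>\<^sup>+x. f x \<partial>\<pi>))"

sublocale seq: sequence_space M by unfold_locales

sublocale noise: prob_space noise
  unfolding noise_def by (rule prob_space_PiM) unfold_locales

lemma map_measurable'[measurable (raw)]:
  "f \<in> borel_measurable K \<Longrightarrow> g \<in> measurable K M \<Longrightarrow> (\<lambda>k. \<Phi> (f k) (g k)) \<in> borel_measurable K"
  using measurable_compose[OF measurable_Pair map_measurable, of f K g] by simp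

lemma \<delta>_measurable[measurable (raw)]:
  "f \<in> borel_measurable K \<Longrightarrow> g \<in> borel_measurable K \<Longrightarrow> (\<lambda>k. \<delta> (f k) (g k)) \<in> borel_measurable K"
proof -
  have "continuous_on UNIV (\<lambda>p. \<delta> (fst p) (snd p))"
    unfolding \<delta>_def by (intro continuous_intros continuous_on_compose2[OF J_continuous]) auto
  then have "(\<lambda>p. \<delta> (fst p) (snd p)) \<in> borel_measurable (borel \<Otimes>\<^sub>M borel)"
    by (simp add: borel_prod borel_measurable_continuous_onI)
  from measurable_compose[OF measurable_Pair this, of f K g]
  show "f \<in> borel_measurable K \<Longrightarrow> g \<in> borel_measurable K \<Longrightarrow> (\<lambda>k. \<delta> (f k) (g k)) \<in> borel_measurable K"
    by simp
qed

lemma \<delta>_nonneg[simp]: "0 \<le> \<delta> x y" and \<delta>_triangle: "\<delta> x z \<le> \<delta> x y + \<delta> y z"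
  and \<delta>_same[simp]: "\<delta> x x = 0"
  by (simp_all add: \<delta>_def dist_triangle dist_commute)

lemma shift_measurable[measurable]:
  "(\<lambda>s i. s (Suc i)) \<in> measurable noise noise" "(\<lambda>s. s 0) \<in> measurable noise M"
  by (auto simp: noise_def space_PiM PiE_iff intro!: measurable_PiM_single')

lemma backward_measurable[measurable (raw)]:
  "f \<in> borel_measurable K \<Longrightarrow> g \<in> measurable K noise \<Longrightarrow>
    (\<lambda>k. backward (f k) n (g k)) \<in> borel_measurable K"
proof (induction n arbitrary: f g)
  case (Suc n)
  note [measurable] = Suc.prems
  have "(\<lambda>k. backward (f k) n (\<lambda>i. g k (Suc i))) \<in> borel_measurable K"
    by (rule Suc.IH) (measurable; fact measurable_compose[OF Suc.prems(2) shift_measurable(1)])+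
  moreover have "(\<lambda>k. g k 0) \<in> measurable K M"
    by (rule measurable_compose[OF Suc.prems(2) shift_measurable(2)])
  ultimately show ?case by simp
qed simp

lemma average_measurable[measurable]:
  assumes [measurable]: "f \<in> borel_measurable borel"
  shows "average f \<in> borel_measurable borel"
  unfolding average_def by measurable

text \<open>
  The first noise variable and the remaining ones are independent, and the shifted sequence has the
  law of the whole sequence.
\<close>

lemma nn_integral_noise_split:
  assumes [measurable]: "(\<lambda>(\<omega>, s). G \<omega> s) \<in> borel_measurable (M \<Otimes>\<^sub>M noise)"
  shows "(\<integral>\<^sup>+s. G (s 0) (\<lambda>i. s (Suc i)) \<partial>noise) = (\<integral>\<^sup>+s. \<integral>\<^sup>+\<omega>. G \<omega> s \<partial>M \<partial>noise)"
proof -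
  interpret P: pair_sigma_finite M noise by unfold_locales
  have iter: "distr (M \<Otimes>\<^sub>M noise) noise (\<lambda>(\<omega>, s). case_nat \<omega> s) = noise"
    unfolding noise_def by (rule seq.PiM_iter)
  have [measurable]: "(\<lambda>(\<omega>, s). case_nat \<omega> s) \<in> measurable (M \<Otimes>\<^sub>M noise) noise"
    unfolding noise_def by measurable
  have [measurable]: "(\<lambda>s. G (s 0) (\<lambda>i. s (Suc i))) \<in> borel_measurable noise"
    using measurable_compose[OF measurable_Pair[OF shift_measurable(2,1)] assms] by simp
  have "(\<integral>\<^sup>+s. G (s 0) (\<lambda>i. s (Suc i)) \<partial>noise)
      = (\<integral>\<^sup>+s. G (s 0) (\<lambda>i. s (Suc i)) \<partial>distr (M \<Otimes>\<^sub>M noise) noise (\<lambda>(\<omega>, s). case_nat \<omega> s))"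
    by (simp only: iter)
  also have "\<dots> = (\<integral>\<^sup>+p. (case p of (\<omega>, s) \<Rightarrow> G \<omega> s) \<partial>(M \<Otimes>\<^sub>M noise))"
    by (subst nn_integral_distr) (auto simp: case_prod_unfold)
  also have "\<dots> = (\<integral>\<^sup>+s. \<integral>\<^sup>+\<omega>. G \<omega> s \<partial>M \<partial>noise)"
    by (subst P.nn_integral_snd[symmetric]) auto
  finally show ?thesis .
qed

lemma nn_integral_backward_Suc:
  assumes [measurable]: "f \<in> borel_measurable borel"
  shows "(\<integral>\<^sup>+s. f (backward x (Suc n) s) \<partial>noise) = (\<integral>\<^sup>+s. average f (backward x n s) \<partial>noise)"
  unfolding average_def backward.simps
  by (rule nn_integral_noise_split[where G="\<lambda>\<omega> s. f (\<Phi> (backward x n s) \<omega>)"]) measurable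

text \<open>
  Both states are functions of the shifted noise and hence independent of the first noise
  variable, which drives the common last map.
\<close>

lemma contraction_pair:
  assumes [measurable]: "X \<in> borel_measurable noise" "X' \<in> borel_measurable noise"
  shows "(\<integral>\<^sup>+s. \<delta> (\<Phi> (X (\<lambda>i. s (Suc i))) (s 0)) (\<Phi> (X' (\<lambda>i. s (Suc i))) (s 0)) \<partial>noise)
    \<le> ennreal r * (\<integral>\<^sup>+s. \<delta> (X s) (X' s) \<partial>noise)"
proof -
  have "(\<integral>\<^sup>+s. \<delta> (\<Phi> (X (\<lambda>i. s (Suc i))) (s 0)) (\<Phi> (X' (\<lambda>i. s (Suc i))) (s 0)) \<partial>noise)
    = (\<integral>\<^sup>+s. \<integral>\<^sup>+\<omega>. \<delta> (\<Phi> (X s) \<omega>) (\<Phi> (X' s) \<omega>) \<partial>M \<partial>noise)"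
    by (rule nn_integral_noise_split[where G="\<lambda>\<omega> s. ennreal (\<delta> (\<Phi> (X s) \<omega>) (\<Phi> (X' s) \<omega>))"]) measurable
  also have "\<dots> \<le> (\<integral>\<^sup>+s. ennreal r * \<delta> (X s) (X' s) \<partial>noise)"
    unfolding \<delta>_def by (intro nn_integral_mono contraction)
  finally show ?thesis by (simp add: nn_integral_cmult)
qed

lemma backward_contraction:
  "(\<integral>\<^sup>+s. \<delta> (backward x n s) (backward y n s) \<partial>noise) \<le> ennreal r ^ n * \<delta> x y"
proof (induction n)
  case 0
  then show ?case by (simp add: noise.emeasure_space_1)
next
  case (Suc n)
  have "(\<integral>\<^sup>+s. \<delta> (backward x (Suc n) s) (backward y (Suc n) s) \<partial>noise)
    \<le> ennreal r * (\<integral>\<^sup>+s. \<delta> (backward x n s) (backward y n s) \<partial>noise)"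
    unfolding backward.simps by (rule contraction_pair) measurable
  also have "\<dots> \<le> ennreal r * (ennreal r ^ n * \<delta> x y)"
    by (intro mult_left_mono Suc) simp
  finally show ?case by (simp add: mult.assoc)
qed

definition displacement :: "'a \<Rightarrow> real" where
  "displacement x = enn2real (\<integral>\<^sup>+\<omega>. \<delta> x (\<Phi> x \<omega>) \<partial>M)"

lemma displacement_nonneg[simp]: "0 \<le> displacement x"
  by (simp add: displacement_def)

lemma displacement: "(\<integral>\<^sup>+\<omega>. \<delta> x (\<Phi> x \<omega>) \<partial>M) = ennreal (displacement x)"
  using finite_displacement[of x] by (simp add: displacement_def \<delta>_def)

lemma backward_increment:
  "(\<integral>\<^sup>+s. \<delta> (backward x n s) (backward x (Suc n) s) \<partial>noise) \<le> ennreal (r ^ n * displacement x)"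
proof (induction n)
  case 0
  have "(\<integral>\<^sup>+s. \<delta> (backward x 0 s) (backward x (Suc 0) s) \<partial>noise)
      = (\<integral>\<^sup>+s. \<integral>\<^sup>+\<omega>. \<delta> x (\<Phi> x \<omega>) \<partial>M \<partial>noise)"
    unfolding backward.simps
    by (rule nn_integral_noise_split[where G="\<lambda>\<omega> s. ennreal (\<delta> x (\<Phi> x \<omega>))"]) measurable
  then show ?case by (simp add: displacement noise.emeasure_space_1)
next
  case (Suc n)
  have "(\<integral>\<^sup>+s. \<delta> (backward x (Suc n) s) (backward x (Suc (Suc n)) s) \<partial>noise)
    \<le> ennreal r * (\<integral>\<^sup>+s. \<delta> (backward x n s) (backward x (Suc n) s) \<partial>noise)"
    using contraction_pair[of "backward x n" "backward x (Suc n)"] backward_measurable by simp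
  also have "\<dots> \<le> ennreal r * ennreal (r ^ n * displacement x)"
    by (intro mult_left_mono Suc) simp
  finally show ?case using ratio by (simp add: ennreal_mult'[symmetric] mult.assoc)
qed

text \<open>
  The remaining length of the orbit after time \<open>n\<close>; it bounds the distance from the orbit to its
  limit.
\<close>

definition tail :: "'a \<Rightarrow> nat \<Rightarrow> (nat \<Rightarrow> 'w) \<Rightarrow> ennreal" where
  "tail x n s = (\<Sum>k. ennreal (\<delta> (backward x (n + k) s) (backward x (Suc (n + k)) s)))"

definition limit :: "'a \<Rightarrow> (nat \<Rightarrow> 'w) \<Rightarrow> 'a" where
  "limit x s = lim (\<lambda>n. backward x n s)"

definition limit_law :: "'a \<Rightarrow> 'a measure" where
  "limit_law x = distr noise borel (limit x)"

lemma tail_measurable[measurable]: "tail x n \<in> borel_measurable noise"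
  unfolding tail_def by measurable

lemma limit_measurable[measurable]: "limit x \<in> borel_measurable noise"
  unfolding limit_def by measurable

lemma nn_integral_tail:
  "(\<integral>\<^sup>+s. tail x n s \<partial>noise) \<le> ennreal (displacement x / (1 - r) * r ^ n)"
proof -
  have sums: "(\<lambda>k. r ^ (n + k) * displacement x) sums (displacement x / (1 - r) * r ^ n)"
    using sums_mult[OF geometric_sums[of r], of "r ^ n * displacement x"] ratio
    by (simp add: power_add mult_ac)
  have "(\<integral>\<^sup>+s. tail x n s \<partial>noise)
      = (\<Sum>k. \<integral>\<^sup>+s. \<delta> (backward x (n + k) s) (backward x (Suc (n + k)) s) \<partial>noise)"
    unfolding tail_def by (rule nn_integral_suminf) measurable
  also have "\<dots> \<le> (\<Sum>k. ennreal (r ^ (n + k) * displacement x))"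
    by (intro suminf_le backward_increment) auto
  also have "\<dots> = ennreal (displacement x / (1 - r) * r ^ n)"
    using ratio by (intro suminf_ennreal_eq sums) auto
  finally show ?thesis .
qed

lemma \<delta>_le_tail:
  "ennreal (\<delta> (backward x n s) (backward x (n + k) s)) \<le> tail x n s"
proof -
  have "\<delta> (backward x n s) (backward x (n + k) s)
      \<le> (\<Sum>i<k. \<delta> (backward x (n + i) s) (backward x (Suc (n + i)) s))"
  proof (induction k)
    case (Suc k)
    show ?case
      using Suc \<delta>_triangle[of "backward x n s" "backward x (n + Suc k) s" "backward x (n + k) s"]
      by simp
  qed simp
  then have "ennreal (\<delta> (backward x n s) (backward x (n + k) s))
      \<le> (\<Sum>i<k. ennreal (\<delta> (backward x (n + i) s) (backward x (Suc (n + i)) s)))"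
    by (simp add: ennreal_leI sum_ennreal)
  also have "\<dots> \<le> tail x n s"
    unfolding tail_def by (rule sum_le_suminf) auto
  finally show ?thesis .
qed

text \<open>
  The total length of the orbit has finite mean, so it is finite almost surely and the orbit is a
  Cauchy sequence.
\<close>

lemma backward_converges:
  "AE s in noise. (\<lambda>n. backward x n s) \<longlonglongrightarrow> limit x s \<and> (\<forall>n. ennreal (\<delta> (backward x n s) (limit x s)) \<le> tail x n s)"
proof -
  have "(\<integral>\<^sup>+s. tail x 0 s \<partial>noise) \<noteq> \<infinity>"
    using nn_integral_tail[of x 0] by (auto simp: top_unique)
  then have "AE s in noise. tail x 0 s \<noteq> \<infinity>"
    by (intro nn_integral_PInf_AE) auto
  then show ?thesis
  proof eventually_elim
    case (elim s)
    let ?d = "\<lambda>n. \<delta> (backward x n s) (backward x (Suc n) s)"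
    have summ: "summable ?d"
      using elim by (intro summable_suminf_not_top) (auto simp: tail_def)
    have tail_eq: "tail x n s = ennreal (\<Sum>k. ?d (n + k))" for n
      unfolding tail_def using summable_ignore_initial_segment[OF summ, of n]
      by (intro suminf_ennreal2) (auto simp: add.commute)
    have to0: "(\<lambda>n. \<Sum>k. ?d (n + k)) \<longlonglongrightarrow> 0"
      using suminf_exist_split2[OF summ] by (simp add: add.commute)
    have bound: "\<delta> (backward x n s) (backward x (n + k) s) \<le> (\<Sum>k. ?d (n + k))" for n k
      using \<delta>_le_tail[of x n s k] summable_ignore_initial_segment[OF summ, of n]
      unfolding tail_eq by (subst (asm) ennreal_le_iff) (auto intro!: suminf_nonneg simp: add.commute)
    have "Cauchy (\<lambda>n. backward x n s)"
      unfolding Cauchy_altdef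
    proof (intro allI impI)
      fix e :: real assume "0 < e"
      then obtain K where K: "\<And>n. n \<ge> K \<Longrightarrow> (\<Sum>k. ?d (n + k)) < e"
        using order_tendstoD(2)[OF to0] by (auto simp: eventually_sequentially)
      show "\<exists>K. \<forall>m\<ge>K. \<forall>n>m. dist (backward x m s) (backward x n s) < e"
      proof (intro exI allI impI)
        fix m n assume "m \<ge> K" "n > m"
        have "dist (backward x m s) (backward x (m + (n - m)) s) \<le> \<delta> (backward x m s) (backward x (m + (n - m)) s)"
          unfolding \<delta>_def by (rule J_expansive)
        also have "\<dots> < e"
          using bound[of m "n - m"] K[OF \<open>m \<ge> K\<close>] by linarith
        finally show "dist (backward x m s) (backward x n s) < e" using \<open>n > m\<close> by simp
      qed
    qed
    then have conv: "(\<lambda>n. backward x n s) \<longlonglongrightarrow> limit x s"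
      unfolding limit_def using Cauchy_convergent_iff convergent_LIMSEQ_iff by blast
    have "ennreal (\<delta> (backward x n s) (limit x s)) \<le> tail x n s" for n
    proof -
      have "(\<lambda>k. backward x (n + k) s) \<longlonglongrightarrow> limit x s"
        using LIMSEQ_ignore_initial_segment[OF conv, of n] by (simp add: add.commute)
      moreover have "isCont J (limit x s)"
        using J_continuous by (simp add: continuous_on_eq_continuous_at)
      ultimately have "(\<lambda>k. J (backward x (n + k) s)) \<longlonglongrightarrow> J (limit x s)"
        using isCont_tendsto_compose by blast
      then have "(\<lambda>k. \<delta> (backward x n s) (backward x (n + k) s)) \<longlonglongrightarrow> \<delta> (backward x n s) (limit x s)"
        unfolding \<delta>_def by (intro tendsto_intros)
      then have "\<delta> (backward x n s) (limit x s) \<le> (\<Sum>k. ?d (n + k))"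
        by (rule LIMSEQ_le_const2) (use bound in auto)
      then show ?thesis by (simp add: tail_eq ennreal_leI)
    qed
    with conv show ?case by blast
  qed
qed

text \<open>
  Lipschitz continuity for the distance \<open>\<delta>\<close>. Unlike Lipschitz continuity for \<open>dist\<close>, it is preserved
  by averaging over one step of the chain.
\<close>

definition J_lipschitz :: "real \<Rightarrow> ('a \<Rightarrow> real) \<Rightarrow> bool" where
  "J_lipschitz C \<phi> \<longleftrightarrow> 0 \<le> C \<and> (\<forall>x y. \<bar>\<phi> x - \<phi> y\<bar> \<le> C * \<delta> x y)"

lemma lipschitz_imp_J_lipschitz:
  assumes "C-lipschitz_on UNIV \<phi>"
  shows "J_lipschitz C \<phi>"
proof -
  have "\<bar>\<phi> x - \<phi> y\<bar> \<le> C * \<delta> x y" for x y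
  proof -
    have "\<bar>\<phi> x - \<phi> y\<bar> \<le> C * dist x y"
      using lipschitz_onD[OF assms, of x y] by (simp add: dist_real_def)
    also have "\<dots> \<le> C * \<delta> x y"
      unfolding \<delta>_def using lipschitz_on_nonneg[OF assms] by (intro mult_left_mono J_expansive) auto
    finally show ?thesis .
  qed
  then show ?thesis using lipschitz_on_nonneg[OF assms] by (simp add: J_lipschitz_def)
qed

lemma J_lipschitz_measurable:
  assumes "J_lipschitz C \<phi>"
  shows "\<phi> \<in> borel_measurable borel"
proof (rule borel_measurable_continuous_onI, rule continuous_at_imp_continuous_on, rule ballI)
  fix x
  have "((\<lambda>y. C * \<delta> y x) \<longlongrightarrow> C * \<delta> x x) (at x)"
    unfolding \<delta>_def using J_continuous by (intro tendsto_intros) (simp add: continuous_on_def)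
  then have "((\<lambda>y. C * \<delta> y x) \<longlongrightarrow> 0) (at x)" by simp
  then have "((\<lambda>y. \<phi> y - \<phi> x) \<longlongrightarrow> 0) (at x)"
    by (rule Lim_null_comparison[rotated]) (use assms in \<open>auto simp: J_lipschitz_def\<close>)
  then show "isCont \<phi> x" by (simp add: isCont_def LIM_zero_iff)
qed

lemma prob_space_limit_law: "prob_space (limit_law x)"
  unfolding limit_law_def by (rule noise.prob_space_distr) simp

lemma integrable_tail:
  "integrable noise (\<lambda>s. enn2real (tail x n s))" "(\<integral>s. enn2real (tail x n s) \<partial>noise) \<le> displacement x / (1 - r) * r ^ n"
  "AE s in noise. tail x n s = ennreal (enn2real (tail x n s))"
proof -
  have fin: "(\<integral>\<^sup>+s. tail x n s \<partial>noise) \<noteq> \<infinity>"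
    using nn_integral_tail[of x n] by (auto simp: top_unique)
  show AE: "AE s in noise. tail x n s = ennreal (enn2real (tail x n s))"
    using nn_integral_PInf_AE[OF _ fin] by (auto simp: less_top)
  then have eq: "(\<integral>\<^sup>+s. ennreal (enn2real (tail x n s)) \<partial>noise) = (\<integral>\<^sup>+s. tail x n s \<partial>noise)"
    by (intro nn_integral_cong_AE) (auto elim: eventually_mono)
  show int: "integrable noise (\<lambda>s. enn2real (tail x n s))"
    using fin by (intro integrableI_nonneg) (auto simp: eq less_top)
  show "(\<integral>s. enn2real (tail x n s) \<partial>noise) \<le> displacement x / (1 - r) * r ^ n"
    using nn_integral_tail[of x n] ratio nn_integral_eq_integral[OF int]
    by (subst (asm) eq[symmetric]) (simp add: ennreal_le_iff)
qed

text \<open>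
  This is the mixing estimate: a test function changes by at most \<open>C\<close> times the length of the tail
  between time \<open>n\<close> and the limit.
\<close>

lemma limit_estimate:
  assumes lip: "J_lipschitz C \<phi>"
  shows "integrable noise (\<lambda>s. \<phi> (backward x n s))" (is ?A)
    and "integrable (limit_law x) \<phi>" (is ?B)
    and "\<bar>(\<integral>s. \<phi> (backward x n s) \<partial>noise) - (\<integral>y. \<phi> y \<partial>limit_law x)\<bar>
      \<le> C * (displacement x / (1 - r)) * r ^ n" (is ?C)
proof -
  note [measurable] = J_lipschitz_measurable[OF lip]
  let ?t = "\<lambda>n s. enn2real (tail x n s)"
  have C: "0 \<le> C" and dist_le: "\<bar>\<phi> a - \<phi> b\<bar> \<le> C * \<delta> a b" for a b
    using lip by (auto simp: J_lipschitz_def)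
  have AE: "AE s in noise. \<delta> (backward x n s) (limit x s) \<le> ?t n s" for n
    using backward_converges[of x] integrable_tail(3)[of x n]
  proof eventually_elim
    case (elim s)
    then have "ennreal (\<delta> (backward x n s) (limit x s)) \<le> ennreal (?t n s)" by metis
    then show ?case by (simp add: ennreal_le_iff)
  qed
  have diff: "AE s in noise. \<bar>\<phi> (backward x n s) - \<phi> (limit x s)\<bar> \<le> C * ?t n s" for n
    using AE[of n] by eventually_elim (meson C dist_le mult_left_mono order_trans)
  have int_diff: "integrable noise (\<lambda>s. \<phi> (backward x n s) - \<phi> (limit x s))" for n
  proof (rule Bochner_Integration.integrable_bound[of _ "\<lambda>s. C * ?t n s"])
    show "integrable noise (\<lambda>s. C * ?t n s)" using integrable_tail(1) by auto
    show "AE s in noise. norm (\<phi> (backward x n s) - \<phi> (limit x s)) \<le> norm (C * ?t n s)"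
      using diff[of n] by eventually_elim auto
  qed measurable
  have int_lim: "integrable noise (\<lambda>s. \<phi> (limit x s))"
    using Bochner_Integration.integrable_diff[OF noise.integrable_const[of "\<phi> x"] int_diff[of 0]] by simp
  show A: ?A
    using Bochner_Integration.integrable_add[OF int_diff[of n] int_lim] by simp
  show ?B
    unfolding limit_law_def by (subst integrable_distr_eq) (auto simp: int_lim)
  have "\<bar>(\<integral>s. \<phi> (backward x n s) \<partial>noise) - (\<integral>s. \<phi> (limit x s) \<partial>noise)\<bar>
      = \<bar>\<integral>s. \<phi> (backward x n s) - \<phi> (limit x s) \<partial>noise\<bar>"
    using A int_lim by simp
  also have "\<dots> \<le> (\<integral>s. \<bar>\<phi> (backward x n s) - \<phi> (limit x s)\<bar> \<partial>noise)"
    by (rule integral_abs_bound)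
  also have "\<dots> \<le> (\<integral>s. C * ?t n s \<partial>noise)"
    using diff int_diff integrable_tail(1)[of x n] by (intro integral_mono_AE) auto
  also have "\<dots> \<le> C * (displacement x / (1 - r) * r ^ n)"
    using mult_left_mono[OF integrable_tail(2)[of x n] C] by simp
  finally show ?C
    unfolding limit_law_def by (subst integral_distr) (auto simp: mult.assoc)
qed

lemma limit_tendsto:
  assumes "J_lipschitz C \<phi>"
  shows "(\<lambda>n. \<integral>s. \<phi> (backward x n s) \<partial>noise) \<longlonglongrightarrow> (\<integral>y. \<phi> y \<partial>limit_law x)"
proof -
  have "(\<lambda>n. C * (displacement x / (1 - r)) * r ^ n) \<longlonglongrightarrow> 0"
    using ratio by (intro tendsto_mult_right_zero LIMSEQ_power_zero) auto
  then have "(\<lambda>n. (\<integral>s. \<phi> (backward x n s) \<partial>noise) - (\<integral>y. \<phi> y \<partial>limit_law x)) \<longlonglongrightarrow> 0"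
    by (rule Lim_null_comparison[rotated, where g="\<lambda>n. C * (displacement x / (1 - r)) * r ^ n"])
      (use limit_estimate(3)[OF assms] in \<open>auto intro!: always_eventually\<close>)
  then show ?thesis by (simp add: LIM_zero_iff)
qed

text \<open>
  The constant improves by the contraction ratio; the bounds on \<open>\<phi>\<close> make all averages exist.
\<close>

lemma J_lipschitz_average:
  assumes lip: "J_lipschitz C \<phi>" and bd: "\<And>x. 0 \<le> \<phi> x \<and> \<phi> x \<le> 1"
  shows "J_lipschitz (C * r) (\<lambda>x. \<integral>\<omega>. \<phi> (\<Phi> x \<omega>) \<partial>M)"
    and "average (\<lambda>x. ennreal (\<phi> x)) x = ennreal (\<integral>\<omega>. \<phi> (\<Phi> x \<omega>) \<partial>M)"
    and "0 \<le> (\<integral>\<omega>. \<phi> (\<Phi> x \<omega>) \<partial>M) \<and> (\<integral>\<omega>. \<phi> (\<Phi> x \<omega>) \<partial>M) \<le> 1"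
proof -
  note [measurable] = J_lipschitz_measurable[OF lip]
  have C: "0 \<le> C" and dist_le: "\<bar>\<phi> a - \<phi> b\<bar> \<le> C * \<delta> a b" for a b
    using lip by (auto simp: J_lipschitz_def)
  have int: "integrable M (\<lambda>\<omega>. \<phi> (\<Phi> x \<omega>))" for x
    by (rule integrable_const_bound[of _ 1]) (use bd in auto)
  show "average (\<lambda>x. ennreal (\<phi> x)) x = ennreal (\<integral>\<omega>. \<phi> (\<Phi> x \<omega>) \<partial>M)"
    unfolding average_def using bd by (intro nn_integral_eq_integral int) auto
  show "0 \<le> (\<integral>\<omega>. \<phi> (\<Phi> x \<omega>) \<partial>M) \<and> (\<integral>\<omega>. \<phi> (\<Phi> x \<omega>) \<partial>M) \<le> 1"
    using bd integral_le_const[OF int[of x]] by (auto intro: integral_nonneg)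
  have "\<bar>(\<integral>\<omega>. \<phi> (\<Phi> x \<omega>) \<partial>M) - (\<integral>\<omega>. \<phi> (\<Phi> y \<omega>) \<partial>M)\<bar> \<le> C * r * \<delta> x y" for x y
  proof -
    have "ennreal \<bar>(\<integral>\<omega>. \<phi> (\<Phi> x \<omega>) \<partial>M) - (\<integral>\<omega>. \<phi> (\<Phi> y \<omega>) \<partial>M)\<bar>
        = ennreal (norm (\<integral>\<omega>. \<phi> (\<Phi> x \<omega>) - \<phi> (\<Phi> y \<omega>) \<partial>M))"
      using int by simp
    also have "\<dots> \<le> (\<integral>\<^sup>+\<omega>. norm (\<phi> (\<Phi> x \<omega>) - \<phi> (\<Phi> y \<omega>)) \<partial>M)"
      using int by (intro integral_norm_bound_ennreal) auto
    also have "\<dots> \<le> (\<integral>\<^sup>+\<omega>. ennreal C * \<delta> (\<Phi> x \<omega>) (\<Phi> y \<omega>) \<partial>M)"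
      using dist_le C by (intro nn_integral_mono) (auto simp: ennreal_mult[symmetric] intro!: ennreal_leI)
    also have "\<dots> = ennreal C * (\<integral>\<^sup>+\<omega>. \<delta> (\<Phi> x \<omega>) (\<Phi> y \<omega>) \<partial>M)"
      by (rule nn_integral_cmult) measurable
    also have "\<dots> \<le> ennreal C * (ennreal r * \<delta> x y)"
      unfolding \<delta>_def by (intro mult_left_mono contraction) simp
    also have "\<dots> = ennreal (C * r * \<delta> x y)"
      using C ratio by (simp add: ennreal_mult mult.assoc)
    finally show ?thesis
      using C ratio by (subst (asm) ennreal_le_iff) auto
  qed
  then show "J_lipschitz (C * r) (\<lambda>x. \<integral>\<omega>. \<phi> (\<Phi> x \<omega>) \<partial>M)"
    using C ratio by (simp add: J_lipschitz_def)
qed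

definition law_after_step :: "'a measure \<Rightarrow> 'a measure" where
  "law_after_step \<pi> = distr (\<pi> \<Otimes>\<^sub>M M) borel (\<lambda>(x, \<omega>). \<Phi> x \<omega>)"

lemma
  assumes "prob_space \<pi>" and sets[measurable_cong]: "sets \<pi> = sets borel"
  shows prob_space_law_after_step: "prob_space (law_after_step \<pi>)"
    and nn_integral_law_after_step: "f \<in> borel_measurable borel \<Longrightarrow> (\<integral>\<^sup>+x. f x \<partial>law_after_step \<pi>) = (\<integral>\<^sup>+x. average f x \<partial>\<pi>)"
    and stationary_iff_law_after_step: "stationary \<pi> \<longleftrightarrow> law_after_step \<pi> = \<pi>"
proof -
  interpret \<pi>: prob_space \<pi> by fact
  interpret P: pair_prob_space \<pi> M by unfold_locales
  show "prob_space (law_after_step \<pi>)"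
    unfolding law_after_step_def by (rule P.prob_space_distr) measurable
  show int: "(\<integral>\<^sup>+x. f x \<partial>law_after_step \<pi>) = (\<integral>\<^sup>+x. average f x \<partial>\<pi>)" if [measurable]: "f \<in> borel_measurable borel" for f
    unfolding average_def law_after_step_def
    by (simp add: nn_integral_distr nn_integral_fst[symmetric] case_prod_unfold)
  show "stationary \<pi> \<longleftrightarrow> law_after_step \<pi> = \<pi>"
  proof
    assume stat: "stationary \<pi>"
    show "law_after_step \<pi> = \<pi>"
    proof (rule measure_eqI)
      fix B assume "B \<in> sets (law_after_step \<pi>)"
      then have B: "B \<in> sets borel" by (simp add: law_after_step_def)
      have "emeasure (law_after_step \<pi>) B = (\<integral>\<^sup>+x. indicator B x \<partial>law_after_step \<pi>)"
        using B by (simp add: law_after_step_def)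
      also have "\<dots> = (\<integral>\<^sup>+x. indicator B x \<partial>\<pi>)"
        using stat B by (simp add: int stationary_def)
      finally show "emeasure (law_after_step \<pi>) B = emeasure \<pi> B" using B sets by simp
    qed (simp add: law_after_step_def sets)
  next
    assume eq: "law_after_step \<pi> = \<pi>"
    then have "(\<integral>\<^sup>+x. average f x \<partial>\<pi>) = (\<integral>\<^sup>+x. f x \<partial>\<pi>)" if "f \<in> borel_measurable borel" for f
      using int[OF that] by simp
    then show "stationary \<pi>"
      using assms unfolding stationary_def by blast
  qed
qed

lemma sets_limit_law[simp, measurable_cong]: "sets (limit_law x) = sets borel"
  by (simp add: limit_law_def)

text \<open>
  For bounded test functions, averaging over one step only shifts the time, and both sides have the
  same limit, because the averaged test function is again Lipschitz for \<open>\<delta>\<close>.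
\<close>

lemma stationary_limit_law: "stationary (limit_law x)"
  unfolding stationary_iff_law_after_step[OF prob_space_limit_law sets_limit_law]
proof (rule measure_eqI_lipschitz)
  fix \<phi> :: "'a \<Rightarrow> real" assume *: "\<exists>C. C-lipschitz_on UNIV \<phi>" "\<And>x. 0 \<le> \<phi> x \<and> \<phi> x \<le> 1"
  then obtain C where lip: "J_lipschitz C \<phi>" by (auto dest: lipschitz_imp_J_lipschitz)
  note [measurable] = J_lipschitz_measurable[OF lip]
  let ?a = "\<lambda>x. \<integral>\<omega>. \<phi> (\<Phi> x \<omega>) \<partial>M"
  note avg = J_lipschitz_average[OF lip *(2)]
  have nn: "ennreal (\<integral>s. \<psi> (backward x n s) \<partial>noise) = (\<integral>\<^sup>+s. ennreal (\<psi> (backward x n s)) \<partial>noise)"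
    if "J_lipschitz D \<psi>" "\<And>x. 0 \<le> \<psi> x" for \<psi> D n
    using limit_estimate(1)[OF that(1)] that(2) by (intro nn_integral_eq_integral[symmetric]) auto
  have "ennreal (\<integral>s. ?a (backward x n s) \<partial>noise) = ennreal (\<integral>s. \<phi> (backward x (Suc n) s) \<partial>noise)" for n
  proof -
    have "ennreal (\<integral>s. ?a (backward x n s) \<partial>noise)
        = (\<integral>\<^sup>+s. average (\<lambda>y. ennreal (\<phi> y)) (backward x n s) \<partial>noise)"
      unfolding avg(2) using avg(3) by (intro nn[OF avg(1)]) auto
    also have "\<dots> = (\<integral>\<^sup>+s. ennreal (\<phi> (backward x (Suc n) s)) \<partial>noise)"
      by (rule nn_integral_backward_Suc[symmetric]) measurable
    also have "\<dots> = ennreal (\<integral>s. \<phi> (backward x (Suc n) s) \<partial>noise)"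
      using *(2) by (intro nn[OF lip, symmetric]) auto
    finally show ?thesis .
  qed
  then have "(\<integral>s. ?a (backward x n s) \<partial>noise) = (\<integral>s. \<phi> (backward x (Suc n) s) \<partial>noise)" for n
    using avg(3) *(2) by (subst (asm) ennreal_inj) (auto intro!: integral_nonneg)
  then have "(\<integral>y. ?a y \<partial>limit_law x) = (\<integral>y. \<phi> y \<partial>limit_law x)"
    using limit_tendsto[OF avg(1), of x] LIMSEQ_Suc[OF limit_tendsto[OF lip, of x]]
    by (simp add: LIMSEQ_unique)
  then have "(\<integral>\<^sup>+y. average (\<lambda>y. ennreal (\<phi> y)) y \<partial>limit_law x) = (\<integral>\<^sup>+y. ennreal (\<phi> y) \<partial>limit_law x)"
    using avg *(2) nn_integral_eq_integral[OF limit_estimate(2)[OF avg(1)], of x]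
      nn_integral_eq_integral[OF limit_estimate(2)[OF lip], of x] by simp
  then show "(\<integral>\<^sup>+y. ennreal (\<phi> y) \<partial>law_after_step (limit_law x)) = (\<integral>\<^sup>+y. ennreal (\<phi> y) \<partial>limit_law x)"
    by (simp add: nn_integral_law_after_step[OF prob_space_limit_law])
qed (simp_all add: prob_space_limit_law prob_space_law_after_step[OF prob_space_limit_law], simp add: law_after_step_def)

lemma stationary_backward:
  assumes "stationary \<pi>" and [measurable]: "f \<in> borel_measurable borel"
  shows "(\<integral>\<^sup>+x. \<integral>\<^sup>+s. f (backward x n s) \<partial>noise \<partial>\<pi>) = (\<integral>\<^sup>+x. f x \<partial>\<pi>)"
  using assms(2)
proof (induction n arbitrary: f)
  case 0
  then show ?case by (simp add: noise.emeasure_space_1)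
next
  case (Suc n)
  note [measurable] = Suc.prems
  have "(\<integral>\<^sup>+x. \<integral>\<^sup>+s. f (backward x (Suc n) s) \<partial>noise \<partial>\<pi>)
      = (\<integral>\<^sup>+x. \<integral>\<^sup>+s. average f (backward x n s) \<partial>noise \<partial>\<pi>)"
    by (simp only: nn_integral_backward_Suc[OF Suc.prems])
  also have "\<dots> = (\<integral>\<^sup>+x. average f x \<partial>\<pi>)" by (rule Suc.IH) measurable
  also have "\<dots> = (\<integral>\<^sup>+x. f x \<partial>\<pi>)"
    using assms(1) Suc.prems by (auto simp: stationary_def)
  finally show ?case .
qed

text \<open>
  Two orbits driven by the same noise approach each other, so the mean of a test function at time
  \<open>n\<close> has the same limit from every starting point; integrating over a stationary initial law
  leaves this mean constant in \<open>n\<close>.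
\<close>

lemma stationary_unique:
  assumes stat: "stationary \<pi>"
  shows "\<pi> = limit_law x"
proof (rule measure_eqI_lipschitz)
  interpret \<pi>: prob_space \<pi> using stat by (simp add: stationary_def)
  have [measurable_cong]: "sets \<pi> = sets borel" using stat by (simp add: stationary_def)
  fix \<phi> :: "'a \<Rightarrow> real" assume *: "\<exists>C. C-lipschitz_on UNIV \<phi>" "\<And>x. 0 \<le> \<phi> x \<and> \<phi> x \<le> 1"
  then obtain C where lip: "J_lipschitz C \<phi>" by (auto dest: lipschitz_imp_J_lipschitz)
  note [measurable] = J_lipschitz_measurable[OF lip]
  have C: "0 \<le> C" and dist_le: "\<bar>\<phi> a - \<phi> b\<bar> \<le> C * \<delta> a b" for a b
    using lip by (auto simp: J_lipschitz_def)
  let ?e = "\<lambda>y n. \<integral>s. \<phi> (backward y n s) \<partial>noise"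
  have lim: "(\<lambda>n. ?e y n) \<longlonglongrightarrow> (\<integral>z. \<phi> z \<partial>limit_law x)" for y
  proof -
    have bound: "\<bar>?e y n - ?e x n\<bar> \<le> C * \<delta> y x * r ^ n" for n
    proof -
      have "ennreal \<bar>?e y n - ?e x n\<bar> = ennreal (norm (\<integral>s. \<phi> (backward y n s) - \<phi> (backward x n s) \<partial>noise))"
        using limit_estimate(1)[OF lip] by simp
      also have "\<dots> \<le> (\<integral>\<^sup>+s. norm (\<phi> (backward y n s) - \<phi> (backward x n s)) \<partial>noise)"
        using limit_estimate(1)[OF lip] by (intro integral_norm_bound_ennreal) auto
      also have "\<dots> \<le> (\<integral>\<^sup>+s. ennreal C * \<delta> (backward y n s) (backward x n s) \<partial>noise)"
        using dist_le C by (intro nn_integral_mono) (auto simp: ennreal_mult[symmetric] intro!: ennreal_leI)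
      also have "\<dots> = ennreal C * (\<integral>\<^sup>+s. \<delta> (backward y n s) (backward x n s) \<partial>noise)"
        by (rule nn_integral_cmult) measurable
      also have "\<dots> \<le> ennreal C * (ennreal r ^ n * \<delta> y x)"
        by (intro mult_left_mono backward_contraction) simp
      also have "\<dots> = ennreal (C * \<delta> y x * r ^ n)"
        using C ratio by (simp add: ennreal_mult ennreal_power mult_ac)
      finally show ?thesis using C ratio by (subst (asm) ennreal_le_iff) auto
    qed
    have "(\<lambda>n. C * \<delta> y x * r ^ n) \<longlonglongrightarrow> 0"
      using ratio by (intro tendsto_mult_right_zero LIMSEQ_power_zero) auto
    then have "(\<lambda>n. ?e y n - ?e x n) \<longlonglongrightarrow> 0"
      by (rule Lim_null_comparison[rotated, where g="\<lambda>n. C * \<delta> y x * r ^ n"])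
        (use bound in \<open>auto intro!: always_eventually\<close>)
    then have "(\<lambda>n. (?e y n - ?e x n) + ?e x n) \<longlonglongrightarrow> 0 + (\<integral>z. \<phi> z \<partial>limit_law x)"
      using limit_tendsto[OF lip, of x] by (rule tendsto_add)
    then show ?thesis by simp
  qed
  have e_nn: "ennreal (?e y n) = (\<integral>\<^sup>+s. ennreal (\<phi> (backward y n s)) \<partial>noise)" for y n
    using limit_estimate(1)[OF lip] *(2) by (intro nn_integral_eq_integral[symmetric]) auto
  have "(\<lambda>n. \<integral>\<^sup>+y. ennreal (?e y n) \<partial>\<pi>) \<longlonglongrightarrow> (\<integral>\<^sup>+y. ennreal (\<integral>z. \<phi> z \<partial>limit_law x) \<partial>\<pi>)"
  proof (rule nn_integral_dominated_convergence[where w="\<lambda>_. 1"])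
    show "(\<lambda>y. ennreal (?e y n)) \<in> borel_measurable \<pi>" for n
      unfolding e_nn by measurable
    show "AE y in \<pi>. ennreal (?e y n) \<le> 1" for n
    proof (rule AE_I2)
      fix y
      have "?e y n \<le> 1" using noise.integral_le_const[OF limit_estimate(1)[OF lip]] *(2) by auto
      then show "ennreal (?e y n) \<le> 1" by simp
    qed
  qed (use lim in \<open>auto simp: \<pi>.emeasure_space_1 intro!: tendsto_ennrealI\<close>)
  moreover have "(\<integral>\<^sup>+y. ennreal (?e y n) \<partial>\<pi>) = (\<integral>\<^sup>+y. ennreal (\<phi> y) \<partial>\<pi>)" for n
    unfolding e_nn by (rule stationary_backward[OF stat]) measurable
  ultimately have "(\<integral>\<^sup>+y. ennreal (\<phi> y) \<partial>\<pi>) = ennreal (\<integral>z. \<phi> z \<partial>limit_law x)"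
    by (simp add: LIMSEQ_const_iff \<pi>.emeasure_space_1)
  also have "\<dots> = (\<integral>\<^sup>+y. ennreal (\<phi> y) \<partial>limit_law x)"
    using limit_estimate(2)[OF lip] *(2) by (intro nn_integral_eq_integral[symmetric]) auto
  finally show "(\<integral>\<^sup>+y. ennreal (\<phi> y) \<partial>\<pi>) = (\<integral>\<^sup>+y. ennreal (\<phi> y) \<partial>limit_law x)" .
next
  show "prob_space \<pi>" "sets \<pi> = sets borel"
    using stat by (simp_all add: stationary_def)
qed (rule prob_space_limit_law, simp)

end

section \<open>Poisson point clouds\<close>

lemma simple_function_disjoint_representation:
  fixes g :: "'z \<Rightarrow> 'e::real_vector"
  assumes "simple_function \<mu> g"
  obtains n :: nat and A y where "\<And>i. i < n \<Longrightarrow> A i \<in> sets \<mu>" "disjoint_family_on A {..<n}"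
    "\<And>z. z \<in> space \<mu> \<Longrightarrow> g z = (\<Sum>i<n. indicator (A i) z *\<^sub>R y i)"
proof -
  have fin: "finite (g ` space \<mu>)" using assms by (simp add: simple_function_def)
  obtain y :: "nat \<Rightarrow> 'e" where bij: "bij_betw y {..<card (g ` space \<mu>)} (g ` space \<mu>)"
    using ex_bij_betw_nat_finite[OF fin] by (auto simp: atLeast0LessThan)
  let ?n = "card (g ` space \<mu>)" and ?A = "\<lambda>i. g -` {y i} \<inter> space \<mu>"
  show thesis
  proof (rule that)
    show "?A i \<in> sets \<mu>" if "i < ?n" for i
    proof -
      have "y i \<in> g ` space \<mu>" using bij_betwE[OF bij] that by blast
      then show ?thesis using assms unfolding simple_function_def by blast
    qed
    show "disjoint_family_on ?A {..<?n}"
      using bij by (auto simp: disjoint_family_on_def bij_betw_def inj_on_def)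
    fix z assume z: "z \<in> space \<mu>"
    have "(\<Sum>i<?n. indicator (?A i) z *\<^sub>R y i) = (\<Sum>v\<in>g ` space \<mu>. indicator (g -` {v} \<inter> space \<mu>) z *\<^sub>R v)"
      by (rule sum.reindex_bij_betw[OF bij])
    also have "\<dots> = (\<Sum>v\<in>g ` space \<mu>. if v = g z then v else 0)"
      using z by (intro sum.cong) (auto simp: indicator_def)
    also have "\<dots> = g z" using fin z by simp
    finally show "g z = (\<Sum>i<?n. indicator (?A i) z *\<^sub>R y i)" by simp
  qed
qed

lemma (in finite_measure) integral_disjoint_representation:
  fixes g :: "'a \<Rightarrow> 'e::{banach, second_countable_topology}"
  assumes "\<And>i. i < n \<Longrightarrow> A i \<in> sets M"
    and "\<And>z. z \<in> space M \<Longrightarrow> g z = (\<Sum>i<(n::nat). indicator (A i) z *\<^sub>R y i)"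
  shows "(\<integral>z. g z \<partial>M) = (\<Sum>i<n. measure M (A i) *\<^sub>R y i)"
proof -
  have "(\<integral>z. g z \<partial>M) = (\<integral>z. (\<Sum>i<n. indicator (A i) z *\<^sub>R y i) \<partial>M)"
    by (intro Bochner_Integration.integral_cong assms) auto
  also have "\<dots> = (\<Sum>i<n. \<integral>z. indicator (A i) z *\<^sub>R y i \<partial>M)"
    using assms(1) by (intro Bochner_Integration.integral_sum) (auto simp: less_top[symmetric])
  also have "\<dots> = (\<Sum>i<n. measure M (A i) *\<^sub>R y i)"
    using assms(1) by (intro sum.cong) (auto simp: less_top[symmetric] Int_absorb2 sets.sets_into_space)
  finally show ?thesis .
qed

text \<open>
  Pushing \<open>K x\<close> forward along \<open>z \<mapsto> (x, z)\<close> turns the integrand that varies with \<open>x\<close> into a fixed one on the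
  product space.
\<close>

lemma integral_kernel_measurable:
  fixes f :: "'x \<Rightarrow> 'z \<Rightarrow> 'e::{banach, second_countable_topology}"
  assumes f[measurable]: "(\<lambda>(x, z). f x z) \<in> borel_measurable (X \<Otimes>\<^sub>M \<mu>)"
    and K[measurable]: "K \<in> measurable X (subprob_algebra \<mu>)"
  shows "(\<lambda>x. \<integral>z. f x z \<partial>K x) \<in> borel_measurable X"
proof -
  note measurable_distr2[measurable]
  have "(\<lambda>x. \<integral>p. (case p of (x, z) \<Rightarrow> f x z) \<partial>distr (K x) (X \<Otimes>\<^sub>M \<mu>) (\<lambda>z. (x, z))) \<in> borel_measurable X"
    by (rule measurable_compose[OF _ integral_measurable_subprob_algebra[OF f]]) measurable
  then show ?thesis
  proof (rule measurable_cong[THEN iffD1, rotated])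
    fix x assume x: "x \<in> space X"
    have [measurable_cong]: "sets (K x) = sets \<mu>" by (rule sets_kernel[OF K x])
    have [measurable]: "(\<lambda>z. (x, z)) \<in> measurable (K x) (X \<Otimes>\<^sub>M \<mu>)"
      by (subst measurable_cong_sets[OF sets_kernel[OF K x] refl]) (rule measurable_Pair1'[OF x])
    show "(\<integral>p. (case p of (x, z) \<Rightarrow> f x z) \<partial>distr (K x) (X \<Otimes>\<^sub>M \<mu>) (\<lambda>z. (x, z))) = (\<integral>z. f x z \<partial>K x)"
      by (subst integral_distr) auto
  qed
qed

text \<open>
  The \<open>\<sigma>\<close>-algebra \<open>G\<close> is kept as a parameter, because integrals against the random measure must be
  measurable with respect to the \<open>\<sigma>\<close>-algebra of the future noise, not only with respect to all events.
\<close>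

locale finite_random_measure =
  fixes G :: "'w measure" and \<mu> :: "'z measure" and R :: "'w \<Rightarrow> 'z measure"
  assumes nonempty: "space \<mu> \<noteq> {}"
    and sets_R: "\<omega> \<in> space G \<Longrightarrow> sets (R \<omega>) = sets \<mu>"
    and finite_R: "\<omega> \<in> space G \<Longrightarrow> finite_measure (R \<omega>)"
    and measurable_R: "B \<in> sets \<mu> \<Longrightarrow> (\<lambda>\<omega>. emeasure (R \<omega>) B) \<in> borel_measurable G"
begin

lemma space_R: "\<omega> \<in> space G \<Longrightarrow> space (R \<omega>) = space \<mu>"
  using sets_R sets_eq_imp_space_eq by blast

definition mass :: "'w \<Rightarrow> real" where "mass \<omega> = measure (R \<omega>) (space \<mu>)"

text \<open>
  Division by \<open>1 + mass\<close> gives a subprobability kernel, also where the mass is zero or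
  arbitrarily large, so that the measurability results for such kernels apply.
\<close>

definition normalised :: "'w \<Rightarrow> 'z measure" where
  "normalised \<omega> = density (R \<omega>) (\<lambda>_. ennreal (1 / (1 + mass \<omega>)))"

lemma mass: "\<omega> \<in> space G \<Longrightarrow> emeasure (R \<omega>) (space \<mu>) = ennreal (mass \<omega>)" "0 \<le> mass \<omega>"
  by (auto simp: mass_def finite_measure.emeasure_eq_measure[OF finite_R])

lemma mass_measurable[measurable]: "mass \<in> borel_measurable G"
  unfolding mass_def measure_def using measurable_R by measurable

lemma normalised_kernel: "normalised \<in> measurable G (subprob_algebra \<mu>)"
proof (rule measurable_subprob_algebra)
  fix \<omega> assume \<omega>: "\<omega> \<in> space G"
  show "sets (normalised \<omega>) = sets \<mu>" by (simp add: normalised_def sets_R \<omega>)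
  show "subprob_space (normalised \<omega>)"
  proof
    have "ennreal (1 / (1 + mass \<omega>)) * ennreal (mass \<omega>) \<le> 1"
      using mass(2)[of \<omega>] by (auto simp: ennreal_mult[symmetric] divide_simps simp flip: ennreal_1 intro!: ennreal_leI)
    then show "emeasure (normalised \<omega>) (space (normalised \<omega>)) \<le> 1"
      using mass(1)[OF \<omega>] sets.top[of \<mu>]
      by (simp add: normalised_def emeasure_density_const space_R \<omega> sets_R)
    show "space (normalised \<omega>) \<noteq> {}" using nonempty by (simp add: normalised_def space_R \<omega>)
  qed
next
  fix A assume A: "A \<in> sets \<mu>"
  have "(\<lambda>\<omega>. ennreal (1 / (1 + mass \<omega>)) * emeasure (R \<omega>) A) \<in> borel_measurable G"
    using measurable_R[OF A] by measurable
  then show "(\<lambda>\<omega>. emeasure (normalised \<omega>) A) \<in> borel_measurable G"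
    by (subst measurable_cong) (auto simp: normalised_def emeasure_density_const sets_R A)
qed

lemma normalised_pair_kernel:
  "(\<lambda>(x, \<omega>). normalised \<omega>) \<in> measurable (X \<Otimes>\<^sub>M G) (subprob_algebra \<mu>)"
  using measurable_compose[OF measurable_snd normalised_kernel, of X] by (simp add: case_prod_unfold)

lemma integral_measurable:
  fixes f :: "'x \<Rightarrow> 'z \<Rightarrow> 'e::{banach, second_countable_topology}"
  assumes f[measurable]: "(\<lambda>(x, z). f x z) \<in> borel_measurable (X \<Otimes>\<^sub>M \<mu>)"
  shows "(\<lambda>(x, \<omega>). \<integral>z. f x z \<partial>R \<omega>) \<in> borel_measurable (X \<Otimes>\<^sub>M G)"
proof -
  have [measurable]: "(\<lambda>(p, z). f (fst p) z) \<in> borel_measurable ((X \<Otimes>\<^sub>M G) \<Otimes>\<^sub>M \<mu>)"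
    by measurable
  have 1: "(\<lambda>p. \<integral>z. f (fst p) z \<partial>(case p of (x, \<omega>) \<Rightarrow> normalised \<omega>)) \<in> borel_measurable (X \<Otimes>\<^sub>M G)"
    by (rule integral_kernel_measurable[OF _ normalised_pair_kernel]) measurable
  have "(\<lambda>p. (1 + mass (snd p)) *\<^sub>R (\<integral>z. f (fst p) z \<partial>(case p of (x, \<omega>) \<Rightarrow> normalised \<omega>)))
      \<in> borel_measurable (X \<Otimes>\<^sub>M G)"
    using 1 by measurable
  moreover have "(\<integral>z. f x z \<partial>R \<omega>) = (1 + mass \<omega>) *\<^sub>R (\<integral>z. f x z \<partial>normalised \<omega>)"
    if "x \<in> space X" "\<omega> \<in> space G" for x \<omega>
  proof -
    have [measurable]: "f x \<in> borel_measurable \<mu>"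
      using measurable_compose[OF measurable_Pair1'[OF that(1)] f] by simp
    have [measurable]: "f x \<in> borel_measurable (R \<omega>)"
      by (subst measurable_cong_sets[OF sets_R[OF that(2)] refl]) measurable
    have "(\<integral>z. f x z \<partial>normalised \<omega>) = (1 / (1 + mass \<omega>)) *\<^sub>R (\<integral>z. f x z \<partial>R \<omega>)"
      unfolding normalised_def using mass(2)[of \<omega>] by (subst integral_density) auto
    then show ?thesis using mass(2)[of \<omega>] by (simp add: add_nonneg_eq_0_iff)
  qed
  ultimately show ?thesis
    by (subst measurable_cong) (auto simp: space_pair_measure)
qed

lemma integral_measurable1[measurable (raw)]:
  fixes f :: "'z \<Rightarrow> 'e::{banach, second_countable_topology}"
  assumes "f \<in> borel_measurable \<mu>"
  shows "(\<lambda>\<omega>. \<integral>z. f z \<partial>R \<omega>) \<in> borel_measurable G"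
proof -
  have "(\<lambda>(x, \<omega>). \<integral>z. f z \<partial>R \<omega>) \<in> borel_measurable (count_space UNIV \<Otimes>\<^sub>M G)"
    by (rule integral_measurable) (use assms in measurable)
  from measurable_compose[OF measurable_Pair1' this, of undefined] show ?thesis by simp
qed

lemma nn_integral_measurable1[measurable (raw)]:
  assumes f[measurable]: "f \<in> borel_measurable \<mu>"
  shows "(\<lambda>\<omega>. \<integral>\<^sup>+z. f z \<partial>R \<omega>) \<in> borel_measurable G"
proof -
  have "(\<lambda>\<omega>. ennreal (1 + mass \<omega>) * (\<integral>\<^sup>+z. f z \<partial>normalised \<omega>)) \<in> borel_measurable G"
    using measurable_compose[OF normalised_kernel nn_integral_measurable_subprob_algebra[OF f]] by measurable
  moreover have "(\<integral>\<^sup>+z. f z \<partial>R \<omega>) = ennreal (1 + mass \<omega>) * (\<integral>\<^sup>+z. f z \<partial>normalised \<omega>)"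
    if \<omega>: "\<omega> \<in> space G" for \<omega>
  proof -
    have [measurable]: "f \<in> borel_measurable (R \<omega>)"
      by (subst measurable_cong_sets[OF sets_R[OF \<omega>] refl]) measurable
    have "ennreal (1 + mass \<omega>) * (\<integral>\<^sup>+z. f z \<partial>normalised \<omega>)
        = (ennreal (1 + mass \<omega>) * ennreal (1 / (1 + mass \<omega>))) * (\<integral>\<^sup>+z. f z \<partial>R \<omega>)"
      unfolding normalised_def by (subst nn_integral_density) (auto simp: nn_integral_cmult mult.assoc)
    also have "ennreal (1 + mass \<omega>) * ennreal (1 / (1 + mass \<omega>)) = 1"
      using mass(2)[of \<omega>] by (subst ennreal_mult[symmetric]) (auto simp: add_nonneg_eq_0_iff)
    finally show ?thesis by simp
  qed
  ultimately show ?thesis by (subst measurable_cong) auto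
qed

end

text \<open>
  Both moments reduce to the total mass of the Poisson distribution by the index shift
  \<open>Suc k * w (Suc k) = l * w k\<close>.
\<close>

lemma poisson_weights_sums:
  fixes l :: real
  defines "w \<equiv> \<lambda>k. l ^ k / fact k * exp (- l)"
  shows "w sums 1" "(\<lambda>k. real k * w k) sums l" "(\<lambda>k. (real k)\<^sup>2 * w k) sums (l\<^sup>2 + l)"
proof -
  show 0: "w sums 1"
    using sums_mult2[OF exp_converges[of l], of "exp (- l)"]
    by (simp add: w_def exp_minus field_simps)
  have step: "real (Suc k) * w (Suc k) = l * w k" for k
    by (simp add: w_def divide_simps del: of_nat_Suc)
  have "(\<lambda>k. real (Suc k) * w (Suc k)) sums l"
    unfolding step using sums_mult[OF 0, of l] by simp
  then show 1: "(\<lambda>k. real k * w k) sums l"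
    using sums_Suc_iff[of "\<lambda>k. real k * w k" l] by simp
  have "(real (Suc k))\<^sup>2 * w (Suc k) = l * (real k * w k) + l * w k" for k
  proof -
    have "(real (Suc k))\<^sup>2 * w (Suc k) = real (Suc k) * (l * w k)"
      unfolding step[symmetric] by (simp add: power2_eq_square mult_ac)
    then show ?thesis by (simp add: algebra_simps)
  qed
  then have "(\<lambda>k. (real (Suc k))\<^sup>2 * w (Suc k)) sums (l * l + l * 1)"
    using sums_add[OF sums_mult[OF 1, of l] sums_mult[OF 0, of l]] by simp
  then show "(\<lambda>k. (real k)\<^sup>2 * w k) sums (l\<^sup>2 + l)"
    using sums_Suc_iff[of "\<lambda>k. (real k)\<^sup>2 * w k" "l\<^sup>2 + l"] by (simp add: power2_eq_square)
qed

text \<open>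
  The Poisson weights sum to one, which leaves no mass for other values.
\<close>

lemma (in prob_space) AE_poisson_of_nat:
  assumes X[measurable]: "X \<in> borel_measurable M"
    and law: "\<And>k. prob {\<omega> \<in> space M. X \<omega> = of_nat k} = l ^ k / fact k * exp (- l)"
  shows "AE \<omega> in M. \<exists>k. X \<omega> = (of_nat k :: ennreal)"
proof -
  let ?E = "\<lambda>k. {\<omega> \<in> space M. X \<omega> = of_nat k}"
  have "(\<lambda>k. prob (?E k)) sums prob (\<Union>k. ?E k)"
    by (intro finite_measure_UNION) (auto simp: disjoint_family_on_def)
  then have "prob (\<Union>k. ?E k) = 1"
    using poisson_weights_sums(1)[of l] unfolding law by (rule sums_unique2)
  then have "AE \<omega> in M. \<omega> \<in> (\<Union>k. ?E k)"
    by (rule prob_Collect_eq_1[THEN iffD1, rotated] AE_prob_1)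
  then show ?thesis by (auto elim: eventually_mono)
qed

locale poisson_cloud = prob_space M + finite_random_measure M \<mu> R + \<mu>: finite_measure \<mu>
  for M :: "'w measure" and \<mu> :: "'z measure" and R :: "'w \<Rightarrow> 'z measure" +
  assumes poisson: "B \<in> sets \<mu> \<Longrightarrow>
      prob {\<omega> \<in> space M. emeasure (R \<omega>) B = of_nat k} = measure \<mu> B ^ k / fact k * exp (- measure \<mu> B)"
    and disjoint_indep: "\<lbrakk>\<And>i. i < n \<Longrightarrow> A i \<in> sets \<mu>; disjoint_family_on A {..<n}\<rbrakk> \<Longrightarrow>
      indep_vars (\<lambda>_. borel) (\<lambda>i \<omega>. emeasure (R \<omega>) (A i)) {..<n::nat}"
begin

lemma nn_integral_count:
  assumes B: "B \<in> sets \<mu>" and h[measurable]: "h \<in> borel_measurable borel"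
  shows "(\<integral>\<^sup>+\<omega>. h (emeasure (R \<omega>) B) \<partial>M)
    = (\<Sum>k. h (of_nat k) * ennreal (measure \<mu> B ^ k / fact k * exp (- measure \<mu> B)))"
proof -
  note [measurable] = measurable_R[OF B]
  let ?E = "\<lambda>k. {\<omega> \<in> space M. emeasure (R \<omega>) B = of_nat k}"
  have AE: "AE \<omega> in M. \<omega> \<in> (\<Union>k. ?E k)"
    using AE_poisson_of_nat[OF measurable_R[OF B] poisson[OF B]] AE_space by eventually_elim auto
  have "(\<integral>\<^sup>+\<omega>. h (emeasure (R \<omega>) B) \<partial>M) = (\<integral>\<^sup>+\<omega>. (\<Sum>k. h (of_nat k) * indicator (?E k) \<omega>) \<partial>M)"
  proof (intro nn_integral_cong_AE, use AE in eventually_elim)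
    case (elim \<omega>)
    then obtain j where j: "\<omega> \<in> ?E j" by blast
    then have "(\<Sum>k. h (of_nat k) * indicator (?E k) \<omega>) = (\<Sum>k\<in>{j}. h (of_nat k) * indicator (?E k) \<omega>)"
      by (intro suminf_finite) (auto simp: indicator_def)
    with j show ?case by simp
  qed
  also have "\<dots> = (\<Sum>k. \<integral>\<^sup>+\<omega>. h (of_nat k) * indicator (?E k) \<omega> \<partial>M)"
    by (rule nn_integral_suminf) measurable
  also have "\<dots> = (\<Sum>k. h (of_nat k) * emeasure M (?E k))"
    by (intro suminf_cong nn_integral_cmult_indicator) measurable
  finally show ?thesis by (simp add: emeasure_eq_measure poisson[OF B])
qed

lemma nn_integral_count_eq:
  assumes B: "B \<in> sets \<mu>"
  shows "(\<integral>\<^sup>+\<omega>. emeasure (R \<omega>) B \<partial>M) = emeasure \<mu> B"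
proof -
  let ?l = "measure \<mu> B"
  have "(\<integral>\<^sup>+\<omega>. emeasure (R \<omega>) B \<partial>M) = (\<Sum>k. ennreal (real k * (?l ^ k / fact k * exp (- ?l))))"
    by (subst nn_integral_count[OF B, of "\<lambda>x. x"]) (auto simp: ennreal_mult'[symmetric] ennreal_of_nat_eq_real_of_nat)
  also have "\<dots> = ennreal ?l"
    by (rule suminf_ennreal_eq[OF _ poisson_weights_sums(2)]) simp
  finally show ?thesis by (simp add: \<mu>.emeasure_eq_measure)
qed

text \<open>
  Campbell's formula holds for indicators by the mean of the Poisson distribution and extends by
  linearity and monotone limits.
\<close>

lemma campbell:
  assumes "f \<in> borel_measurable \<mu>"
  shows "(\<integral>\<^sup>+\<omega>. \<integral>\<^sup>+z. f z \<partial>R \<omega> \<partial>M) = (\<integral>\<^sup>+z. f z \<partial>\<mu>)"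
  using assms
proof (induction rule: borel_measurable_induct)
  case (cong f g)
  have "(\<integral>\<^sup>+z. f z \<partial>R \<omega>) = (\<integral>\<^sup>+z. g z \<partial>R \<omega>)" if "\<omega> \<in> space M" for \<omega>
    using cong(3) by (intro nn_integral_cong) (simp add: space_R that)
  then have "(\<integral>\<^sup>+\<omega>. \<integral>\<^sup>+z. f z \<partial>R \<omega> \<partial>M) = (\<integral>\<^sup>+\<omega>. \<integral>\<^sup>+z. g z \<partial>R \<omega> \<partial>M)"
    by (rule nn_integral_cong)
  moreover have "(\<integral>\<^sup>+z. f z \<partial>\<mu>) = (\<integral>\<^sup>+z. g z \<partial>\<mu>)"
    using cong(3) by (intro nn_integral_cong) auto
  ultimately show ?case using cong by simp
next
  case (set B)
  have "(\<integral>\<^sup>+\<omega>. \<integral>\<^sup>+z. indicator B z \<partial>R \<omega> \<partial>M) = (\<integral>\<^sup>+\<omega>. emeasure (R \<omega>) B \<partial>M)"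
    using set by (intro nn_integral_cong) (auto simp: sets_R)
  with set show ?case by (simp add: nn_integral_count_eq)
next
  case (mult u c)
  have "(\<integral>\<^sup>+\<omega>. \<integral>\<^sup>+z. c * u z \<partial>R \<omega> \<partial>M) = (\<integral>\<^sup>+\<omega>. c * (\<integral>\<^sup>+z. u z \<partial>R \<omega>) \<partial>M)"
    using mult(2) by (intro nn_integral_cong nn_integral_cmult) (auto simp: sets_R cong: measurable_cong_sets)
  with mult show ?case by (simp add: nn_integral_cmult)
next
  case (add u v)
  have "(\<integral>\<^sup>+\<omega>. \<integral>\<^sup>+z. v z + u z \<partial>R \<omega> \<partial>M) = (\<integral>\<^sup>+\<omega>. (\<integral>\<^sup>+z. v z \<partial>R \<omega>) + (\<integral>\<^sup>+z. u z \<partial>R \<omega>) \<partial>M)"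
    using add(1,3) by (intro nn_integral_cong nn_integral_add) (auto simp: sets_R cong: measurable_cong_sets)
  with add show ?case by (simp add: nn_integral_add)
next
  case (seq U)
  have meas: "U i \<in> borel_measurable (R \<omega>)" if "\<omega> \<in> space M" for i \<omega>
    using seq(1) that by (auto simp: sets_R cong: measurable_cong_sets)
  have "(\<integral>\<^sup>+\<omega>. \<integral>\<^sup>+z. (SUP i. U i) z \<partial>R \<omega> \<partial>M) = (\<integral>\<^sup>+\<omega>. (SUP i. \<integral>\<^sup>+z. U i z \<partial>R \<omega>) \<partial>M)"
    using seq(3) meas
    by (intro nn_integral_cong) (simp add: nn_integral_monotone_convergence_SUP image_comp)
  also have "\<dots> = (SUP i. \<integral>\<^sup>+\<omega>. \<integral>\<^sup>+z. U i z \<partial>R \<omega> \<partial>M)"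
    using seq(1,3)
    by (intro nn_integral_monotone_convergence_SUP)
      (auto simp: mono_def le_fun_def intro!: nn_integral_mono)
  also have "\<dots> = (SUP i. \<integral>\<^sup>+z. U i z \<partial>\<mu>)"
    using seq by simp
  also have "\<dots> = (\<integral>\<^sup>+z. (SUP i. U i) z \<partial>\<mu>)"
    using seq(1,3) by (simp add: nn_integral_monotone_convergence_SUP image_comp)
  finally show ?case .
qed

lemma AE_integrable:
  fixes g :: "'z \<Rightarrow> 'e::{banach, second_countable_topology}"
  assumes g: "integrable \<mu> g"
  shows "AE \<omega> in M. integrable (R \<omega>) g"
proof -
  have [measurable]: "g \<in> borel_measurable \<mu>" using g by simp
  have "(\<integral>\<^sup>+\<omega>. \<integral>\<^sup>+z. norm (g z) \<partial>R \<omega> \<partial>M) \<noteq> \<infinity>"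
    using g by (subst campbell) (auto simp: integrable_iff_bounded)
  then have "AE \<omega> in M. (\<integral>\<^sup>+z. norm (g z) \<partial>R \<omega>) \<noteq> \<infinity>"
    by (intro nn_integral_PInf_AE) measurable
  then show ?thesis
    using AE_space
  proof eventually_elim
    case (elim \<omega>)
    then show ?case
      by (auto simp: integrable_iff_bounded less_top sets_R cong: measurable_cong_sets)
  qed
qed

lemma
  fixes g :: "'z \<Rightarrow> real"
  assumes g: "integrable \<mu> g"
  shows integrable_integral: "integrable M (\<lambda>\<omega>. \<integral>z. g z \<partial>R \<omega>)"
    and expectation_integral: "(\<integral>\<omega>. (\<integral>z. g z \<partial>R \<omega>) \<partial>M) = (\<integral>z. g z \<partial>\<mu>)"
proof -
  have nonneg: "has_bochner_integral M (\<lambda>\<omega>. \<integral>z. h z \<partial>R \<omega>) (\<integral>z. h z \<partial>\<mu>)"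
    if h: "integrable \<mu> h" "\<And>z. 0 \<le> h z" for h :: "'z \<Rightarrow> real"
  proof (rule has_bochner_integral_nn_integral)
    have [measurable]: "h \<in> borel_measurable \<mu>" using h by simp
    show "(\<lambda>\<omega>. \<integral>z. h z \<partial>R \<omega>) \<in> borel_measurable M" by measurable
    have "(\<integral>\<^sup>+\<omega>. (\<integral>z. h z \<partial>R \<omega>) \<partial>M) = (\<integral>\<^sup>+\<omega>. \<integral>\<^sup>+z. h z \<partial>R \<omega> \<partial>M)"
    proof (intro nn_integral_cong_AE, use AE_integrable[OF h(1)] in eventually_elim)
      case (elim \<omega>)
      then show ?case using h(2) by (simp add: nn_integral_eq_integral)
    qed
    also have "\<dots> = ennreal (\<integral>z. h z \<partial>\<mu>)"
      using h by (subst campbell) (auto simp: nn_integral_eq_integral)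
    finally show "(\<integral>\<^sup>+\<omega>. (\<integral>z. h z \<partial>R \<omega>) \<partial>M) = ennreal (\<integral>z. h z \<partial>\<mu>)" .
  qed (use h in \<open>auto intro!: integral_nonneg_AE\<close>)
  let ?p = "\<lambda>z. max 0 (g z)" and ?m = "\<lambda>z. max 0 (- g z)"
  have pm: "integrable \<mu> ?p" "integrable \<mu> ?m" using g by auto
  have "has_bochner_integral M (\<lambda>\<omega>. (\<integral>z. ?p z \<partial>R \<omega>) - (\<integral>z. ?m z \<partial>R \<omega>)) ((\<integral>z. ?p z \<partial>\<mu>) - (\<integral>z. ?m z \<partial>\<mu>))"
    by (intro has_bochner_integral_diff nonneg pm) auto
  moreover have "(\<integral>z. ?p z \<partial>\<mu>) - (\<integral>z. ?m z \<partial>\<mu>) = (\<integral>z. g z \<partial>\<mu>)"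
    unfolding Bochner_Integration.integral_diff[OF pm, symmetric]
    by (rule Bochner_Integration.integral_cong) auto
  moreover have "AE \<omega> in M. (\<integral>z. ?p z \<partial>R \<omega>) - (\<integral>z. ?m z \<partial>R \<omega>) = (\<integral>z. g z \<partial>R \<omega>)"
    using AE_integrable[OF pm(1)] AE_integrable[OF pm(2)]
  proof eventually_elim
    case (elim \<omega>)
    then show ?case
      unfolding Bochner_Integration.integral_diff[OF elim, symmetric]
      by (intro Bochner_Integration.integral_cong) auto
  qed
  moreover have "(\<lambda>\<omega>. \<integral>z. g z \<partial>R \<omega>) \<in> borel_measurable M" using g by measurable
  ultimately have "has_bochner_integral M (\<lambda>\<omega>. \<integral>z. g z \<partial>R \<omega>) (\<integral>z. g z \<partial>\<mu>)"
    by (subst has_bochner_integral_cong_AE[symmetric]) auto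
  then show "integrable M (\<lambda>\<omega>. \<integral>z. g z \<partial>R \<omega>)" "(\<integral>\<omega>. (\<integral>z. g z \<partial>R \<omega>) \<partial>M) = (\<integral>z. g z \<partial>\<mu>)"
    by (auto simp: has_bochner_integral_iff)
qed

lemma count_moments:
  assumes B: "B \<in> sets \<mu>"
  defines "X \<equiv> \<lambda>\<omega>. measure (R \<omega>) B - measure \<mu> B"
  shows "integrable M X" "expectation X = 0" "integrable M (\<lambda>\<omega>. (X \<omega>)\<^sup>2)" "expectation (\<lambda>\<omega>. (X \<omega>)\<^sup>2) = measure \<mu> B"
proof -
  let ?l = "measure \<mu> B" and ?n = "\<lambda>\<omega>. measure (R \<omega>) B"
  note [measurable] = measurable_R[OF B]
  have [measurable]: "?n \<in> borel_measurable M" unfolding measure_def by measurable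
  have moment: "has_bochner_integral M (\<lambda>\<omega>. ?n \<omega> ^ p) c"
    if "(\<lambda>k. real k ^ p * (?l ^ k / fact k * exp (- ?l))) sums c" for p c
  proof (rule has_bochner_integral_nn_integral)
    have "(\<integral>\<^sup>+\<omega>. ennreal (?n \<omega> ^ p) \<partial>M)
        = (\<Sum>k. ennreal (enn2real (of_nat k) ^ p) * ennreal (?l ^ k / fact k * exp (- ?l)))"
      unfolding measure_def[of "R _"]
      by (rule nn_integral_count[OF B, of "\<lambda>x. ennreal (enn2real x ^ p)"]) measurable
    also have "\<dots> = (\<Sum>k. ennreal (real k ^ p * (?l ^ k / fact k * exp (- ?l))))"
      by (intro suminf_cong) (subst ennreal_mult', auto simp: ennreal_of_nat_eq_real_of_nat)
    also have "\<dots> = ennreal c" by (rule suminf_ennreal_eq[OF _ that]) simp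
    finally show "(\<integral>\<^sup>+\<omega>. ennreal (?n \<omega> ^ p) \<partial>M) = ennreal c" .
    have "0 \<le> (\<Sum>k. real k ^ p * (?l ^ k / fact k * exp (- ?l)))"
      using that by (intro suminf_nonneg) (auto simp: sums_iff)
    then show "0 \<le> c" using that by (simp add: sums_iff)
  qed auto
  have 1: "has_bochner_integral M ?n ?l"
    using moment[of 1] poisson_weights_sums(2)[of ?l] by simp
  have 2: "has_bochner_integral M (\<lambda>\<omega>. (?n \<omega>)\<^sup>2) (?l\<^sup>2 + ?l)"
    using moment[of 2] poisson_weights_sums(3)[of ?l] by simp
  show "integrable M X" "expectation X = 0"
    using 1 by (auto simp: X_def has_bochner_integral_iff prob_space)
  have "has_bochner_integral M (\<lambda>\<omega>. (?n \<omega>)\<^sup>2 - 2 * ?l * ?n \<omega> + ?l\<^sup>2) (?l\<^sup>2 + ?l - 2 * ?l * ?l + ?l\<^sup>2)"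
    using 1 2 by (auto simp: has_bochner_integral_iff prob_space)
  moreover have "(?n \<omega>)\<^sup>2 - 2 * ?l * ?n \<omega> + ?l\<^sup>2 = (X \<omega>)\<^sup>2" for \<omega>
    by (simp add: X_def power2_eq_square algebra_simps)
  ultimately show "integrable M (\<lambda>\<omega>. (X \<omega>)\<^sup>2)" "expectation (\<lambda>\<omega>. (X \<omega>)\<^sup>2) = ?l"
    by (auto simp: has_bochner_integral_iff power2_eq_square)
qed

text \<open>
  A simple integrand is constant on finitely many disjoint sets, whose counts are independent;
  the mixed terms vanish and the variance of each count is its intensity.
\<close>

lemma compensated_second_moment_simple:
  fixes g :: "'z \<Rightarrow> real"
  assumes "simple_function \<mu> g"
  shows "(\<integral>\<^sup>+\<omega>. ennreal (((\<integral>z. g z \<partial>R \<omega>) - (\<integral>z. g z \<partial>\<mu>))\<^sup>2) \<partial>M) = ennreal (\<integral>z. (g z)\<^sup>2 \<partial>\<mu>)"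
proof -
  obtain n :: nat and A y where A: "\<And>i. i < n \<Longrightarrow> A i \<in> sets \<mu>" and disj: "disjoint_family_on A {..<n}"
    and g: "\<And>z. z \<in> space \<mu> \<Longrightarrow> g z = (\<Sum>i<n. indicator (A i) z *\<^sub>R y i)"
    using simple_function_disjoint_representation[OF assms] by metis
  define X where "X i \<omega> = y i * (measure (R \<omega>) (A i) - measure \<mu> (A i))" for i \<omega>
  have X: "integrable M (X i)" "expectation (X i) = 0" "integrable M (\<lambda>\<omega>. (X i \<omega>)\<^sup>2)"
    "expectation (\<lambda>\<omega>. (X i \<omega>)\<^sup>2) = (y i)\<^sup>2 * measure \<mu> (A i)" if "i < n" for i
    using count_moments[OF A[OF that]] by (auto simp: X_def[abs_def] power_mult_distrib)
  have "indep_vars (\<lambda>_. borel) (\<lambda>i \<omega>. emeasure (R \<omega>) (A i)) {..<n}"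
    using A disj by (rule disjoint_indep)
  from indep_vars_compose2[OF this, of "\<lambda>i x. y i * (enn2real x - measure \<mu> (A i))" "\<lambda>_. borel"]
  have indep: "indep_vars (\<lambda>_. borel) X {..<n}"
    by (simp add: X_def[abs_def] measure_def)
  have cross: "has_bochner_integral M (\<lambda>\<omega>. X i \<omega> * X j \<omega>) (if i = j then (y i)\<^sup>2 * measure \<mu> (A i) else 0)"
    if ij: "i < n" "j < n" for i j
  proof (cases "i = j")
    case True
    then show ?thesis using X(3,4)[OF ij(1)] by (simp add: has_bochner_integral_iff power2_eq_square)
  next
    case False
    have ind: "indep_vars (\<lambda>_. borel) X {i, j}" by (rule indep_vars_subset[OF indep]) (use ij in auto)
    have int: "integrable M (X k)" if "k \<in> {i, j}" for k using X(1) ij that by auto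
    show ?thesis
      using indep_vars_integrable[OF _ ind int] indep_vars_lebesgue_integral[OF _ ind int] False X(2) ij
      by (simp add: has_bochner_integral_iff)
  qed
  have comp: "(\<integral>z. g z \<partial>R \<omega>) - (\<integral>z. g z \<partial>\<mu>) = (\<Sum>i<n. X i \<omega>)" if \<omega>: "\<omega> \<in> space M" for \<omega>
  proof -
    interpret R: finite_measure "R \<omega>" by (rule finite_R[OF \<omega>])
    have "(\<integral>z. g z \<partial>R \<omega>) = (\<Sum>i<n. measure (R \<omega>) (A i) *\<^sub>R y i)"
      by (rule R.integral_disjoint_representation) (auto simp: A sets_R[OF \<omega>] g space_R[OF \<omega>])
    moreover have "(\<integral>z. g z \<partial>\<mu>) = (\<Sum>i<n. measure \<mu> (A i) *\<^sub>R y i)"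
      by (rule \<mu>.integral_disjoint_representation) (auto simp: A g)
    ultimately show ?thesis by (simp add: X_def sum_subtractf algebra_simps)
  qed
  have "has_bochner_integral M (\<lambda>\<omega>. \<Sum>i<n. \<Sum>j<n. X i \<omega> * X j \<omega>)
      (\<Sum>i<n. \<Sum>j<n. if i = j then (y i)\<^sup>2 * measure \<mu> (A i) else 0)"
    by (intro has_bochner_integral_sum cross) auto
  moreover have "(\<Sum>i<n. \<Sum>j<n. X i \<omega> * X j \<omega>) = (\<Sum>i<n. X i \<omega>)\<^sup>2" for \<omega>
    by (simp add: power2_eq_square sum_product)
  ultimately have "has_bochner_integral M (\<lambda>\<omega>. (\<Sum>i<n. X i \<omega>)\<^sup>2) (\<Sum>i<n. (y i)\<^sup>2 * measure \<mu> (A i))"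
    by simp
  then have lhs: "(\<integral>\<^sup>+\<omega>. ennreal ((\<Sum>i<n. X i \<omega>)\<^sup>2) \<partial>M) = ennreal (\<Sum>i<n. (y i)\<^sup>2 * measure \<mu> (A i))"
    by (simp add: has_bochner_integral_iff nn_integral_eq_integral)
  have "(g z)\<^sup>2 = (\<Sum>i<n. indicator (A i) z *\<^sub>R (y i)\<^sup>2)" if "z \<in> space \<mu>" for z
  proof (cases "\<exists>i<n. z \<in> A i")
    case True
    then obtain i where i: "i < n" "z \<in> A i" by blast
    have "indicator (A j) z *\<^sub>R c = (if j = i then c else 0)" if "j < n" for j and c :: real
      using disj i that by (auto simp: disjoint_family_on_def indicator_def)
    then have "(\<Sum>j<n. indicator (A j) z *\<^sub>R c j) = c i" for c :: "nat \<Rightarrow> real"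
      using i by (simp cong: sum.cong_simp)
    then show ?thesis by (simp only: g[OF that])
  qed (simp add: g[OF that] indicator_def)
  then have "(\<integral>z. (g z)\<^sup>2 \<partial>\<mu>) = (\<Sum>i<n. measure \<mu> (A i) *\<^sub>R (y i)\<^sup>2)"
    by (intro \<mu>.integral_disjoint_representation) (auto simp: A)
  with lhs show ?thesis by (simp add: comp mult.commute cong: nn_integral_cong)
qed

lemma AE_integral_tendsto:
  fixes g :: "'z \<Rightarrow> 'e::{banach, second_countable_topology}"
  assumes g: "integrable \<mu> g" and s: "\<And>k. simple_function \<mu> (s k)"
    "\<And>k z. z \<in> space \<mu> \<Longrightarrow> norm (s k z) \<le> 2 * norm (g z)"
    "\<And>z. z \<in> space \<mu> \<Longrightarrow> (\<lambda>k. s k z) \<longlonglongrightarrow> g z"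
  shows "AE \<omega> in M. (\<lambda>k. \<integral>z. s k z \<partial>R \<omega>) \<longlonglongrightarrow> (\<integral>z. g z \<partial>R \<omega>)"
  using AE_integrable[OF g] AE_space
proof eventually_elim
  case (elim \<omega>)
  have "s k \<in> borel_measurable (R \<omega>)" for k
    using borel_measurable_simple_function[OF s(1)]
    by (subst measurable_cong_sets[OF sets_R[OF elim(2)] refl])
  with elim s show ?case
    by (intro integral_dominated_convergence[where w="\<lambda>z. 2 * norm (g z)"]) (auto simp: space_R)
qed

text \<open>
  Fatou's lemma along simple approximations; this gives an inequality where the isometry for
  simple integrands has an equality.
\<close>

lemma compensated_second_moment:
  fixes g :: "'z \<Rightarrow> real"
  assumes g: "integrable \<mu> g" and g2: "integrable \<mu> (\<lambda>z. (g z)\<^sup>2)"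
  shows "(\<integral>\<^sup>+\<omega>. ennreal (((\<integral>z. g z \<partial>R \<omega>) - (\<integral>z. g z \<partial>\<mu>))\<^sup>2) \<partial>M) \<le> ennreal (\<integral>z. (g z)\<^sup>2 \<partial>\<mu>)"
proof -
  have [measurable]: "g \<in> borel_measurable \<mu>" using g by simp
  from borel_measurable_implies_sequence_metric[OF this, of 0]
  obtain s where s: "\<And>k. simple_function \<mu> (s k)" "\<And>k z. z \<in> space \<mu> \<Longrightarrow> norm (s k z) \<le> 2 * norm (g z)"
    "\<And>z. z \<in> space \<mu> \<Longrightarrow> (\<lambda>k. s k z) \<longlonglongrightarrow> g z"
    unfolding norm_conv_dist by blast
  have [measurable]: "s k \<in> borel_measurable \<mu>" for k
    by (rule borel_measurable_simple_function[OF s(1)])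
  have lim_\<mu>: "(\<lambda>k. \<integral>z. s k z \<partial>\<mu>) \<longlonglongrightarrow> (\<integral>z. g z \<partial>\<mu>)"
    by (rule integral_dominated_convergence[where w="\<lambda>z. 2 * norm (g z)"]) (use g s in auto)
  have lim_R: "AE \<omega> in M. (\<lambda>k. \<integral>z. s k z \<partial>R \<omega>) \<longlonglongrightarrow> (\<integral>z. g z \<partial>R \<omega>)"
    using s by (intro AE_integral_tendsto[OF g])
  let ?I = "\<lambda>h \<omega>. ennreal (((\<integral>z. h z \<partial>R \<omega>) - (\<integral>z. h z \<partial>\<mu>))\<^sup>2)"
  have sq_le: "(s k z)\<^sup>2 \<le> 4 * (g z)\<^sup>2" if "z \<in> space \<mu>" for k z
    using power_mono[OF s(2)[OF that, of k], of 2] by (simp add: power_mult_distrib)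
  have "(\<lambda>k. \<integral>z. (s k z)\<^sup>2 \<partial>\<mu>) \<longlonglongrightarrow> (\<integral>z. (g z)\<^sup>2 \<partial>\<mu>)"
    by (rule integral_dominated_convergence[where w="\<lambda>z. 4 * (g z)\<^sup>2"])
      (use g2 s(3) sq_le in \<open>auto intro!: tendsto_intros\<close>)
  then have lim: "(\<lambda>k. ennreal (\<integral>z. (s k z)\<^sup>2 \<partial>\<mu>)) \<longlonglongrightarrow> ennreal (\<integral>z. (g z)\<^sup>2 \<partial>\<mu>)"
    by (rule tendsto_ennrealI)
  have "(\<integral>\<^sup>+\<omega>. ?I g \<omega> \<partial>M) = (\<integral>\<^sup>+\<omega>. liminf (\<lambda>k. ?I (s k) \<omega>) \<partial>M)"
  proof (intro nn_integral_cong_AE, use lim_R in eventually_elim)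
    case (elim \<omega>)
    have "(\<lambda>k. ?I (s k) \<omega>) \<longlonglongrightarrow> ?I g \<omega>"
      by (intro tendsto_ennrealI tendsto_intros elim lim_\<mu>)
    then show ?case by (rule lim_imp_Liminf[OF sequentially_bot, symmetric])
  qed
  also have "\<dots> \<le> liminf (\<lambda>k. \<integral>\<^sup>+\<omega>. ?I (s k) \<omega> \<partial>M)"
    by (rule nn_integral_liminf) measurable
  also have "\<dots> = ennreal (\<integral>z. (g z)\<^sup>2 \<partial>\<mu>)"
    unfolding compensated_second_moment_simple[OF s(1)] using lim by (rule lim_imp_Liminf[OF sequentially_bot])
  finally show ?thesis .
qed

end

text \<open>
  For a simple integrand the integral is a fixed function of the counts of disjoint sets, and their
  joint law is the product of Poisson distributions determined by \<open>\<mu>\<close>.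
\<close>

lemma poisson_cloud_integral_law_simple:
  fixes g :: "'z \<Rightarrow> 'e::{banach, second_countable_topology}"
  assumes "poisson_cloud M \<mu> R" "poisson_cloud M' \<mu> R'" and "simple_function \<mu> g"
  shows "distr M borel (\<lambda>\<omega>. \<integral>z. g z \<partial>R \<omega>) = distr M' borel (\<lambda>\<omega>. \<integral>z. g z \<partial>R' \<omega>)"
proof -
  obtain n :: nat and A y where A: "\<And>i. i < n \<Longrightarrow> A i \<in> sets \<mu>" and disj: "disjoint_family_on A {..<n}"
    and g: "\<And>z. z \<in> space \<mu> \<Longrightarrow> g z = (\<Sum>i<n. indicator (A i) z *\<^sub>R y i)"
    using simple_function_disjoint_representation[OF assms(3)] by metis
  define T :: "(nat \<Rightarrow> ennreal) \<Rightarrow> 'e" where "T v = (\<Sum>i<n. enn2real (v i) *\<^sub>R y i)" for v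
  have [measurable]: "T \<in> borel_measurable (\<Pi>\<^sub>M i\<in>{..<n}. borel)"
    unfolding T_def by measurable
  define Q where "Q i = distr M borel (\<lambda>\<omega>. emeasure (R \<omega>) (A i))" for i
  have law: "distr N borel (\<lambda>\<omega>. \<integral>z. g z \<partial>S \<omega>) = distr (\<Pi>\<^sub>M i\<in>{..<n}. Q i) borel T"
    if "poisson_cloud N \<mu> S" for N :: "'x measure" and S
  proof -
    interpret S: poisson_cloud N \<mu> S by fact
    interpret R: poisson_cloud M \<mu> R by fact
    let ?V = "\<lambda>\<omega>. \<lambda>i\<in>{..<n}. emeasure (S \<omega>) (A i)"
    have Q: "Q i = distr N borel (\<lambda>\<omega>. emeasure (S \<omega>) (A i))" if i: "i < n" for i
    proof (rule measure_eqI)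
      fix B assume "B \<in> sets (Q i)"
      then have B[measurable]: "B \<in> sets borel" by (simp add: Q_def)
      note [measurable] = S.measurable_R[OF A[OF i]] R.measurable_R[OF A[OF i]]
      have "emeasure (Q i) B = (\<integral>\<^sup>+x. indicator B x \<partial>Q i)"
        by (simp add: Q_def)
      also have "\<dots> = (\<integral>\<^sup>+\<omega>. indicator B (emeasure (R \<omega>) (A i)) \<partial>M)"
        unfolding Q_def by (rule nn_integral_distr) measurable
      also have "\<dots> = (\<integral>\<^sup>+\<omega>. indicator B (emeasure (S \<omega>) (A i)) \<partial>N)"
        using A[OF i] by (simp add: R.nn_integral_count S.nn_integral_count)
      also have "\<dots> = (\<integral>\<^sup>+x. indicator B x \<partial>distr N borel (\<lambda>\<omega>. emeasure (S \<omega>) (A i)))"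
        by (rule nn_integral_distr[symmetric]) measurable
      also have "\<dots> = emeasure (distr N borel (\<lambda>\<omega>. emeasure (S \<omega>) (A i))) B"
        by simp
      finally show "emeasure (Q i) B = emeasure (distr N borel (\<lambda>\<omega>. emeasure (S \<omega>) (A i))) B" .
    qed (simp add: Q_def)
    have V: "?V \<in> measurable N (\<Pi>\<^sub>M i\<in>{..<n}. borel)"
      by (intro measurable_restrict S.measurable_R A) auto
    have joint: "distr N (\<Pi>\<^sub>M i\<in>{..<n}. borel) ?V = (\<Pi>\<^sub>M i\<in>{..<n}. Q i)"
    proof (cases "n = 0")
      case False
      then have "distr N (\<Pi>\<^sub>M i\<in>{..<n}. borel) ?V = (\<Pi>\<^sub>M i\<in>{..<n}. distr N borel (\<lambda>\<omega>. emeasure (S \<omega>) (A i)))"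
        using A disj
        by (intro S.indep_vars_iff_distr_eq_PiM'[THEN iffD1] S.disjoint_indep) (auto intro!: S.measurable_R)
      also have "\<dots> = (\<Pi>\<^sub>M i\<in>{..<n}. Q i)" by (intro PiM_cong) (auto simp: Q)
      finally show ?thesis .
    next
      case True
      show ?thesis
      proof (rule measure_eqI)
        fix B assume "B \<in> sets (distr N (\<Pi>\<^sub>M i\<in>{..<n}. borel) ?V)"
        then have "B \<in> sets (PiM {} (\<lambda>i. borel :: ennreal measure))" using True by simp
        then have "B = {} \<or> B = {\<lambda>_. undefined}" by (simp add: sets_PiM_empty)
        then show "emeasure (distr N (\<Pi>\<^sub>M i\<in>{..<n}. borel) ?V) B = emeasure (\<Pi>\<^sub>M i\<in>{..<n}. Q i) B"
          using True V by (auto simp: emeasure_distr PiM_empty S.emeasure_space_1 restrict_def)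
      qed (use True in \<open>simp add: sets_PiM_empty\<close>)
    qed
    have "distr N borel (\<lambda>\<omega>. \<integral>z. g z \<partial>S \<omega>) = distr N borel (\<lambda>\<omega>. T (?V \<omega>))"
    proof (rule distr_cong)
      fix \<omega> assume \<omega>: "\<omega> \<in> space N"
      interpret S\<omega>: finite_measure "S \<omega>" by (rule S.finite_R[OF \<omega>])
      have "(\<integral>z. g z \<partial>S \<omega>) = (\<Sum>i<n. measure (S \<omega>) (A i) *\<^sub>R y i)"
        by (rule S\<omega>.integral_disjoint_representation) (auto simp: A S.sets_R[OF \<omega>] g S.space_R[OF \<omega>])
      then show "(\<integral>z. g z \<partial>S \<omega>) = T (?V \<omega>)" by (simp add: T_def measure_def)
    qed simp_all
    also have "\<dots> = distr (distr N (\<Pi>\<^sub>M i\<in>{..<n}. borel) ?V) borel T"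
      by (subst distr_distr) (auto simp: V comp_def)
    finally show ?thesis by (simp only: joint)
  qed
  show ?thesis by (simp only: law[OF assms(1)] law[OF assms(2)])
qed

text \<open>
  The laws agree for simple approximations, and almost sure convergence passes this on to
  the limit when tested against bounded continuous functions.
\<close>

lemma poisson_cloud_integral_law:
  fixes g :: "'z \<Rightarrow> 'e::{banach, second_countable_topology}"
  assumes cloud: "poisson_cloud M \<mu> R" "poisson_cloud M' \<mu> R'" and g: "integrable \<mu> g"
  shows "distr M borel (\<lambda>\<omega>. \<integral>z. g z \<partial>R \<omega>) = distr M' borel (\<lambda>\<omega>. \<integral>z. g z \<partial>R' \<omega>)"
proof -
  have [measurable]: "g \<in> borel_measurable \<mu>" using g by simp
  from borel_measurable_implies_sequence_metric[OF this, of 0]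
  obtain s where s: "\<And>k. simple_function \<mu> (s k)" "\<And>k z. z \<in> space \<mu> \<Longrightarrow> norm (s k z) \<le> 2 * norm (g z)"
    "\<And>z. z \<in> space \<mu> \<Longrightarrow> (\<lambda>k. s k z) \<longlonglongrightarrow> g z"
    unfolding norm_conv_dist by blast
  have [measurable]: "s k \<in> borel_measurable \<mu>" for k
    by (rule borel_measurable_simple_function[OF s(1)])
  have lim: "(\<lambda>k. \<integral>\<^sup>+x. ennreal (\<phi> x) \<partial>distr N borel (\<lambda>\<omega>. \<integral>z. s k z \<partial>S \<omega>))
      \<longlonglongrightarrow> (\<integral>\<^sup>+x. ennreal (\<phi> x) \<partial>distr N borel (\<lambda>\<omega>. \<integral>z. g z \<partial>S \<omega>))"
    if "poisson_cloud N \<mu> S" and cont: "continuous_on UNIV \<phi>" and bd: "\<And>x. \<phi> x \<le> 1"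
    for N :: "'x measure" and S and \<phi> :: "'e \<Rightarrow> real"
  proof -
    interpret S: poisson_cloud N \<mu> S by fact
    have [measurable]: "\<phi> \<in> borel_measurable borel"
      using cont by (rule borel_measurable_continuous_onI)
    have lim_S: "AE \<omega> in N. (\<lambda>k. \<integral>z. s k z \<partial>S \<omega>) \<longlonglongrightarrow> (\<integral>z. g z \<partial>S \<omega>)"
      using s by (intro S.AE_integral_tendsto[OF g])
    have "(\<lambda>k. \<integral>\<^sup>+\<omega>. ennreal (\<phi> (\<integral>z. s k z \<partial>S \<omega>)) \<partial>N) \<longlonglongrightarrow> (\<integral>\<^sup>+\<omega>. ennreal (\<phi> (\<integral>z. g z \<partial>S \<omega>)) \<partial>N)"
    proof (rule nn_integral_dominated_convergence[where w="\<lambda>_. 1"])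
      show "AE \<omega> in N. (\<lambda>k. ennreal (\<phi> (\<integral>z. s k z \<partial>S \<omega>))) \<longlonglongrightarrow> ennreal (\<phi> (\<integral>z. g z \<partial>S \<omega>))"
        using lim_S
      proof eventually_elim
        case (elim \<omega>)
        then show ?case
          by (intro tendsto_ennrealI continuous_on_tendsto_compose[OF cont]) auto
      qed
    qed (use bd in \<open>auto simp: S.emeasure_space_1\<close>)
    then show ?thesis by (simp add: nn_integral_distr)
  qed
  interpret R: poisson_cloud M \<mu> R by fact
  interpret R': poisson_cloud M' \<mu> R' by fact
  show ?thesis
  proof (rule measure_eqI_lipschitz)
    fix \<phi> :: "'e \<Rightarrow> real" assume "\<exists>C. C-lipschitz_on UNIV \<phi>" and bd: "\<And>x. 0 \<le> \<phi> x \<and> \<phi> x \<le> 1"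
    then have cont: "continuous_on UNIV \<phi>" using lipschitz_on_continuous_on by blast
    show "(\<integral>\<^sup>+x. ennreal (\<phi> x) \<partial>distr M borel (\<lambda>\<omega>. \<integral>z. g z \<partial>R \<omega>))
        = (\<integral>\<^sup>+x. ennreal (\<phi> x) \<partial>distr M' borel (\<lambda>\<omega>. \<integral>z. g z \<partial>R' \<omega>))"
      using lim[OF cloud(1) cont] lim[OF cloud(2) cont] bd
      unfolding poisson_cloud_integral_law_simple[OF cloud s(1)] by (meson LIMSEQ_unique)
  qed (auto intro!: R.prob_space_distr R'.prob_space_distr)
qed

section \<open>Moments of Gaussian vectors and of independent sums\<close>

text \<open>
  Lebesgue measure on \<open>real ^ 'm\<close> is the image of the product measure indexed by the standard basis.
\<close>

lemma
  fixes u :: "'m::finite \<Rightarrow> real \<Rightarrow> real"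
  assumes u: "\<And>i. integrable lborel (u i)"
  shows integrable_prod_components: "integrable lborel (\<lambda>x::real ^ 'm. \<Prod>i\<in>UNIV. u i (x $ i))"
    and integral_prod_components: "(\<integral>x. (\<Prod>i\<in>UNIV. u i ((x :: real ^ 'm) $ i)) \<partial>lborel) = (\<Prod>i\<in>UNIV. (\<integral>t. u i t \<partial>lborel))"
proof -
  interpret product_sigma_finite "\<lambda>_::real ^ 'm. lborel :: real measure" by unfold_locales
  let ?e = "\<lambda>i. axis i 1 :: real ^ 'm"
  let ?P = "\<Pi>\<^sub>M b\<in>(Basis :: (real ^ 'm) set). (lborel :: real measure)"
  let ?S = "\<lambda>f. \<Sum>b\<in>Basis. f b *\<^sub>R b :: real ^ 'm"
  have inj: "inj ?e" by (simp add: inj_on_def axis_eq_axis)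
  have Basis: "(Basis :: (real ^ 'm) set) = range ?e" by (auto simp: Basis_vec_def)
  define v where "v b = u (inv ?e b)" for b
  have v: "v (?e i) = u i" for i by (simp add: v_def inv_f_f[OF inj])
  have prod: "(\<Prod>b\<in>Basis. h b) = (\<Prod>i\<in>UNIV. h (?e i))" for h :: "real ^ 'm \<Rightarrow> real"
    unfolding Basis by (rule prod.reindex[OF inj, unfolded comp_def])
  have coord: "?S f $ i = f (?e i)" for f i
  proof -
    have "?S f $ i = ?S f \<bullet> ?e i" by (rule cart_eq_inner_axis)
    also have "\<dots> = f (?e i)" by (rule inner_sum_left_Basis) (simp add: Basis)
    finally show ?thesis .
  qed
  have [measurable]: "u i \<in> borel_measurable borel" for i
    using u[of i] by (auto dest: borel_measurable_integrable)
  have S[measurable]: "?S \<in> borel_measurable ?P" by measurable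
  have meas[measurable]: "(\<lambda>x::real ^ 'm. \<Prod>i\<in>UNIV. u i (x $ i)) \<in> borel_measurable borel" by measurable
  have eq: "(\<Prod>i\<in>UNIV. u i (?S f $ i)) = (\<Prod>b\<in>Basis. v b (f b))" for f
    by (simp only: coord prod v)
  have int_v: "integrable lborel (v b)" for b using u by (simp add: v_def)
  show "integrable lborel (\<lambda>x::real ^ 'm. \<Prod>i\<in>UNIV. u i (x $ i))"
    by (subst lborel_eq, subst integrable_distr_eq[OF S meas], subst eq)
      (rule product_integrable_prod[OF finite_Basis int_v])
  show "(\<integral>x. (\<Prod>i\<in>UNIV. u i ((x :: real ^ 'm) $ i)) \<partial>lborel) = (\<Prod>i\<in>UNIV. (\<integral>t. u i t \<partial>lborel))"
    by (subst lborel_eq, subst integral_distr[OF S meas], subst eq, subst product_integral_prod[OF finite_Basis int_v])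
      (simp add: prod v)
qed

lemma normal_density_moments:
  assumes "0 < s"
  shows "has_bochner_integral lborel (\<lambda>t. normal_density 0 s t * t ^ 0) 1"
    "has_bochner_integral lborel (\<lambda>t. normal_density 0 s t * t ^ 1) 0"
    "has_bochner_integral lborel (\<lambda>t. normal_density 0 s t * t ^ 2) (s\<^sup>2)"
  using normal_moment_even[OF assms, of 0 0] normal_moment_odd[OF assms, of 0 0]
    normal_moment_even[OF assms, of 0 1] assms by (simp_all add: fact_numeral)

text \<open>
  All moments in question are integrals of monomials of degree at most two in each coordinate, which factorise under
  the product density.
\<close>

lemma (in prob_space) gaussian_vector_moments:
  fixes X :: "'a \<Rightarrow> real ^ 'm"
  assumes s: "0 < s"
    and X: "distributed M lborel X (\<lambda>x. ennreal (\<Prod>i\<in>UNIV. normal_density 0 s (x $ i)))"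
  shows "has_bochner_integral M (\<lambda>\<omega>. X \<omega> $ i) 0"
    and "has_bochner_integral M (\<lambda>\<omega>. X \<omega> $ i * X \<omega> $ j) (if i = j then s\<^sup>2 else 0)"
proof -
  have moment: "has_bochner_integral M (\<lambda>\<omega>. \<Prod>k\<in>UNIV. (X \<omega> $ k) ^ e k)
      (\<Prod>k\<in>UNIV. if e k = 0 then 1 else if e k = 1 then 0 else s\<^sup>2)"
    if e: "\<And>k. e k \<le> 2" for e :: "'m \<Rightarrow> nat"
  proof -
    let ?u = "\<lambda>k t. normal_density 0 s t * t ^ e k"
    have "has_bochner_integral lborel (?u k) (if e k = 0 then 1 else if e k = 1 then 0 else s\<^sup>2)" for k
      using normal_density_moments[OF s] e[of k] by (cases "e k = 0"; cases "e k = 1") (auto simp: le_Suc_eq numeral_2_eq_2)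
    then have u: "integrable lborel (?u k)" "(\<integral>t. ?u k t \<partial>lborel) = (if e k = 0 then 1 else if e k = 1 then 0 else s\<^sup>2)" for k
      by (auto simp: has_bochner_integral_iff)
    have split: "(\<Prod>k\<in>UNIV. ?u k (x $ k)) = (\<Prod>k\<in>UNIV. normal_density 0 s (x $ k)) * (\<Prod>k\<in>UNIV. (x $ k) ^ e k)"
      for x :: "real ^ 'm" by (rule prod.distrib)
    have [measurable]: "(\<lambda>x::real ^ 'm. \<Prod>k\<in>UNIV. (x $ k) ^ e k) \<in> borel_measurable lborel" by measurable
    have nonneg: "0 \<le> (\<Prod>k\<in>UNIV. normal_density 0 s (x $ k))" for x :: "real ^ 'm"
      by (intro prod_nonneg) auto
    have "integrable M (\<lambda>\<omega>. \<Prod>k\<in>UNIV. (X \<omega> $ k) ^ e k)"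
      using integrable_prod_components[of ?u, OF u(1)] nonneg
      by (subst distributed_integrable[OF X, symmetric]) (auto simp: split)
    moreover have "(\<integral>\<omega>. (\<Prod>k\<in>UNIV. (X \<omega> $ k) ^ e k) \<partial>M) = (\<Prod>k\<in>UNIV. if e k = 0 then 1 else if e k = 1 then 0 else s\<^sup>2)"
      using integral_prod_components[of ?u, OF u(1)] nonneg
      by (subst distributed_integral[OF X, symmetric]) (auto simp: split u(2))
    ultimately show ?thesis by (simp add: has_bochner_integral_iff)
  qed
  have single: "(\<Prod>k\<in>UNIV. y k ^ (if k = i then p else 0)) = y i ^ p" for y :: "'m \<Rightarrow> real" and i p
    by (subst prod.remove[of _ i]) auto
  have zero: "(\<Prod>k\<in>UNIV. if e k = 0 then 1 else if e k = 1 then 0 else s\<^sup>2) = 0" if "e i = 1" for e :: "'m \<Rightarrow> nat" and i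
    by (rule prod_zero) (use that in auto)
  show "has_bochner_integral M (\<lambda>\<omega>. X \<omega> $ i) 0"
    using moment[of "\<lambda>k. if k = i then 1 else 0"] zero[of "\<lambda>k. if k = i then 1 else 0" i] by (simp add: single)
  show "has_bochner_integral M (\<lambda>\<omega>. X \<omega> $ i * X \<omega> $ j) (if i = j then s\<^sup>2 else 0)"
  proof (cases "i = j")
    case True
    have "(\<Prod>k\<in>UNIV. if (if k = i then 2 else 0) = (0::nat) then 1 else if (if k = i then 2 else 0) = (1::nat) then 0 else s\<^sup>2) = s\<^sup>2"
      by (subst prod.remove[of _ i]) auto
    with True moment[of "\<lambda>k. if k = i then 2 else 0"] show ?thesis by (simp only: single) (simp add: power2_eq_square)
  next
    case False
    have "(\<Prod>k\<in>UNIV. (X \<omega> $ k) ^ (if k = i \<or> k = j then 1 else 0)) = X \<omega> $ i * X \<omega> $ j" for \<omega>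
    proof -
      have "(\<Prod>k\<in>UNIV. (X \<omega> $ k) ^ (if k = i \<or> k = j then 1 else 0))
          = (\<Prod>k\<in>UNIV. (X \<omega> $ k) ^ (if k = i then 1 else 0) * (X \<omega> $ k) ^ (if k = j then 1 else 0))"
        using False by (intro prod.cong) auto
      then show ?thesis by (simp only: prod.distrib single) simp
    qed
    with False moment[of "\<lambda>k. if k = i \<or> k = j then 1 else 0"] zero[of "\<lambda>k. if k = i \<or> k = j then 1 else 0" i]
    show ?thesis by simp
  qed
qed

lemma norm_vec_power2: "(norm (x :: 'a::real_normed_vector ^ 'n))\<^sup>2 = (\<Sum>i\<in>UNIV. (norm (x $ i))\<^sup>2)"
  by (simp add: norm_vec_def L2_set_def sum_nonneg)

lemma (in prob_space) gaussian_linear_image_moments: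
  fixes X :: "'a \<Rightarrow> real ^ 'm" and S :: "real ^ 'm ^ 'd"
  assumes s: "0 < s"
    and X: "distributed M lborel X (\<lambda>x. ennreal (\<Prod>i\<in>UNIV. normal_density 0 s (x $ i)))"
  shows "has_bochner_integral M (\<lambda>\<omega>. (S *v X \<omega>) $ k) 0"
    and "has_bochner_integral M (\<lambda>\<omega>. (norm (S *v X \<omega>))\<^sup>2) (s\<^sup>2 * (norm S)\<^sup>2)"
proof -
  note m = gaussian_vector_moments[OF s X]
  have "has_bochner_integral M (\<lambda>\<omega>. \<Sum>i\<in>UNIV. S $ k $ i * X \<omega> $ i) (\<Sum>i\<in>UNIV. S $ k $ i * 0)"
    by (intro has_bochner_integral_sum has_bochner_integral_mult_right m)
  then show "has_bochner_integral M (\<lambda>\<omega>. (S *v X \<omega>) $ k) 0"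
    by (simp add: matrix_vector_mult_def)
  have "has_bochner_integral M (\<lambda>\<omega>. \<Sum>k\<in>UNIV. \<Sum>i\<in>UNIV. \<Sum>j\<in>UNIV. S $ k $ i * S $ k $ j * (X \<omega> $ i * X \<omega> $ j))
     (\<Sum>k\<in>UNIV. \<Sum>i\<in>UNIV. \<Sum>j\<in>UNIV. S $ k $ i * S $ k $ j * (if i = j then s\<^sup>2 else 0))"
    by (intro has_bochner_integral_sum has_bochner_integral_mult_right m)
  moreover have "(\<Sum>k\<in>UNIV. \<Sum>i\<in>UNIV. \<Sum>j\<in>UNIV. S $ k $ i * S $ k $ j * (X \<omega> $ i * X \<omega> $ j)) = (norm (S *v X \<omega>))\<^sup>2" for \<omega>
    by (simp add: norm_vec_power2 matrix_vector_mult_def power2_eq_square[of "sum _ _"] sum_product mult_ac)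
  moreover have "(\<Sum>k\<in>UNIV. \<Sum>i\<in>UNIV. \<Sum>j\<in>UNIV. S $ k $ i * S $ k $ j * (if i = j then s\<^sup>2 else 0)) = s\<^sup>2 * (norm S)\<^sup>2"
    by (simp add: norm_vec_power2 sum_distrib_left if_distrib power2_eq_square[of "S $ _ $ _"] mult_ac cong: if_cong)
  ultimately show "has_bochner_integral M (\<lambda>\<omega>. (norm (S *v X \<omega>))\<^sup>2) (s\<^sup>2 * (norm S)\<^sup>2)" by simp
qed

lemma (in prob_space) second_moment_independent_sum:
  fixes U V :: "'a \<Rightarrow> real ^ 'd" and A :: "real ^ 'd"
  assumes indep: "indep_var borel U borel V"
    and U: "\<And>k. has_bochner_integral M (\<lambda>\<omega>. U \<omega> $ k) 0" "has_bochner_integral M (\<lambda>\<omega>. (norm (U \<omega>))\<^sup>2) u"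
    and V: "\<And>k. has_bochner_integral M (\<lambda>\<omega>. V \<omega> $ k) 0" "has_bochner_integral M (\<lambda>\<omega>. (norm (V \<omega>))\<^sup>2) v"
  shows "has_bochner_integral M (\<lambda>\<omega>. (norm (A + U \<omega> + V \<omega>))\<^sup>2) ((norm A)\<^sup>2 + u + v)"
proof -
  have UV: "has_bochner_integral M (\<lambda>\<omega>. U \<omega> $ k * V \<omega> $ k) 0" for k
  proof -
    have "indep_var borel ((\<lambda>x. x $ k) \<circ> U) borel ((\<lambda>x. x $ k) \<circ> V)"
      by (rule indep_var_compose[OF indep]) measurable
    then have ind: "indep_var borel (\<lambda>\<omega>. U \<omega> $ k) borel (\<lambda>\<omega>. V \<omega> $ k)" by (simp add: comp_def)
    have int: "integrable M (\<lambda>\<omega>. U \<omega> $ k)" "integrable M (\<lambda>\<omega>. V \<omega> $ k)"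
      using U(1)[of k] V(1)[of k] by (auto simp: has_bochner_integral_iff)
    show ?thesis
      using indep_var_integrable[OF ind int] indep_var_lebesgue_integral[OF ind int] U(1)[of k]
      by (auto simp: has_bochner_integral_iff)
  qed
  have "has_bochner_integral M (\<lambda>\<omega>. (norm A)\<^sup>2 + (norm (U \<omega>))\<^sup>2 + (norm (V \<omega>))\<^sup>2
      + (\<Sum>k\<in>UNIV. 2 * A $ k * U \<omega> $ k) + (\<Sum>k\<in>UNIV. 2 * A $ k * V \<omega> $ k) + (\<Sum>k\<in>UNIV. 2 * (U \<omega> $ k * V \<omega> $ k)))
      ((norm A)\<^sup>2 + u + v + (\<Sum>k\<in>UNIV. 2 * A $ k * 0) + (\<Sum>k\<in>UNIV. 2 * A $ k * 0) + (\<Sum>k::'d\<in>UNIV. 2 * 0))"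
  proof (intro has_bochner_integral_add has_bochner_integral_sum has_bochner_integral_mult_right U V UV)
    show "has_bochner_integral M (\<lambda>\<omega>. (norm A)\<^sup>2) ((norm A)\<^sup>2)"
      by (simp add: has_bochner_integral_iff prob_space)
  qed
  moreover have "(norm A)\<^sup>2 + (norm (U \<omega>))\<^sup>2 + (norm (V \<omega>))\<^sup>2
      + (\<Sum>k\<in>UNIV. 2 * A $ k * U \<omega> $ k) + (\<Sum>k\<in>UNIV. 2 * A $ k * V \<omega> $ k) + (\<Sum>k\<in>UNIV. 2 * (U \<omega> $ k * V \<omega> $ k))
      = (norm (A + U \<omega> + V \<omega>))\<^sup>2" for \<omega>
    unfolding norm_vec_power2 sum.distrib[symmetric]
    by (intro sum.cong refl) (simp add: power2_eq_square algebra_simps)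
  ultimately show ?thesis by simp
qed

text \<open>
  The Cauchy--Schwarz inequality on a probability space, in the form of nonnegativity of the
  variance.
\<close>

lemma (in prob_space) nn_integral_le_of_square:
  fixes X :: "'a \<Rightarrow> real"
  assumes [measurable]: "X \<in> borel_measurable M" and X: "\<And>\<omega>. 0 \<le> X \<omega>" and "0 \<le> c"
    and sq: "(\<integral>\<^sup>+\<omega>. ennreal ((X \<omega>)\<^sup>2) \<partial>M) \<le> ennreal (c\<^sup>2)"
  shows "(\<integral>\<^sup>+\<omega>. ennreal (X \<omega>) \<partial>M) \<le> ennreal c"
proof -
  have int2: "integrable M (\<lambda>\<omega>. (X \<omega>)\<^sup>2)"
    using sq by (intro integrableI_nonneg) (auto simp: less_top[symmetric] top_unique)
  have int: "integrable M X"
  proof (rule Bochner_Integration.integrable_bound[of _ "\<lambda>\<omega>. 1 + (X \<omega>)\<^sup>2"])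
    have "X \<omega> \<le> 1 + (X \<omega>)\<^sup>2" for \<omega>
      using zero_le_power2[of "X \<omega> - 1"] X[of \<omega>] by (simp add: power2_eq_square algebra_simps)
    then show "AE \<omega> in M. norm (X \<omega>) \<le> norm (1 + (X \<omega>)\<^sup>2)" using X by (auto simp: abs_of_nonneg)
  qed (use int2 in auto)
  have "(expectation X)\<^sup>2 \<le> expectation (\<lambda>\<omega>. (X \<omega>)\<^sup>2)"
    using variance_positive[of X] variance_eq[OF int int2] by simp
  also have "\<dots> \<le> c\<^sup>2"
    using sq nn_integral_eq_integral[OF int2] by simp
  finally have "expectation X \<le> c" using \<open>0 \<le> c\<close> by (rule power2_le_imp_le)
  then show ?thesis using nn_integral_eq_integral[OF int] X by (simp add: ennreal_leI)
qed

section \<open>Independence of past and future noise\<close>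

text \<open>
  Independence is a property of the joint law, which does not see null sets.
\<close>

lemma (in prob_space) indep_vars_cong_AE:
  assumes X: "\<And>i. i \<in> I \<Longrightarrow> X i \<in> measurable M (N i)" and Y: "\<And>i. i \<in> I \<Longrightarrow> Y i \<in> measurable M (N i)"
    and "finite I" and eq: "\<And>i. i \<in> I \<Longrightarrow> AE \<omega> in M. X i \<omega> = Y i \<omega>"
    and indep: "indep_vars N X I"
  shows "indep_vars N Y I"
proof (cases "I = {}")
  case True
  then show ?thesis by (auto simp: indep_vars_def2 indep_sets_def)
next
  case False
  have "AE \<omega> in M. \<forall>i\<in>I. X i \<omega> = Y i \<omega>"
    using \<open>finite I\<close> eq by (simp add: AE_finite_all)
  then have "distr M (\<Pi>\<^sub>M i\<in>I. N i) (\<lambda>\<omega>. \<lambda>i\<in>I. Y i \<omega>) = distr M (\<Pi>\<^sub>M i\<in>I. N i) (\<lambda>\<omega>. \<lambda>i\<in>I. X i \<omega>)"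
    by (intro distr_cong_AE measurable_restrict X Y) (auto elim!: eventually_mono intro!: restrict_ext)
  also have "\<dots> = (\<Pi>\<^sub>M i\<in>I. distr M (N i) (X i))"
    using indep by (simp add: indep_vars_iff_distr_eq_PiM'[OF False X])
  also have "\<dots> = (\<Pi>\<^sub>M i\<in>I. distr M (N i) (Y i))"
    using eq by (intro PiM_cong distr_cong_AE X Y) auto
  finally show ?thesis by (simp add: indep_vars_iff_distr_eq_PiM'[OF False Y])
qed

lemma (in prob_space) distr_pair_of_indep_set:
  assumes indep: "indep_set (sets G) (sets H)" and space: "space G = space M" "space H = space M"
    and U: "U \<in> measurable G S" and V: "V \<in> measurable H T"
  shows "distr M S U \<Otimes>\<^sub>M distr M T V = distr M (S \<Otimes>\<^sub>M T) (\<lambda>\<omega>. (U \<omega>, V \<omega>))"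
proof -
  have sub: "sets G \<subseteq> events" "sets H \<subseteq> events"
    and prod: "\<And>a b. a \<in> sets G \<Longrightarrow> b \<in> sets H \<Longrightarrow> prob (a \<inter> b) = prob a * prob b"
    using indep by (auto simp: indep_sets2_eq)
  have UM[measurable]: "U \<in> measurable M S" and VM[measurable]: "V \<in> measurable M T"
    using U V sub space by (auto simp: measurable_def)
  interpret PU: prob_space "distr M S U" by (rule prob_space_distr[OF UM])
  interpret PV: prob_space "distr M T V" by (rule prob_space_distr[OF VM])
  show ?thesis
  proof (rule pair_measure_eqI)
    fix A B assume "A \<in> sets (distr M S U)" "B \<in> sets (distr M T V)"
    then have A: "A \<in> sets S" and B: "B \<in> sets T" by simp_all
    have "prob ((U -` A \<inter> space M) \<inter> (V -` B \<inter> space M)) = prob (U -` A \<inter> space M) * prob (V -` B \<inter> space M)"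
      using measurable_sets[OF U A] measurable_sets[OF V B] by (intro prod) (simp_all add: space)
    moreover have "(\<lambda>\<omega>. (U \<omega>, V \<omega>)) -` (A \<times> B) \<inter> space M = (U -` A \<inter> space M) \<inter> (V -` B \<inter> space M)"
      by auto
    ultimately show "emeasure (distr M S U) A * emeasure (distr M T V) B
        = emeasure (distr M (S \<Otimes>\<^sub>M T) (\<lambda>\<omega>. (U \<omega>, V \<omega>))) (A \<times> B)"
      using A B by (simp add: emeasure_distr emeasure_eq_measure ennreal_mult)
  qed (simp_all add: PU.sigma_finite_measure_axioms PV.sigma_finite_measure_axioms)
qed

lemma (in prob_space) indep_var_of_indep_set:
  assumes indep: "indep_set (sets G) (sets H)" and space: "space G = space M" "space H = space M"
    and U: "U \<in> measurable G S" and V: "V \<in> measurable H T"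
  shows "indep_var S U T V"
proof -
  have "sets G \<subseteq> events" "sets H \<subseteq> events"
    using indep by (auto simp: indep_sets2_eq)
  then have "U \<in> measurable M S" "V \<in> measurable M T"
    using U V space by (auto simp: measurable_def)
  then show ?thesis
    using distr_pair_of_indep_set[OF assms] by (simp add: indep_var_distribution_eq)
qed

text \<open>
  A variable \<open>X\<close> of the past may be frozen while averaging over the independent \<open>\<sigma>\<close>-algebra \<open>G\<close>: the pair of \<open>X\<close>
  and the identity map into \<open>G\<close> has a product law. This is the Markov property without
  conditional expectations.
\<close>

lemma (in prob_space) nn_integral_freeze:
  assumes indep: "indep_set (sets A) (sets G)" and sub: "subalgebra M A" "subalgebra M G"
    and X: "X \<in> measurable A S" and f: "(\<lambda>(x, \<omega>). f x \<omega>) \<in> borel_measurable (S \<Otimes>\<^sub>M G)"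
  shows "(\<integral>\<^sup>+\<omega>. f (X \<omega>) \<omega> \<partial>M) = (\<integral>\<^sup>+\<omega>. \<integral>\<^sup>+\<omega>'. f (X \<omega>) \<omega>' \<partial>M \<partial>M)"
proof -
  have XM[measurable]: "X \<in> measurable M S" by (rule measurable_from_subalg[OF sub(1) X])
  have idM[measurable]: "(\<lambda>\<omega>. \<omega>) \<in> measurable M G" by (rule measurable_from_subalg[OF sub(2)]) simp
  have joint: "distr M S X \<Otimes>\<^sub>M distr M G (\<lambda>\<omega>. \<omega>) = distr M (S \<Otimes>\<^sub>M G) (\<lambda>\<omega>. (X \<omega>, \<omega>))"
    using sub by (intro distr_pair_of_indep_set[OF indep _ _ X]) (auto simp: subalgebra_def)
  interpret G: prob_space "distr M G (\<lambda>\<omega>. \<omega>)" by (rule prob_space_distr[OF idM])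
  have f': "(\<lambda>(x, \<omega>). f x \<omega>) \<in> borel_measurable (distr M S X \<Otimes>\<^sub>M distr M G (\<lambda>\<omega>. \<omega>))"
    using f by (subst measurable_cong_sets[OF sets_pair_measure_cong refl]) auto
  have fx: "f x \<in> borel_measurable G" if "x \<in> space S" for x
    using measurable_compose[OF measurable_Pair1'[OF that] f] by simp
  have "(\<integral>\<^sup>+\<omega>. f (X \<omega>) \<omega> \<partial>M) = (\<integral>\<^sup>+p. (case p of (x, \<omega>) \<Rightarrow> f x \<omega>) \<partial>distr M (S \<Otimes>\<^sub>M G) (\<lambda>\<omega>. (X \<omega>, \<omega>)))"
    using f by (subst nn_integral_distr) auto
  also have "\<dots> = (\<integral>\<^sup>+x. \<integral>\<^sup>+\<omega>. f x \<omega> \<partial>distr M G (\<lambda>\<omega>. \<omega>) \<partial>distr M S X)"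
    unfolding joint[symmetric] using G.nn_integral_fst[OF f'] by simp
  also have "\<dots> = (\<integral>\<^sup>+\<omega>. \<integral>\<^sup>+\<omega>'. f (X \<omega>) \<omega>' \<partial>distr M G (\<lambda>\<omega>. \<omega>) \<partial>M)"
    using G.borel_measurable_nn_integral_fst[OF f'] by (subst nn_integral_distr) auto
  also have "\<dots> = (\<integral>\<^sup>+\<omega>. \<integral>\<^sup>+\<omega>'. f (X \<omega>) \<omega>' \<partial>M \<partial>M)"
    using measurable_space[OF XM] fx
    by (intro nn_integral_cong nn_integral_distr idM) (simp add: measurable_distr_eq1)
  finally show ?thesis .
qed

lemma finite_random_measure_mono:
  assumes "finite_random_measure G \<mu> R" "subalgebra H G"
  shows "finite_random_measure H \<mu> R"
proof -
  interpret finite_random_measure G \<mu> R by fact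
  have "space H = space G" using assms(2) by (simp add: subalgebra_def)
  then show ?thesis
    using nonempty sets_R finite_R
    by (intro finite_random_measure.intro measurable_from_subalg[OF assms(2)] measurable_R) auto
qed

context poisson_random_measure
begin

text \<open>
  The marks of the points with times in \<open>(a, b]\<close>.
\<close>

definition window_cloud :: "real \<Rightarrow> real \<Rightarrow> (real \<times> 'z) measure \<Rightarrow> 'z measure" where
  "window_cloud a b Q = distr (density Q (\<lambda>p. ennreal (indicator ({a<..b} \<times> space \<nu>) p))) \<nu> snd"

text \<open>
  On the null event of infinitely many points the cloud is replaced by the zero measure, so that its realisations
  are finite everywhere and integrals against it are measurable without exception.
\<close>

definition cloud :: "real \<Rightarrow> real \<Rightarrow> 'w \<Rightarrow> 'z measure" where
  "cloud a b \<omega> = (if emeasure (N \<omega>) ({a<..b} \<times> space \<nu>) < \<infinity> then window_cloud a b (N \<omega>) else null_measure \<nu>)"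

definition poisson_algebra :: "real \<Rightarrow> 'w measure" where
  "poisson_algebra a = sigma (space M) (poisson_future M \<nu> N a)"

sublocale \<nu>: finite_measure \<nu> by (rule nu_finite)

lemma space_nu_nonempty: "space \<nu> \<noteq> {}"
  using nu_nonzero by auto

lemma window_in_intensity:
  assumes "0 \<le> a" "B \<in> sets \<nu>"
  shows "{a<..b} \<times> B \<in> sets (intensity \<nu>)"
proof -
  have "{a<..b} \<in> sets (restrict_space lborel {0..})"
    using assms(1) by (auto simp: sets_restrict_space_iff)
  then show ?thesis unfolding intensity_def using assms(2) by (rule pair_measureI)
qed

lemma emeasure_intensity_window:
  assumes "0 \<le> a" "a \<le> b" "B \<in> sets \<nu>"
  shows "emeasure (intensity \<nu>) ({a<..b} \<times> B) = ennreal (b - a) * emeasure \<nu> B"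
proof -
  have "{a<..b} \<in> sets (restrict_space lborel {0..})"
    using assms(1) by (auto simp: sets_restrict_space_iff)
  then have "emeasure (intensity \<nu>) ({a<..b} \<times> B) = emeasure (restrict_space lborel {0..}) {a<..b} * emeasure \<nu> B"
    unfolding intensity_def using assms(3) by (rule \<nu>.emeasure_pair_measure_Times)
  also have "emeasure (restrict_space lborel {0..}) {a<..b} = ennreal (b - a)"
    using assms(1,2) by (subst emeasure_restrict_space) auto
  finally show ?thesis .
qed

context
  fixes a b :: real and Q :: "(real \<times> 'z) measure"
  assumes a: "0 \<le> a" and Q: "sets Q = sets (intensity \<nu>)"
begin

lemma snd_measurable_window: "snd \<in> measurable Q \<nu>"
  by (subst measurable_cong_sets[OF Q refl]) (simp add: intensity_def)

lemma window_measurable: "{a<..b} \<times> space \<nu> \<in> sets Q"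
  using window_in_intensity[OF a, of "space \<nu>" b] by (simp add: Q)

lemma emeasure_window_cloud:
  assumes B: "B \<in> sets \<nu>"
  shows "emeasure (window_cloud a b Q) B = emeasure Q ({a<..b} \<times> B)"
proof -
  note [measurable] = snd_measurable_window window_measurable
  have "snd -` B \<inter> space Q \<in> sets Q" using measurable_sets[OF snd_measurable_window B] .
  then have "emeasure (window_cloud a b Q) B = (\<integral>\<^sup>+p. indicator ({a<..b} \<times> space \<nu>) p * indicator (snd -` B \<inter> space Q) p \<partial>Q)"
    unfolding window_cloud_def using B
    by (subst emeasure_distr) (auto simp: emeasure_density ennreal_indicator)
  also have "\<dots> = (\<integral>\<^sup>+p. indicator ({a<..b} \<times> B) p \<partial>Q)"
    using B[THEN sets.sets_into_space] by (intro nn_integral_cong) (auto simp: indicator_def)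
  also have "\<dots> = emeasure Q ({a<..b} \<times> B)"
    using window_in_intensity[OF a B, of b] by (simp add: Q)
  finally show ?thesis .
qed

lemma integral_window_cloud:
  fixes g :: "'z \<Rightarrow> 'e::{banach, second_countable_topology}"
  assumes g[measurable]: "g \<in> borel_measurable \<nu>"
  shows "(LINT p:{a<..b} \<times> space \<nu>|Q. g (snd p)) = (\<integral>z. g z \<partial>window_cloud a b Q)"
proof -
  note [measurable] = snd_measurable_window window_measurable
  show ?thesis
    unfolding window_cloud_def set_lebesgue_integral_def
    by (subst integral_distr) (auto simp: integral_density)
qed

end

lemma window_cloud_intensity:
  assumes "0 \<le> a" "a \<le> b"
  shows "window_cloud a b (intensity \<nu>) = density \<nu> (\<lambda>_. ennreal (b - a))"
proof (rule measure_eqI)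
  fix B assume "B \<in> sets (window_cloud a b (intensity \<nu>))"
  then have "B \<in> sets \<nu>" by (simp add: window_cloud_def)
  then show "emeasure (window_cloud a b (intensity \<nu>)) B = emeasure (density \<nu> (\<lambda>_. ennreal (b - a))) B"
    using assms by (simp add: emeasure_window_cloud emeasure_intensity_window emeasure_density_const)
qed (simp add: window_cloud_def)

lemma sets_poisson_algebra: "sets (poisson_algebra a) = poisson_future M \<nu> N a"
  and space_poisson_algebra: "space (poisson_algebra a) = space M"
proof -
  have "poisson_future M \<nu> N a \<subseteq> Pow (space M)"
    unfolding poisson_future_def by (rule subsetI, rule PowI, erule sigma_sets_into_sp[rotated]) auto
  moreover have closed: "sigma_sets (space M) (poisson_future M \<nu> N a) = poisson_future M \<nu> N a"
    unfolding poisson_future_def by (rule sigma_sets_sigma_sets_eq) auto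
  ultimately show "sets (poisson_algebra a) = poisson_future M \<nu> N a" "space (poisson_algebra a) = space M"
    unfolding poisson_algebra_def using closed by (simp_all add: sets_measure_of space_measure_of)
qed

lemma poisson_algebra_sub:
  assumes "0 \<le> a" shows "subalgebra M (poisson_algebra a)"
  using prm_indep[OF assms] by (simp add: subalgebra_def space_poisson_algebra sets_poisson_algebra indep_sets2_eq)

lemma count_poisson_algebra:
  assumes "0 \<le> a" "B \<in> sets \<nu>"
  shows "(\<lambda>\<omega>. emeasure (N \<omega>) ({a<..b} \<times> B)) \<in> borel_measurable (poisson_algebra a)"
proof (rule measurableI)
  fix C :: "ennreal set" assume "C \<in> sets borel"
  then show "(\<lambda>\<omega>. emeasure (N \<omega>) ({a<..b} \<times> B)) -` C \<inter> space (poisson_algebra a) \<in> sets (poisson_algebra a)"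
    unfolding space_poisson_algebra sets_poisson_algebra poisson_future_def
    using window_in_intensity[OF assms] assms(2)[THEN sets.sets_into_space]
    by (intro sigma_sets.Basic) fastforce
qed simp

lemma emeasure_cloud:
  assumes "0 \<le> a" "\<omega> \<in> space M" "emeasure (N \<omega>) ({a<..b} \<times> space \<nu>) < \<infinity>" "B \<in> sets \<nu>"
  shows "emeasure (cloud a b \<omega>) B = emeasure (N \<omega>) ({a<..b} \<times> B)"
  using assms by (simp add: cloud_def emeasure_window_cloud prm_sets)

lemma AE_finite_window:
  assumes "0 \<le> a" "a \<le> b"
  shows "AE \<omega> in M. emeasure (N \<omega>) ({a<..b} \<times> space \<nu>) < \<infinity>"
proof -
  let ?W = "{a<..b} \<times> space \<nu>"
  have W: "?W \<in> sets (intensity \<nu>)" using assms(1) by (rule window_in_intensity) simp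
  have "emeasure (intensity \<nu>) ?W < \<infinity>"
    using assms by (simp add: emeasure_intensity_window ennreal_mult_eq_top_iff less_top[symmetric])
  from AE_poisson_of_nat[OF prm_measurable[OF W] prm_poisson[OF W this]]
  show ?thesis by eventually_elim (auto simp: of_nat_less_top)
qed

lemma cloud_random_measure:
  assumes "0 \<le> a" "a \<le> b"
  shows "finite_random_measure (poisson_algebra a) (density \<nu> (\<lambda>_. ennreal (b - a))) (cloud a b)"
proof (rule finite_random_measure.intro)
  fix \<omega> assume "\<omega> \<in> space (poisson_algebra a)"
  then have \<omega>: "\<omega> \<in> space M" by (simp add: space_poisson_algebra)
  show "sets (cloud a b \<omega>) = sets (density \<nu> (\<lambda>_. ennreal (b - a)))"
    by (simp add: cloud_def window_cloud_def)
  have sp: "space (cloud a b \<omega>) = space \<nu>" by (simp add: cloud_def window_cloud_def)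
  show "finite_measure (cloud a b \<omega>)"
  proof (cases "emeasure (N \<omega>) ({a<..b} \<times> space \<nu>) < \<infinity>")
    case True
    then show ?thesis using emeasure_cloud[OF assms(1) \<omega> True sets.top]
      by (intro finite_measureI) (simp add: sp)
  qed (auto simp: cloud_def intro!: finite_measureI)
next
  fix B assume "B \<in> sets (density \<nu> (\<lambda>_. ennreal (b - a)))"
  then have B: "B \<in> sets \<nu>" by simp
  note [measurable] = count_poisson_algebra[OF assms(1) B, of b] count_poisson_algebra[OF assms(1) sets.top, of b]
  have "(\<lambda>\<omega>. if emeasure (N \<omega>) ({a<..b} \<times> space \<nu>) < \<infinity> then emeasure (N \<omega>) ({a<..b} \<times> B) else 0)
      \<in> borel_measurable (poisson_algebra a)" by measurable
  then show "(\<lambda>\<omega>. emeasure (cloud a b \<omega>) B) \<in> borel_measurable (poisson_algebra a)"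
    by (rule measurable_cong[THEN iffD1, rotated])
      (use assms B in \<open>auto simp: space_poisson_algebra emeasure_cloud\<close>, auto simp: cloud_def)
qed (simp add: space_nu_nonempty)

lemma cloud_poisson:
  assumes "0 \<le> a" "a \<le> b"
  shows "poisson_cloud M (density \<nu> (\<lambda>_. ennreal (b - a))) (cloud a b)"
proof -
  let ?\<mu> = "density \<nu> (\<lambda>_. ennreal (b - a))"
  interpret C: finite_random_measure M ?\<mu> "cloud a b"
    by (rule finite_random_measure_mono[OF cloud_random_measure poisson_algebra_sub]) (use assms in auto)
  interpret \<mu>: finite_measure ?\<mu>
    by (rule finite_measureI) (simp add: emeasure_density_const ennreal_mult_eq_top_iff)
  have W: "{a<..b} \<times> B \<in> sets (intensity \<nu>)" if "B \<in> sets \<nu>" for B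
    using assms(1) that by (rule window_in_intensity)
  have int: "emeasure (intensity \<nu>) ({a<..b} \<times> B) = emeasure ?\<mu> B" if "B \<in> sets \<nu>" for B
    using assms that by (simp add: emeasure_intensity_window emeasure_density_const)
  have eq: "AE \<omega> in M. emeasure (N \<omega>) ({a<..b} \<times> B) = emeasure (cloud a b \<omega>) B" if "B \<in> sets \<nu>" for B
    using AE_finite_window[OF assms] AE_space by eventually_elim (simp add: emeasure_cloud assms that)
  show ?thesis
  proof unfold_locales
    fix B k assume "B \<in> sets ?\<mu>"
    then have B: "B \<in> sets \<nu>" by simp
    note [measurable] = prm_measurable[OF W[OF B]] C.measurable_R[of B, simplified, OF B]
    have fin: "emeasure (intensity \<nu>) ({a<..b} \<times> B) < \<infinity>"
      by (simp add: int[OF B] less_top[symmetric])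
    have "prob {\<omega> \<in> space M. emeasure (cloud a b \<omega>) B = of_nat k}
        = prob {\<omega> \<in> space M. emeasure (N \<omega>) ({a<..b} \<times> B) = of_nat k}"
      using eq[OF B] by (intro finite_measure_eq_AE) (auto elim: eventually_mono)
    also have "\<dots> = measure ?\<mu> B ^ k / fact k * exp (- measure ?\<mu> B)"
      using prm_poisson[OF W[OF B] fin, of k] by (simp add: int[OF B] measure_def)
    finally show "prob {\<omega> \<in> space M. emeasure (cloud a b \<omega>) B = of_nat k}
        = measure ?\<mu> B ^ k / fact k * exp (- measure ?\<mu> B)" .
  next
    fix A :: "nat \<Rightarrow> 'z set" and n
    assume A: "\<And>i. i < n \<Longrightarrow> A i \<in> sets ?\<mu>" and disj: "disjoint_family_on A {..<n}"
    show "indep_vars (\<lambda>_. borel) (\<lambda>i \<omega>. emeasure (cloud a b \<omega>) (A i)) {..<n}"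
    proof (rule indep_vars_cong_AE)
      show "indep_vars (\<lambda>_. borel) (\<lambda>i \<omega>. emeasure (N \<omega>) ({a<..b} \<times> A i)) {..<n}"
        using A disj by (intro prm_disjoint_indep) (auto intro: W simp: disjoint_family_on_def)
    qed (use A in \<open>auto intro: eq prm_measurable W C.measurable_R\<close>)
  qed
qed

end

context levy_noise
begin

definition wiener_algebra :: "real \<Rightarrow> 'w measure" where
  "wiener_algebra a = sigma (space M) (wiener_future M W a)"

definition noise_algebra :: "real \<Rightarrow> 'w measure" where
  "noise_algebra a = sigma (space M) (wiener_future M W a \<union> poisson_future M \<nu> N a)"

lemma sets_wiener_algebra: "sets (wiener_algebra a) = wiener_future M W a"
  and space_wiener_algebra: "space (wiener_algebra a) = space M"
proof -
  have "wiener_future M W a \<subseteq> Pow (space M)"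
    unfolding wiener_future_def by (rule subsetI, rule PowI, erule sigma_sets_into_sp[rotated]) auto
  moreover have closed: "sigma_sets (space M) (wiener_future M W a) = wiener_future M W a"
    unfolding wiener_future_def by (rule sigma_sets_sigma_sets_eq) auto
  ultimately show "sets (wiener_algebra a) = wiener_future M W a" "space (wiener_algebra a) = space M"
    unfolding wiener_algebra_def using closed by (simp_all add: sets_measure_of space_measure_of)
qed

lemma noise_algebra:
  shows space_noise_algebra: "space (noise_algebra a) = space M"
    and sets_noise_algebra: "sets (noise_algebra a) = sigma_sets (space M) (wiener_future M W a \<union> poisson_future M \<nu> N a)"
    and wiener_sub_noise: "subalgebra (noise_algebra a) (wiener_algebra a)"
    and poisson_sub_noise: "subalgebra (noise_algebra a) (poisson_algebra a)"
proof -
  have sub: "wiener_future M W a \<union> poisson_future M \<nu> N a \<subseteq> Pow (space M)"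
    using sets.space_closed[of "wiener_algebra a"] sets.space_closed[of "poisson_algebra a"]
    by (simp add: sets_wiener_algebra space_wiener_algebra sets_poisson_algebra space_poisson_algebra)
  show sp: "space (noise_algebra a) = space M"
    and st: "sets (noise_algebra a) = sigma_sets (space M) (wiener_future M W a \<union> poisson_future M \<nu> N a)"
    using sub by (simp_all add: noise_algebra_def)
  show "subalgebra (noise_algebra a) (wiener_algebra a)" "subalgebra (noise_algebra a) (poisson_algebra a)"
    by (auto simp: subalgebra_def sp st sets_wiener_algebra space_wiener_algebra sets_poisson_algebra space_poisson_algebra)
qed

lemma increment_measurable:
  assumes "a \<le> b"
  shows "(\<lambda>\<omega>. W b \<omega> - W a \<omega>) \<in> borel_measurable (wiener_algebra a)"
proof (rule measurableI)
  fix B :: "(real ^ 'm) set" assume "B \<in> sets borel"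
  then show "(\<lambda>\<omega>. W b \<omega> - W a \<omega>) -` B \<inter> space (wiener_algebra a) \<in> sets (wiener_algebra a)"
    unfolding space_wiener_algebra sets_wiener_algebra wiener_future_def
    using assms by (intro sigma_sets.Basic) auto
qed simp

lemma indep_wiener_poisson:
  assumes "0 \<le> a"
  shows "indep_set (sets (wiener_algebra a)) (sets (poisson_algebra a))"
proof -
  let ?E = "\<lambda>i. [sets (F a), wiener_future M W a, poisson_future M \<nu> N a] ! i"
  have ind: "indep_sets ?E {..<3}" by (rule noise_indep[OF assms])
  show ?thesis
    unfolding indep_sets2_eq sets_wiener_algebra sets_poisson_algebra
  proof (intro conjI ballI)
    have "?E i \<subseteq> events" if "i < 3" for i using ind that by (auto simp: indep_sets_def)
    from this[of 1] this[of 2] show "wiener_future M W a \<subseteq> events" "poisson_future M \<nu> N a \<subseteq> events" by auto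
    fix A B assume AB: "A \<in> wiener_future M W a" "B \<in> poisson_future M \<nu> N a"
    have "prob (\<Inter>i\<in>{1::nat, 2}. if i = 1 then A else B) = (\<Prod>i\<in>{1::nat, 2}. prob (if i = 1 then A else B))"
      using ind AB by (intro indep_setsD[OF ind]) auto
    then show "prob (A \<inter> B) = prob A * prob B" by (simp add: Int_commute)
  qed
qed

text \<open>
  Two of three mutually independent \<open>\<sigma>\<close>-algebras may be joined into one that is independent of the third.
\<close>

lemma indep_past_noise:
  assumes "0 \<le> a"
  shows "indep_set (sets (F a)) (sets (noise_algebra a))"
proof -
  let ?E = "\<lambda>i. [sets (F a), wiener_future M W a, poisson_future M \<nu> N a] ! i"
  let ?I = "\<lambda>j. if j then {0::nat} else {1, 2}"
  have "indep_sets ?E (\<Union>j\<in>UNIV. ?I j)"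
    using noise_indep[OF assms] by (rule indep_sets_mono_index[rotated]) (auto simp: UNIV_bool)
  moreover have "Int_stable (?E i)" if "i \<in> ?I j" for i j
    using that sets.Int_stable[of "F a"] sets.Int_stable[of "wiener_algebra a"] sets.Int_stable[of "poisson_algebra a"]
    by (auto simp: sets_wiener_algebra sets_poisson_algebra split: if_splits)
  moreover have "disjoint_family_on ?I UNIV" by (auto simp: disjoint_family_on_def)
  ultimately have "indep_sets (\<lambda>j. sigma_sets (space M) (\<Union>i\<in>?I j. ?E i)) UNIV"
    by (rule indep_sets_collect_sigma)
  moreover have "(\<lambda>j. sigma_sets (space M) (\<Union>i\<in>?I j. ?E i)) = case_bool (sets (F a)) (sets (noise_algebra a))"
  proof
    have "space (F a) = space M" using filtration_sub[OF assms] by (simp add: subalgebra_def)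
    then have "sigma_sets (space M) (sets (F a)) = sets (F a)"
      using sets.sigma_sets_eq[of "F a"] by simp
    then show "sigma_sets (space M) (\<Union>i\<in>?I j. ?E i) = case_bool (sets (F a)) (sets (noise_algebra a)) j" for j
      by (cases j) (simp_all add: sets_noise_algebra)
  qed
  ultimately show ?thesis by (simp add: indep_set_def)
qed

lemma noise_algebra_sub:
  assumes "0 \<le> a" shows "subalgebra M (noise_algebra a)"
  using indep_past_noise[OF assms] by (simp add: subalgebra_def space_noise_algebra indep_sets2_eq)

end

context levy_noise
begin

lemma cloud_integral_measurable:
  fixes g :: "'z \<Rightarrow> 'e::{banach, second_countable_topology}"
  assumes ab: "0 \<le> a" "a \<le> b" and "g \<in> borel_measurable \<nu>"
  shows "(\<lambda>\<omega>. \<integral>z. g z \<partial>cloud a b \<omega>) \<in> borel_measurable (poisson_algebra a)"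
proof -
  interpret C: finite_random_measure "poisson_algebra a" "density \<nu> (\<lambda>_. ennreal (b - a))" "cloud a b"
    using ab by (rule cloud_random_measure)
  show ?thesis using assms(3) by (intro C.integral_measurable1) simp
qed

text \<open>
  The Gaussian part and the jump part are centred and independent, so all mixed terms in the
  expansion of the square vanish in mean.
\<close>

lemma noise_second_moment:
  fixes A :: "real ^ 'd" and S :: "real ^ 'm ^ 'd" and g :: "'z \<Rightarrow> real ^ 'd"
  assumes ab: "0 \<le> a" "a < b" and g: "g \<in> borel_measurable \<nu>" and g2: "integrable \<nu> (\<lambda>z. (norm (g z))\<^sup>2)"
  shows "(\<integral>\<^sup>+\<omega>. ennreal ((norm (A + S *v (W b \<omega> - W a \<omega>)
        + ((\<integral>z. g z \<partial>cloud a b \<omega>) - (b - a) *\<^sub>R (\<integral>z. g z \<partial>\<nu>))))\<^sup>2) \<partial>M)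
    \<le> ennreal ((norm A)\<^sup>2 + (b - a) * (norm S)\<^sup>2 + (b - a) * (\<integral>z. (norm (g z))\<^sup>2 \<partial>\<nu>))"
proof -
  let ?h = "b - a"
  let ?\<mu> = "density \<nu> (\<lambda>_. ennreal ?h)"
  interpret C: poisson_cloud M ?\<mu> "cloud a b" using ab by (intro cloud_poisson) auto
  note [measurable] = g
  have h: "0 < ?h" using ab by simp
  let ?V = "\<lambda>\<omega>. (\<integral>z. g z \<partial>cloud a b \<omega>) - ?h *\<^sub>R (\<integral>z. g z \<partial>\<nu>)"
  have int_norm: "integrable \<nu> (\<lambda>z. norm (g z))"
    by (rule \<nu>.square_integrable_imp_integrable[where f="\<lambda>z. norm (g z)"]) (use g2 in auto)
  then have int_g: "integrable \<nu> g" by (simp add: integrable_norm_iff)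
  then have int_g\<mu>: "integrable ?\<mu> g" using h by (simp add: integrable_density)
  have [measurable]: "(\<lambda>z. g z $ k) \<in> borel_measurable \<nu>" for k
    by (rule measurable_compose[OF g]) measurable
  have comp2: "integrable \<nu> (\<lambda>z. (g z $ k)\<^sup>2)" for k
  proof (rule Bochner_Integration.integrable_bound[OF g2])
    show "AE z in \<nu>. norm ((g z $ k)\<^sup>2) \<le> norm ((norm (g z))\<^sup>2)"
      using component_le_norm_cart[of "g _" k] by (auto simp: abs_le_square_iff[symmetric])
  qed measurable
  have comp: "integrable \<nu> (\<lambda>z. g z $ k)" for k
    using int_g by (rule integrable_bounded_linear[OF bounded_linear_vec_nth])
  have comp\<mu>: "integrable ?\<mu> (\<lambda>z. g z $ k)" "integrable ?\<mu> (\<lambda>z. (g z $ k)\<^sup>2)"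
    "(\<integral>z. g z $ k \<partial>?\<mu>) = ?h * (\<integral>z. g z $ k \<partial>\<nu>)" "(\<integral>z. (g z $ k)\<^sup>2 \<partial>?\<mu>) = ?h * (\<integral>z. (g z $ k)\<^sup>2 \<partial>\<nu>)" for k
    using comp[of k] comp2[of k] h by (auto simp: integrable_density integral_density)
  have V_comp: "AE \<omega> in M. \<forall>k. ?V \<omega> $ k = (\<integral>z. g z $ k \<partial>cloud a b \<omega>) - (\<integral>z. g z $ k \<partial>?\<mu>)"
    using C.AE_integrable[OF int_g\<mu>]
  proof eventually_elim
    case (elim \<omega>)
    then show ?case
      by (simp add: comp\<mu> integral_bounded_linear[OF bounded_linear_vec_nth elim, symmetric]
          integral_bounded_linear[OF bounded_linear_vec_nth int_g, symmetric])
  qed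
  have V_meas[measurable]: "?V \<in> borel_measurable M" by measurable
  have V_comp_meas: "(\<lambda>\<omega>. ?V \<omega> $ k) \<in> borel_measurable M" for k
    by (rule measurable_compose[OF V_meas]) measurable
  have V1: "has_bochner_integral M (\<lambda>\<omega>. ?V \<omega> $ k) 0" for k
  proof -
    let ?X = "\<lambda>\<omega>. (\<integral>z. g z $ k \<partial>cloud a b \<omega>) - (\<integral>z. g z $ k \<partial>?\<mu>)"
    have X: "has_bochner_integral M ?X 0"
      using C.integrable_integral[OF comp\<mu>(1)] C.expectation_integral[OF comp\<mu>(1)]
      by (simp add: has_bochner_integral_iff prob_space)
    have Xm: "?X \<in> borel_measurable M" by measurable
    have AE: "AE \<omega> in M. ?X \<omega> = ?V \<omega> $ k"
      using V_comp by eventually_elim simp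
    show ?thesis using X unfolding has_bochner_integral_cong_AE[OF Xm V_comp_meas AE] .
  qed
  have V2: "(\<integral>\<^sup>+\<omega>. ennreal ((norm (?V \<omega>))\<^sup>2) \<partial>M) \<le> ennreal (?h * (\<integral>z. (norm (g z))\<^sup>2 \<partial>\<nu>))"
  proof -
    have "(\<integral>\<^sup>+\<omega>. ennreal ((norm (?V \<omega>))\<^sup>2) \<partial>M)
        = (\<integral>\<^sup>+\<omega>. (\<Sum>k\<in>UNIV. ennreal (((\<integral>z. g z $ k \<partial>cloud a b \<omega>) - (\<integral>z. g z $ k \<partial>?\<mu>))\<^sup>2)) \<partial>M)"
    proof (intro nn_integral_cong_AE, use V_comp in eventually_elim)
      case (elim \<omega>)
      then show ?case unfolding norm_vec_power2 by (simp add: sum_ennreal)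
    qed
    also have "\<dots> = (\<Sum>k\<in>UNIV. \<integral>\<^sup>+\<omega>. ennreal (((\<integral>z. g z $ k \<partial>cloud a b \<omega>) - (\<integral>z. g z $ k \<partial>?\<mu>))\<^sup>2) \<partial>M)"
      by (rule nn_integral_sum) measurable
    also have "\<dots> \<le> (\<Sum>k\<in>UNIV. ennreal (\<integral>z. (g z $ k)\<^sup>2 \<partial>?\<mu>))"
      by (intro sum_mono C.compensated_second_moment comp\<mu>)
    also have "\<dots> = ennreal (?h * (\<integral>z. (\<Sum>k\<in>UNIV. (g z $ k)\<^sup>2) \<partial>\<nu>))"
      using comp2 h by (simp add: sum_ennreal comp\<mu> sum_distrib_left integral_nonneg)
    also have "\<dots> = ennreal (?h * (\<integral>z. (norm (g z))\<^sup>2 \<partial>\<nu>))"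
      by (simp add: norm_vec_power2)
    finally show ?thesis .
  qed
  have V2_int: "integrable M (\<lambda>\<omega>. (norm (?V \<omega>))\<^sup>2)"
    using V2 by (intro integrableI_nonneg) (auto simp: less_top[symmetric] top_unique)
  define v where "v = (\<integral>\<omega>. (norm (?V \<omega>))\<^sup>2 \<partial>M)"
  have v: "has_bochner_integral M (\<lambda>\<omega>. (norm (?V \<omega>))\<^sup>2) v"
    using V2_int by (simp add: v_def has_bochner_integral_iff)
  have v_le: "v \<le> ?h * (\<integral>z. (norm (g z))\<^sup>2 \<partial>\<nu>)"
    using V2 h nn_integral_eq_integral[OF V2_int] by (simp add: v_def)
  have "(\<lambda>\<omega>. S *v (W b \<omega> - W a \<omega>)) \<in> borel_measurable (wiener_algebra a)"
    using ab by (intro measurable_compose[OF increment_measurable]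
        borel_measurable_continuous_onI matrix_vector_mult_linear_continuous_on) auto
  moreover have "?V \<in> borel_measurable (poisson_algebra a)"
    using ab by (intro borel_measurable_diff cloud_integral_measurable g) auto
  ultimately have indep: "indep_var borel (\<lambda>\<omega>. S *v (W b \<omega> - W a \<omega>)) borel ?V"
    by (rule indep_var_of_indep_set[OF indep_wiener_poisson[OF ab(1)] space_wiener_algebra space_poisson_algebra])
  have sq: "(sqrt ?h)\<^sup>2 = ?h" using h by simp
  have "has_bochner_integral M (\<lambda>\<omega>. (norm (A + S *v (W b \<omega> - W a \<omega>) + ?V \<omega>))\<^sup>2)
      ((norm A)\<^sup>2 + (sqrt ?h)\<^sup>2 * (norm S)\<^sup>2 + v)"
    using gaussian_linear_image_moments[OF _ wiener_increment[OF ab], of S] h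
    by (intro second_moment_independent_sum indep V1 v) auto
  then have "(\<integral>\<^sup>+\<omega>. ennreal ((norm (A + S *v (W b \<omega> - W a \<omega>) + ?V \<omega>))\<^sup>2) \<partial>M)
      = ennreal ((norm A)\<^sup>2 + ?h * (norm S)\<^sup>2 + v)"
    unfolding sq by (simp add: has_bochner_integral_iff nn_integral_eq_integral)
  also have "\<dots> \<le> ennreal ((norm A)\<^sup>2 + ?h * (norm S)\<^sup>2 + ?h * (\<integral>z. (norm (g z))\<^sup>2 \<partial>\<nu>))"
    using v_le by (intro ennreal_leI) simp
  finally show ?thesis .
qed

end

section \<open>The theta scheme as a contraction\<close>

text \<open>
  The range is open by invariance of domain and closed because Cauchy images have Cauchy preimages,
  hence it is the whole space.
\<close>

lemma expansive_bij:
  fixes f :: "'a::euclidean_space \<Rightarrow> 'a"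
  assumes cont: "continuous_on UNIV f" and exp: "\<And>x y. dist x y \<le> dist (f x) (f y)"
  shows "bij f"
proof -
  have inj: "inj f"
    using exp by (metis dist_eq_0_iff dist_le_zero_iff injI)
  have "open (range f)"
    using cont inj by (intro invariance_of_domain) auto
  moreover have "closed (range f)"
    unfolding closed_sequential_limits
  proof (intro allI impI)
    fix y l assume "(\<forall>n. y n \<in> range f) \<and> y \<longlonglongrightarrow> l"
    then have "\<forall>n. \<exists>x. y n = f x" and lim: "y \<longlonglongrightarrow> l" by auto
    then obtain x where y: "\<And>n. y n = f (x n)" by metis
    have "Cauchy y" using lim by (rule LIMSEQ_imp_Cauchy)
    have "Cauchy x"
    proof (rule metric_CauchyI)
      fix e :: real assume "0 < e"
      then obtain K where K: "\<forall>m\<ge>K. \<forall>n\<ge>K. dist (y m) (y n) < e"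
        using metric_CauchyD[OF \<open>Cauchy y\<close>] by blast
      show "\<exists>K. \<forall>m\<ge>K. \<forall>n\<ge>K. dist (x m) (x n) < e"
        using K le_less_trans[OF exp] by (intro exI[of _ K]) (auto simp: y)
    qed
    then obtain l' where "x \<longlonglongrightarrow> l'" using Cauchy_convergent convergent_def by blast
    then have "(\<lambda>n. f (x n)) \<longlonglongrightarrow> f l'"
      by (intro continuous_on_tendsto_compose[OF cont]) auto
    then have "y \<longlonglongrightarrow> f l'" by (simp only: y[symmetric])
    with lim show "l \<in> range f" using LIMSEQ_unique by blast
  qed
  ultimately have "range f = UNIV"
    by (metis UNIV_not_empty clopen empty_is_image)
  with inj show ?thesis by (simp add: bij_def)
qed

lemma borel_measurable_matrix_vector_mult:
  assumes [measurable]: "S \<in> borel_measurable K" "w \<in> borel_measurable K"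
  shows "(\<lambda>k. (S k :: real ^ 'm ^ 'd) *v w k) \<in> borel_measurable K"
proof -
  have "continuous_on UNIV (\<lambda>p. (fst p :: real ^ 'm ^ 'd) *v snd p)"
    unfolding matrix_vector_mult_def by (intro continuous_intros)
  then have "(\<lambda>p. (fst p :: real ^ 'm ^ 'd) *v snd p) \<in> borel_measurable (borel \<Otimes>\<^sub>M borel)"
    by (simp add: borel_prod borel_measurable_continuous_onI)
  from measurable_compose[OF measurable_Pair this, of S K w] show ?thesis by simp
qed

text \<open>
  The supremum bounds every difference quotient. It is nonnegative because \<open>real ^ 'd\<close> has two distinct
  points, an index type being nonempty.
\<close>

lemma lipschitz_lip_seminorm:
  fixes \<phi> :: "real ^ 'd \<Rightarrow> real"
  assumes "C-lipschitz_on UNIV \<phi>"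
  shows "(lip_seminorm \<phi>)-lipschitz_on UNIV \<phi>"
proof -
  let ?q = "\<lambda>p. \<bar>\<phi> (fst p) - \<phi> (snd p)\<bar> / norm (fst p - snd p)" and ?P = "{(x, y). x \<noteq> y} :: ((real ^ 'd) \<times> (real ^ 'd)) set"
  have seminorm: "lip_seminorm \<phi> = (SUP p\<in>?P. ?q p)"
    by (simp add: lip_seminorm_def case_prod_unfold)
  have "bdd_above (?q ` ?P)"
    using lipschitz_onD[OF assms] by (intro bdd_aboveI2[of _ _ C]) (auto simp: dist_norm divide_simps)
  then have upper: "\<bar>\<phi> x - \<phi> y\<bar> / norm (x - y) \<le> lip_seminorm \<phi>" if "x \<noteq> y" for x y
    unfolding seminorm using that cSUP_upper[of "(x, y)" ?P ?q] by simp
  show ?thesis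
  proof (rule lipschitz_onI)
    show "dist (\<phi> x) (\<phi> y) \<le> lip_seminorm \<phi> * dist x y" for x y
      using upper[of x y] by (cases "x = y") (auto simp: dist_norm divide_simps)
    have "(axis undefined 1 :: real ^ 'd) \<noteq> 0" by (simp add: axis_eq_0_iff)
    from upper[OF this] show "0 \<le> lip_seminorm \<phi>"
      by (rule order_trans[rotated]) simp
  qed
qed

locale theta_scheme = levy_noise M F W \<nu> N
  for M :: "'w measure" and F and W :: "real \<Rightarrow> 'w \<Rightarrow> real ^ 'm"
    and \<nu> :: "'z measure" and N +
  fixes b :: "real ^ 'd \<Rightarrow> real ^ 'd" and \<sigma> :: "real ^ 'd \<Rightarrow> real ^ 'm ^ 'd"
    and \<gamma> :: "real ^ 'd \<Rightarrow> 'z \<Rightarrow> real ^ 'd" and L \<tau> \<theta> :: real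
  assumes coefficients: "admissible_coefficients \<nu> b \<sigma> \<gamma>"
    and b_continuous: "continuous_on UNIV b"
    and L_pos: "0 < L"
    and dissipative: "2 * ((x - y) \<bullet> (b x - b y)) + (norm (\<sigma> x - \<sigma> y))\<^sup>2
      + (LINT z|\<nu>. (norm (\<gamma> x z - \<gamma> y z))\<^sup>2) \<le> - L * (norm (x - y))\<^sup>2"
    and tau: "0 < \<tau>" and theta: "1 / 2 < \<theta>"
begin

definition implicit :: "real ^ 'd \<Rightarrow> real ^ 'd" where
  "implicit x = x - (\<theta> * \<tau>) *\<^sub>R b x"

text \<open>
  The explicit part of the recursion, with the state \<open>x\<close> as a parameter independent of the noise.
\<close>

definition forcing :: "nat \<Rightarrow> real ^ 'd \<Rightarrow> 'w \<Rightarrow> real ^ 'd" where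
  "forcing j x \<omega> = x + ((1 - \<theta>) * \<tau>) *\<^sub>R b x
     + \<sigma> x *v (W (real (Suc j) * \<tau>) \<omega> - W (real j * \<tau>) \<omega>)
     + ((\<integral>z. \<gamma> x z \<partial>cloud (real j * \<tau>) (real (Suc j) * \<tau>) \<omega>) - \<tau> *\<^sub>R (\<integral>z. \<gamma> x z \<partial>\<nu>))"

definition advance :: "nat \<Rightarrow> real ^ 'd \<Rightarrow> 'w \<Rightarrow> real ^ 'd" where
  "advance j x \<omega> = inv implicit (forcing j x \<omega>)"

lemma measurable_coefficients[measurable]:
  "b \<in> borel_measurable borel" "\<sigma> \<in> borel_measurable borel"
  "(\<lambda>(x, z). \<gamma> x z) \<in> borel_measurable (borel \<Otimes>\<^sub>M \<nu>)" "\<gamma> x \<in> borel_measurable \<nu>"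
  and square_integrable: "integrable \<nu> (\<lambda>z. (norm (\<gamma> x z))\<^sup>2)"
proof -
  show *: "(\<lambda>(x, z). \<gamma> x z) \<in> borel_measurable (borel \<Otimes>\<^sub>M \<nu>)"
    and "b \<in> borel_measurable borel" "\<sigma> \<in> borel_measurable borel" "integrable \<nu> (\<lambda>z. (norm (\<gamma> x z))\<^sup>2)"
    using coefficients by (auto simp: admissible_coefficients_def)
  show "\<gamma> x \<in> borel_measurable \<nu>"
    using measurable_compose[OF measurable_Pair1' *, of x] by simp
qed

lemma jump_integrable: "integrable \<nu> (\<gamma> x)"
proof -
  have "integrable \<nu> (\<lambda>z. norm (\<gamma> x z))"
    by (rule \<nu>.square_integrable_imp_integrable[where f="\<lambda>z. norm (\<gamma> x z)"]) (use square_integrable in auto)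
  then show ?thesis by (simp add: integrable_norm_iff)
qed

lemma square_integrable_diff: "integrable \<nu> (\<lambda>z. (norm (\<gamma> x z - \<gamma> y z))\<^sup>2)"
proof (rule Bochner_Integration.integrable_bound)
  show "integrable \<nu> (\<lambda>z. 2 * (norm (\<gamma> x z))\<^sup>2 + 2 * (norm (\<gamma> y z))\<^sup>2)"
    using square_integrable by auto
  show "AE z in \<nu>. norm ((norm (\<gamma> x z - \<gamma> y z))\<^sup>2) \<le> norm (2 * (norm (\<gamma> x z))\<^sup>2 + 2 * (norm (\<gamma> y z))\<^sup>2)"
  proof (rule AE_I2)
    fix z
    have "(norm (\<gamma> x z - \<gamma> y z))\<^sup>2 \<le> 2 * (norm (\<gamma> x z))\<^sup>2 + 2 * (norm (\<gamma> y z))\<^sup>2"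
      using zero_le_power2[of "norm (\<gamma> x z + \<gamma> y z)"]
      by (simp add: power2_norm_eq_inner inner_add inner_diff inner_commute)
    then show "norm ((norm (\<gamma> x z - \<gamma> y z))\<^sup>2) \<le> norm (2 * (norm (\<gamma> x z))\<^sup>2 + 2 * (norm (\<gamma> y z))\<^sup>2)"
      by simp
  qed
qed measurable

lemma drift_monotone: "(x - y) \<bullet> (b x - b y) \<le> 0"
proof -
  have "0 \<le> (LINT z|\<nu>. (norm (\<gamma> x z - \<gamma> y z))\<^sup>2)" by (rule Bochner_Integration.integral_nonneg) simp
  moreover have "0 \<le> L * (norm (x - y))\<^sup>2" using L_pos by simp
  ultimately show ?thesis using dissipative[of x y] zero_le_power2[of "norm (\<sigma> x - \<sigma> y)"] by linarith
qed

lemma implicit_expansive: "dist x y \<le> dist (implicit x) (implicit y)"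
proof -
  let ?D = "x - y" and ?G = "implicit x - implicit y"
  have "?D \<bullet> ?G = ?D \<bullet> ?D - \<theta> * \<tau> * (?D \<bullet> (b x - b y))"
    by (simp add: implicit_def inner_diff algebra_simps)
  moreover have "\<theta> * \<tau> * (?D \<bullet> (b x - b y)) \<le> 0"
    using tau theta drift_monotone by (intro mult_nonneg_nonpos) auto
  ultimately have "norm ?D * norm ?D \<le> ?D \<bullet> ?G"
    by (simp add: power2_norm_eq_inner[symmetric] power2_eq_square)
  also have "\<dots> \<le> norm ?D * norm ?G" by (rule norm_cauchy_schwarz)
  finally show ?thesis by (cases "?D = 0") (auto simp: dist_norm)
qed

lemma implicit_continuous: "continuous_on UNIV implicit"
  unfolding implicit_def by (intro continuous_intros b_continuous)

lemma implicit_measurable[measurable]: "implicit \<in> borel_measurable borel"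
  using implicit_continuous by (rule borel_measurable_continuous_onI)

lemma bij_implicit: "bij implicit"
  using implicit_continuous implicit_expansive by (rule expansive_bij)

lemma inv_implicit[simp]: "inv implicit (implicit x) = x" "implicit (inv implicit x) = x"
  using bij_implicit by (simp_all add: bij_is_inj bij_is_surj surj_f_inv_f)

lemma inv_implicit_measurable[measurable]: "inv implicit \<in> borel_measurable borel"
proof (rule borel_measurable_continuous_onI)
  have "1-lipschitz_on UNIV (inv implicit)"
    using implicit_expansive[of "inv implicit _" "inv implicit _"] by (intro lipschitz_onI) auto
  then show "continuous_on UNIV (inv implicit)" by (rule lipschitz_on_continuous_on)
qed

lemma times: "0 \<le> real j * \<tau>" "real j * \<tau> < real (Suc j) * \<tau>" "real (Suc j) * \<tau> - real j * \<tau> = \<tau>"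
  using tau by (auto simp: algebra_simps)

lemma advance_measurable:
  "(\<lambda>(x, \<omega>). advance j x \<omega>) \<in> borel_measurable (borel \<Otimes>\<^sub>M noise_algebra (real j * \<tau>))"
proof -
  let ?s = "real j * \<tau>" and ?t = "real (Suc j) * \<tau>"
  let ?P = "borel \<Otimes>\<^sub>M noise_algebra ?s :: ((real ^ 'd) \<times> 'w) measure"
  interpret C: finite_random_measure "noise_algebra ?s" "density \<nu> (\<lambda>_. ennreal \<tau>)" "cloud ?s ?t"
    using finite_random_measure_mono[OF cloud_random_measure poisson_sub_noise, of ?s ?t] times[of j] by simp
  have "(\<lambda>(x, \<omega>). \<integral>z. \<gamma> x z \<partial>cloud ?s ?t \<omega>) \<in> borel_measurable ?P"
    by (rule C.integral_measurable, subst measurable_cong_sets[OF sets_pair_measure_cong refl]) auto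
  then have [measurable]: "(\<lambda>p. \<integral>z. \<gamma> (fst p) z \<partial>cloud ?s ?t (snd p)) \<in> borel_measurable ?P"
    by (simp add: case_prod_unfold)
  have dW: "(\<lambda>\<omega>. W ?t \<omega> - W ?s \<omega>) \<in> borel_measurable (noise_algebra ?s)"
    using times[of j] by (intro measurable_from_subalg[OF wiener_sub_noise] increment_measurable) auto
  have [measurable]: "(\<lambda>p. \<sigma> (fst p) *v (W ?t (snd p) - W ?s (snd p))) \<in> borel_measurable ?P"
    by (rule borel_measurable_matrix_vector_mult[OF _ measurable_compose[OF measurable_snd dW]]) measurable
  have [measurable]: "(\<lambda>x. \<integral>z. \<gamma> x z \<partial>\<nu>) \<in> borel_measurable borel"
    by measurable
  have "(\<lambda>p. inv implicit (forcing j (fst p) (snd p))) \<in> borel_measurable ?P"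
    unfolding forcing_def by measurable
  then show ?thesis by (simp add: advance_def case_prod_unfold)
qed

lemma advance_measurable_M: "(\<lambda>(x, \<omega>). advance j x \<omega>) \<in> borel_measurable (borel \<Otimes>\<^sub>M M)"
proof -
  have "(\<lambda>\<omega>. \<omega>) \<in> measurable M (noise_algebra (real j * \<tau>))"
    by (rule measurable_from_subalg[OF noise_algebra_sub[OF times(1)[of j]]]) simp
  then have "(\<lambda>p. (fst p, snd p)) \<in> measurable (borel \<Otimes>\<^sub>M M) (borel \<Otimes>\<^sub>M noise_algebra (real j * \<tau>))"
    by (intro measurable_Pair measurable_compose[OF measurable_snd]) auto
  from measurable_compose[OF this advance_measurable] show ?thesis by (simp add: case_prod_unfold)
qed

lemma advance_measurable1[measurable]: "advance j x \<in> borel_measurable M"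
  using measurable_compose[OF measurable_Pair1' advance_measurable_M, of x j] by simp

text \<open>
  The increment of \<open>W\<close> and the jump integral are independent, and neither law depends on the time
  step; so the scheme is homogeneous in time.
\<close>

lemma advance_law: "distr M borel (advance j x) = distr M borel (advance i x)"
proof -
  let ?s = "\<lambda>j. real j * \<tau>"
  define X where "X j \<omega> = W (?s (Suc j)) \<omega> - W (?s j) \<omega>" for j \<omega>
  define I where "I j \<omega> = (\<integral>z. \<gamma> x z \<partial>cloud (?s j) (?s (Suc j)) \<omega>)" for j \<omega>
  define h where "h p = inv implicit (x + ((1 - \<theta>) * \<tau>) *\<^sub>R b x + \<sigma> x *v fst p + (snd p - \<tau> *\<^sub>R (\<integral>z. \<gamma> x z \<partial>\<nu>)))" for p
  have h[measurable]: "h \<in> borel_measurable (borel \<Otimes>\<^sub>M borel)"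
    unfolding h_def using borel_measurable_matrix_vector_mult[of "\<lambda>_. \<sigma> x" "borel \<Otimes>\<^sub>M borel" fst] by measurable
  have cloud: "poisson_cloud M (density \<nu> (\<lambda>_. ennreal \<tau>)) (cloud (?s j) (?s (Suc j)))" for j
    using cloud_poisson[of "?s j" "?s (Suc j)"] times[of j] by simp
  have I_law: "distr M borel (I j) = distr M borel (I i)" for i j
    unfolding I_def using jump_integrable tau
    by (intro poisson_cloud_integral_law[OF cloud cloud]) (simp add: integrable_density)
  have X_law: "distr M borel (X j) = density lborel (\<lambda>x. ennreal (\<Prod>i\<in>UNIV. normal_density 0 (sqrt \<tau>) (x $ i)))" for j
  proof -
    have "distributed M lborel (X j) (\<lambda>x. ennreal (\<Prod>i\<in>UNIV. normal_density 0 (sqrt \<tau>) (x $ i)))"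
      using wiener_increment[OF times(1,2), of j] unfolding X_def times(3) .
    from distributed_distr_eq_density[OF this] show ?thesis
      by (simp cong: distr_cong)
  qed
  have law: "distr M borel (advance j x) = distr (distr M borel (X j) \<Otimes>\<^sub>M distr M borel (I j)) borel h" for j
  proof -
    have XW: "X j \<in> borel_measurable (wiener_algebra (?s j))"
      unfolding X_def using times[of j] by (intro increment_measurable) auto
    have IP: "I j \<in> borel_measurable (poisson_algebra (?s j))"
      unfolding I_def using times[of j] by (intro cloud_integral_measurable) auto
    have rv: "X j \<in> borel_measurable M" "I j \<in> borel_measurable M"
      using measurable_from_subalg[OF wiener_sub_noise XW] measurable_from_subalg[OF poisson_sub_noise IP]
      by (auto intro: measurable_from_subalg[OF noise_algebra_sub[OF times(1)]])
    have "advance j x = h \<circ> (\<lambda>\<omega>. (X j \<omega>, I j \<omega>))"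
      by (simp add: fun_eq_iff advance_def forcing_def h_def X_def I_def)
    then have "distr M borel (advance j x) = distr (distr M (borel \<Otimes>\<^sub>M borel) (\<lambda>\<omega>. (X j \<omega>, I j \<omega>))) borel h"
      using rv by (simp add: distr_distr)
    also have "distr M (borel \<Otimes>\<^sub>M borel) (\<lambda>\<omega>. (X j \<omega>, I j \<omega>)) = distr M borel (X j) \<Otimes>\<^sub>M distr M borel (I j)"
      by (rule distr_pair_of_indep_set[OF indep_wiener_poisson[OF times(1)] space_wiener_algebra space_poisson_algebra XW IP, symmetric])
    finally show ?thesis .
  qed
  show ?thesis unfolding law X_law I_law[of j i] ..
qed

text \<open>
  The entries of the minimum make the subtracted constant \<open>c\<close> satisfy \<open>2 c \<le> L \<tau>\<close> and
  \<open>2 \<theta>\<^sup>2 c \<le> 2 \<theta> - 1\<close>, which is what \<open>|G|\<^sup>2 \<le> 2 |D|\<^sup>2 + 2 \<theta>\<^sup>2 \<tau>\<^sup>2 |\<Delta>b|\<^sup>2\<close> requires; the entry \<open>1 / 2\<close> keeps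
  the factor positive.
\<close>

definition decay :: real where
  "decay = 1 - min (1 / 2) (min (L * \<tau> / 2) ((2 * \<theta> - 1) / (2 * \<theta>\<^sup>2)))"

lemma decay: "0 < decay" "decay < 1"
proof -
  have "0 < min (1 / 2) (min (L * \<tau> / 2) ((2 * \<theta> - 1) / (2 * \<theta>\<^sup>2)))"
    using L_pos tau theta by simp
  then show "decay < 1" by (simp add: decay_def)
  show "0 < decay" unfolding decay_def by linarith
qed

text \<open>
  The left-hand side bounds the second moment of the new increment of \<open>implicit\<close>. Expanding the square
  in terms of the old increment produces \<open>- (2 \<theta> - 1) \<tau>\<^sup>2 |\<Delta>b|\<^sup>2\<close>, and dissipativity produces \<open>- L \<tau> |D|\<^sup>2\<close>;
  together they dominate a multiple of the old increment.
\<close>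

lemma drift_contraction:
  "(norm ((x - y) + ((1 - \<theta>) * \<tau>) *\<^sub>R (b x - b y)))\<^sup>2 + \<tau> * (norm (\<sigma> x - \<sigma> y))\<^sup>2
      + \<tau> * (LINT z|\<nu>. (norm (\<gamma> x z - \<gamma> y z))\<^sup>2)
    \<le> decay * (norm (implicit x - implicit y))\<^sup>2"
proof -
  let ?D = "x - y" and ?B = "b x - b y" and ?G = "implicit x - implicit y"
  let ?c = "1 - decay"
  have G: "?G = ?D - (\<theta> * \<tau>) *\<^sub>R ?B" by (simp add: implicit_def algebra_simps)
  have "(norm (?D + ((1 - \<theta>) * \<tau>) *\<^sub>R ?B))\<^sup>2 = (norm ?G)\<^sup>2 + \<tau> * (2 * (?D \<bullet> ?B)) - (2 * \<theta> - 1) * \<tau>\<^sup>2 * (norm ?B)\<^sup>2"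
    unfolding G power2_norm_eq_inner
    by (simp add: inner_add inner_diff inner_commute power2_eq_square algebra_simps)
  moreover have "\<tau> * (2 * (?D \<bullet> ?B) + (norm (\<sigma> x - \<sigma> y))\<^sup>2 + (LINT z|\<nu>. (norm (\<gamma> x z - \<gamma> y z))\<^sup>2))
      \<le> \<tau> * (- L * (norm ?D)\<^sup>2)"
    using dissipative[of x y] tau by (intro mult_left_mono) auto
  \<comment> \<open>The two negative terms absorb a fixed proportion of the old increment.\<close>
  moreover have "?c * (norm ?G)\<^sup>2 \<le> L * \<tau> * (norm ?D)\<^sup>2 + (2 * \<theta> - 1) * \<tau>\<^sup>2 * (norm ?B)\<^sup>2"
  proof -
    have c_eq: "?c = min (1 / 2) (min (L * \<tau> / 2) ((2 * \<theta> - 1) / (2 * \<theta>\<^sup>2)))"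
      by (simp add: decay_def)
    have "?c \<le> L * \<tau> / 2" "?c \<le> (2 * \<theta> - 1) / (2 * \<theta>\<^sup>2)"
      unfolding c_eq by (rule min.coboundedI2, rule min.cobounded1, rule min.coboundedI2, rule min.cobounded2)
    moreover have "0 < 2 * \<theta>\<^sup>2" using theta by simp
    ultimately have c: "0 \<le> ?c" "?c * 2 \<le> L * \<tau>" "?c * (2 * \<theta>\<^sup>2) \<le> 2 * \<theta> - 1"
      using decay by (simp_all only: pos_le_divide_eq)
    have "(norm ?G)\<^sup>2 \<le> 2 * (norm ?D)\<^sup>2 + 2 * \<theta>\<^sup>2 * \<tau>\<^sup>2 * (norm ?B)\<^sup>2"
      using zero_le_power2[of "norm (?D + (\<theta> * \<tau>) *\<^sub>R ?B)"] unfolding G power2_norm_eq_inner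
      by (simp add: inner_add inner_diff inner_commute power2_eq_square algebra_simps)
    then have "?c * (norm ?G)\<^sup>2 \<le> ?c * (2 * (norm ?D)\<^sup>2 + 2 * \<theta>\<^sup>2 * \<tau>\<^sup>2 * (norm ?B)\<^sup>2)"
      using c(1) by (rule mult_left_mono)
    also have "\<dots> = (?c * 2) * (norm ?D)\<^sup>2 + (?c * (2 * \<theta>\<^sup>2)) * (\<tau>\<^sup>2 * (norm ?B)\<^sup>2)"
      by (simp add: algebra_simps)
    also have "\<dots> \<le> (L * \<tau>) * (norm ?D)\<^sup>2 + (2 * \<theta> - 1) * (\<tau>\<^sup>2 * (norm ?B)\<^sup>2)"
      using c by (intro add_mono mult_right_mono) auto
    finally show ?thesis by (simp add: mult.assoc)
  qed
  ultimately show ?thesis by (simp add: algebra_simps)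
qed

text \<open>
  The increment of \<open>implicit\<close> at the new state is that of \<open>forcing\<close>, which is affine in the noise. Its second moment
  contracts by \<open>decay\<close>, hence its first moment by the square root.
\<close>

lemma advance_moment:
  "(\<integral>\<^sup>+\<omega>. dist (implicit (advance 0 x \<omega>)) (implicit (advance 0 y \<omega>)) \<partial>M)
    \<le> ennreal (sqrt decay) * dist (implicit x) (implicit y)"
proof -
  let ?g = "\<lambda>z. \<gamma> x z - \<gamma> y z"
  let ?A = "(x - y) + ((1 - \<theta>) * \<tau>) *\<^sub>R (b x - b y)" and ?S = "\<sigma> x - \<sigma> y"
  interpret C: poisson_cloud M "density \<nu> (\<lambda>_. ennreal \<tau>)" "cloud 0 \<tau>"
    using cloud_poisson[of 0 \<tau>] tau by simp
  have int\<mu>: "integrable (density \<nu> (\<lambda>_. ennreal \<tau>)) (\<gamma> x)" for x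
    using jump_integrable tau by (simp add: integrable_density)
  have "AE \<omega> in M. forcing 0 x \<omega> - forcing 0 y \<omega> = ?A + ?S *v (W \<tau> \<omega> - W 0 \<omega>)
      + ((\<integral>z. ?g z \<partial>cloud 0 \<tau> \<omega>) - (\<tau> - 0) *\<^sub>R (\<integral>z. ?g z \<partial>\<nu>))"
    using C.AE_integrable[OF int\<mu>[of x]] C.AE_integrable[OF int\<mu>[of y]]
  proof eventually_elim
    case (elim \<omega>)
    then show ?case
      by (simp add: forcing_def jump_integrable matrix_vector_mult_diff_rdistrib algebra_simps)
  qed
  then have "(\<integral>\<^sup>+\<omega>. ennreal ((dist (implicit (advance 0 x \<omega>)) (implicit (advance 0 y \<omega>)))\<^sup>2) \<partial>M)
      = (\<integral>\<^sup>+\<omega>. ennreal ((norm (?A + ?S *v (W \<tau> \<omega> - W 0 \<omega>)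
        + ((\<integral>z. ?g z \<partial>cloud 0 \<tau> \<omega>) - (\<tau> - 0) *\<^sub>R (\<integral>z. ?g z \<partial>\<nu>))))\<^sup>2) \<partial>M)"
    by (intro nn_integral_cong_AE) (auto elim!: eventually_mono simp: advance_def dist_norm)
  also have "\<dots> \<le> ennreal ((norm ?A)\<^sup>2 + (\<tau> - 0) * (norm ?S)\<^sup>2 + (\<tau> - 0) * (\<integral>z. (norm (?g z))\<^sup>2 \<partial>\<nu>))"
    using tau square_integrable_diff by (intro noise_second_moment) auto
  also have "\<dots> \<le> ennreal (decay * (dist (implicit x) (implicit y))\<^sup>2)"
    using drift_contraction[of x y] by (intro ennreal_leI) (simp add: dist_norm)
  also have "\<dots> = ennreal ((sqrt decay * dist (implicit x) (implicit y))\<^sup>2)"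
    using decay by (simp add: power_mult_distrib)
  finally have square: "(\<integral>\<^sup>+\<omega>. ennreal ((dist (implicit (advance 0 x \<omega>)) (implicit (advance 0 y \<omega>)))\<^sup>2) \<partial>M)
      \<le> ennreal ((sqrt decay * dist (implicit x) (implicit y))\<^sup>2)" .
  have "(\<integral>\<^sup>+\<omega>. dist (implicit (advance 0 x \<omega>)) (implicit (advance 0 y \<omega>)) \<partial>M)
      \<le> ennreal (sqrt decay * dist (implicit x) (implicit y))"
    by (rule nn_integral_le_of_square[OF _ _ _ square]) (intro borel_measurable_dist measurable_compose[OF advance_measurable1 implicit_measurable], simp, use decay in simp)
  then show ?thesis using decay by (simp add: ennreal_mult)
qed

lemma advance_displacement:
  "(\<integral>\<^sup>+\<omega>. dist (implicit x) (implicit (advance 0 x \<omega>)) \<partial>M) < \<infinity>"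
proof -
  let ?c = "(norm (\<tau> *\<^sub>R b x))\<^sup>2 + (\<tau> - 0) * (norm (\<sigma> x))\<^sup>2 + (\<tau> - 0) * (\<integral>z. (norm (\<gamma> x z))\<^sup>2 \<partial>\<nu>)"
  have c: "0 \<le> ?c" using tau by (auto intro!: add_nonneg_nonneg mult_nonneg_nonneg integral_nonneg)
  have "forcing 0 x \<omega> - implicit x = \<tau> *\<^sub>R b x + \<sigma> x *v (W \<tau> \<omega> - W 0 \<omega>)
      + ((\<integral>z. \<gamma> x z \<partial>cloud 0 \<tau> \<omega>) - (\<tau> - 0) *\<^sub>R (\<integral>z. \<gamma> x z \<partial>\<nu>))" for \<omega>
    by (simp add: forcing_def implicit_def algebra_simps)
  then have "(\<integral>\<^sup>+\<omega>. ennreal ((dist (implicit x) (implicit (advance 0 x \<omega>)))\<^sup>2) \<partial>M)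
      = (\<integral>\<^sup>+\<omega>. ennreal ((norm (\<tau> *\<^sub>R b x + \<sigma> x *v (W \<tau> \<omega> - W 0 \<omega>)
        + ((\<integral>z. \<gamma> x z \<partial>cloud 0 \<tau> \<omega>) - (\<tau> - 0) *\<^sub>R (\<integral>z. \<gamma> x z \<partial>\<nu>))))\<^sup>2) \<partial>M)"
    by (simp add: advance_def dist_norm norm_minus_commute[of "implicit x"])
  also have "\<dots> \<le> ennreal ?c"
    using tau square_integrable by (intro noise_second_moment) auto
  also have "?c = (sqrt ?c)\<^sup>2" using c by simp
  finally have square: "(\<integral>\<^sup>+\<omega>. ennreal ((dist (implicit x) (implicit (advance 0 x \<omega>)))\<^sup>2) \<partial>M)
      \<le> ennreal ((sqrt ?c)\<^sup>2)" .
  have "(\<integral>\<^sup>+\<omega>. dist (implicit x) (implicit (advance 0 x \<omega>)) \<partial>M) \<le> ennreal (sqrt ?c)"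
    by (rule nn_integral_le_of_square[OF _ _ _ square]) (intro borel_measurable_dist borel_measurable_const measurable_compose[OF advance_measurable1 implicit_measurable], simp, use c in simp)
  then show ?thesis by (rule le_less_trans) simp
qed

sublocale chain: random_contraction M "advance 0" implicit "sqrt decay"
  using advance_measurable_M implicit_continuous implicit_expansive decay advance_moment advance_displacement
  by unfold_locales auto

text \<open>
  Almost surely the window contains finitely many points, and there the compensated integral is the
  integral over the cloud minus \<open>\<tau>\<close> times the integral over \<open>\<nu>\<close>. Applying the inverse of \<open>implicit\<close>
  solves the implicit equation.
\<close>

lemma solution_step:
  assumes sol: "theta_method_solution M F W \<nu> N b \<sigma> \<gamma> \<tau> \<theta> x Y"
  shows "AE \<omega> in M. Y (Suc j) \<omega> = advance j (Y j \<omega>) \<omega>"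
proof -
  let ?s = "real j * \<tau>" and ?t = "real (Suc j) * \<tau>"
  have rec: "AE \<omega> in M. Y (Suc j) \<omega> = Y j \<omega> + ((1 - \<theta>) * \<tau>) *\<^sub>R b (Y j \<omega>) + (\<theta> * \<tau>) *\<^sub>R b (Y (Suc j) \<omega>)
      + \<sigma> (Y j \<omega>) *v (W ?t \<omega> - W ?s \<omega>)
      + compensated_integral \<nu> N ?s ?t (\<lambda>\<omega> s z. \<gamma> (Y j \<omega>) z) \<omega>"
    using sol by (simp add: theta_method_solution_def)
  show ?thesis
    using rec AE_finite_window[OF times(1) less_imp_le[OF times(2)], of j] AE_space
  proof eventually_elim
    case (elim \<omega>)
    have fin: "emeasure (N \<omega>) ({?s<..?t} \<times> space \<nu>) < \<infinity>" by (rule elim(2))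
    have "compensated_integral \<nu> N ?s ?t (\<lambda>\<omega> s z. \<gamma> (Y j \<omega>) z) \<omega>
        = (\<integral>z. \<gamma> (Y j \<omega>) z \<partial>cloud ?s ?t \<omega>) - \<tau> *\<^sub>R (\<integral>z. \<gamma> (Y j \<omega>) z \<partial>\<nu>)"
      unfolding compensated_integral_def using fin tau
      by (simp only: integral_window_cloud[OF times(1) prm_sets[OF elim(3)] measurable_coefficients(4)]
          integral_window_cloud[OF times(1) refl measurable_coefficients(4)]
          window_cloud_intensity[OF times(1) less_imp_le[OF times(2)]] times(3) cloud_def if_True)
        (simp add: integral_density)
    with elim(1) have "implicit (Y (Suc j) \<omega>) = forcing j (Y j \<omega>) \<omega>"
      by (simp add: implicit_def forcing_def algebra_simps)
    then show ?case by (metis advance_def inv_implicit(1))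
  qed
qed

lemma solution_measurable:
  assumes "theta_method_solution M F W \<nu> N b \<sigma> \<gamma> \<tau> \<theta> x Y"
  shows "Y n \<in> borel_measurable M"
  by (rule measurable_from_subalg[OF filtration_sub[OF times(1)[of n]]])
    (use assms in \<open>simp add: theta_method_solution_def\<close>)

text \<open>
  The state at time \<open>n\<close> belongs to the past and the map \<open>advance n\<close> to the future; after freezing
  the state, \<open>advance n\<close> may be replaced by \<open>advance 0\<close>.
\<close>

lemma nn_integral_solution_Suc:
  assumes sol: "theta_method_solution M F W \<nu> N b \<sigma> \<gamma> \<tau> \<theta> x Y"
    and [measurable]: "f \<in> borel_measurable borel"
  shows "(\<integral>\<^sup>+\<omega>. f (Y (Suc n) \<omega>) \<partial>M) = (\<integral>\<^sup>+\<omega>. chain.average f (Y n \<omega>) \<partial>M)"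
proof -
  note [measurable] = advance_measurable
  have "(\<integral>\<^sup>+\<omega>. f (Y (Suc n) \<omega>) \<partial>M) = (\<integral>\<^sup>+\<omega>. f (advance n (Y n \<omega>) \<omega>) \<partial>M)"
    using solution_step[OF sol, of n] by (intro nn_integral_cong_AE) (auto elim: eventually_mono)
  also have "\<dots> = (\<integral>\<^sup>+\<omega>. \<integral>\<^sup>+\<omega>'. f (advance n (Y n \<omega>) \<omega>') \<partial>M \<partial>M)"
  proof (rule nn_integral_freeze[OF indep_past_noise[OF times(1)] filtration_sub[OF times(1)] noise_algebra_sub[OF times(1)]])
    show "Y n \<in> borel_measurable (F (real n * \<tau>))" using sol by (simp add: theta_method_solution_def)
    show "(\<lambda>(x, \<omega>). f (advance n x \<omega>)) \<in> borel_measurable (borel \<Otimes>\<^sub>M noise_algebra (real n * \<tau>))"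
      by measurable
  qed
  also have "\<dots> = (\<integral>\<^sup>+\<omega>. chain.average f (Y n \<omega>) \<partial>M)"
  proof (intro nn_integral_cong)
    fix \<omega>
    have "(\<integral>\<^sup>+\<omega>'. f (advance n (Y n \<omega>) \<omega>') \<partial>M) = (\<integral>\<^sup>+y. f y \<partial>distr M borel (advance n (Y n \<omega>)))"
      by (simp add: nn_integral_distr)
    also have "\<dots> = chain.average f (Y n \<omega>)"
      unfolding advance_law[of n _ 0] chain.average_def by (simp add: nn_integral_distr)
    finally show "(\<integral>\<^sup>+\<omega>'. f (advance n (Y n \<omega>) \<omega>') \<partial>M) = chain.average f (Y n \<omega>)" .
  qed
  finally show ?thesis .
qed

lemma nn_integral_solution:
  assumes sol: "theta_method_solution M F W \<nu> N b \<sigma> \<gamma> \<tau> \<theta> x Y"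
    and "f \<in> borel_measurable borel"
  shows "(\<integral>\<^sup>+\<omega>. f (Y n \<omega>) \<partial>M) = (\<integral>\<^sup>+s. f (chain.backward x n s) \<partial>chain.noise)"
  using assms(2)
proof (induction n arbitrary: f)
  case 0
  have "AE \<omega> in M. Y 0 \<omega> = x" using sol by (simp add: theta_method_solution_def)
  then have "(\<integral>\<^sup>+\<omega>. f (Y 0 \<omega>) \<partial>M) = (\<integral>\<^sup>+\<omega>. f x \<partial>M)"
    by (intro nn_integral_cong_AE) (auto elim: eventually_mono)
  then show ?case by (simp add: emeasure_space_1 chain.noise.emeasure_space_1)
next
  case (Suc n)
  note [measurable] = Suc.prems
  have "(\<integral>\<^sup>+\<omega>. f (Y (Suc n) \<omega>) \<partial>M) = (\<integral>\<^sup>+\<omega>. chain.average f (Y n \<omega>) \<partial>M)"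
    by (rule nn_integral_solution_Suc[OF sol Suc.prems])
  also have "\<dots> = (\<integral>\<^sup>+s. chain.average f (chain.backward x n s) \<partial>chain.noise)"
    by (rule Suc.IH) measurable
  also have "\<dots> = (\<integral>\<^sup>+s. f (chain.backward x (Suc n) s) \<partial>chain.noise)"
    by (rule chain.nn_integral_backward_Suc[OF Suc.prems, symmetric])
  finally show ?case .
qed

text \<open>
  The solution and the backward orbit differ as processes but satisfy the same one-step recursion for means.
\<close>

lemma solution_law:
  assumes sol: "theta_method_solution M F W \<nu> N b \<sigma> \<gamma> \<tau> \<theta> x Y"
  shows "distr M borel (Y n) = distr chain.noise borel (chain.backward x n)"
proof (rule measure_eqI)
  fix B assume "B \<in> sets (distr M borel (Y n))"
  then have B: "B \<in> sets borel" by simp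
  note [measurable] = solution_measurable[OF sol, of n]
  have "emeasure (distr M borel (Y n)) B = (\<integral>\<^sup>+y. indicator B y \<partial>distr M borel (Y n))"
    using B by simp
  also have "\<dots> = (\<integral>\<^sup>+\<omega>. indicator B (Y n \<omega>) \<partial>M)"
    using B by (intro nn_integral_distr) auto
  also have "\<dots> = (\<integral>\<^sup>+s. indicator B (chain.backward x n s) \<partial>chain.noise)"
    using B by (intro nn_integral_solution[OF sol]) auto
  also have "\<dots> = (\<integral>\<^sup>+y. indicator B y \<partial>distr chain.noise borel (chain.backward x n))"
    using B by (intro nn_integral_distr[symmetric]) auto
  also have "\<dots> = emeasure (distr chain.noise borel (chain.backward x n)) B"
    using B by simp
  finally show "emeasure (distr M borel (Y n)) B = emeasure (distr chain.noise borel (chain.backward x n)) B" .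
qed simp

lemma one_step_law:
  assumes sol: "theta_method_solution M F W \<nu> N b \<sigma> \<gamma> \<tau> \<theta> x Y" and B: "B \<in> sets borel"
  shows "emeasure (distr M borel (Y 1)) B = chain.average (indicator B) x"
proof -
  have "emeasure (distr M borel (Y 1)) B = (\<integral>\<^sup>+y. indicator B y \<partial>distr M borel (Y 1))"
    using B by simp
  also have "\<dots> = (\<integral>\<^sup>+\<omega>. indicator B (Y 1 \<omega>) \<partial>M)"
    using B by (intro nn_integral_distr[OF solution_measurable[OF sol]]) auto
  also have "\<dots> = (\<integral>\<^sup>+\<omega>. chain.average (indicator B) (Y 0 \<omega>) \<partial>M)"
    using nn_integral_solution_Suc[OF sol, of "indicator B" 0] B by simp
  also have "\<dots> = (\<integral>\<^sup>+\<omega>. chain.average (indicator B) x \<partial>M)"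
    using sol by (intro nn_integral_cong_AE) (auto simp: theta_method_solution_def elim!: eventually_mono)
  finally show ?thesis by (simp add: emeasure_space_1)
qed

lemma invariant_prob_iff_stationary:
  assumes sol: "\<And>x. theta_method_solution M F W \<nu> N b \<sigma> \<gamma> \<tau> \<theta> x (Y x)"
  shows "invariant_prob M Y \<pi> \<longleftrightarrow> chain.stationary \<pi>"
proof (cases "prob_space \<pi> \<and> sets \<pi> = sets borel")
  case False
  then show ?thesis by (auto simp: invariant_prob_def chain.stationary_def)
next
  case True
  then have \<pi>: "prob_space \<pi>" "sets \<pi> = sets borel" by auto
  have "emeasure (chain.law_after_step \<pi>) B = (\<integral>\<^sup>+x. emeasure (distr M borel (Y x 1)) B \<partial>\<pi>)" if B: "B \<in> sets borel" for B
  proof -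
    have "emeasure (chain.law_after_step \<pi>) B = (\<integral>\<^sup>+x. indicator B x \<partial>chain.law_after_step \<pi>)"
      using B by (simp add: chain.law_after_step_def)
    then show ?thesis
      using B by (simp add: chain.nn_integral_law_after_step[OF \<pi>] one_step_law[OF sol] del: One_nat_def)
  qed
  then have "invariant_prob M Y \<pi> \<longleftrightarrow> (\<forall>B\<in>sets borel. emeasure (chain.law_after_step \<pi>) B = emeasure \<pi> B)"
    using \<pi> by (simp add: invariant_prob_def)
  also have "\<dots> \<longleftrightarrow> chain.law_after_step \<pi> = \<pi>"
    using \<pi> by (auto intro!: measure_eqI simp: chain.law_after_step_def)
  finally show ?thesis by (simp add: chain.stationary_iff_law_after_step[OF \<pi>])
qed

lemma mixing:
  assumes sol: "theta_method_solution M F W \<nu> N b \<sigma> \<gamma> \<tau> \<theta> x Y" and lip: "C-lipschitz_on UNIV \<phi>"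
  shows "integrable (chain.limit_law 0) \<phi>"
    and "integrable M (\<lambda>\<omega>. \<phi> (Y n \<omega>))"
    and "\<bar>(LINT \<omega>|M. \<phi> (Y n \<omega>)) - (LINT y|chain.limit_law 0. \<phi> y)\<bar>
      \<le> C * (chain.displacement x / (1 - sqrt decay)) * sqrt decay ^ n"
proof -
  have J: "chain.J_lipschitz C \<phi>" using lip by (rule chain.lipschitz_imp_J_lipschitz)
  note [measurable] = chain.J_lipschitz_measurable[OF J] solution_measurable[OF sol]
  have limit: "chain.limit_law 0 = chain.limit_law x"
    by (rule chain.stationary_unique[OF chain.stationary_limit_law])
  note est = chain.limit_estimate[OF J, where x=x]
  show "integrable (chain.limit_law 0) \<phi>" unfolding limit by (rule est(2))
  have "integrable (distr M borel (Y n)) \<phi>"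
    unfolding solution_law[OF sol] using est(1) by (simp add: integrable_distr_eq)
  then show "integrable M (\<lambda>\<omega>. \<phi> (Y n \<omega>))" by (simp add: integrable_distr_eq)
  have "(LINT \<omega>|M. \<phi> (Y n \<omega>)) = (LINT y|distr M borel (Y n). \<phi> y)"
    by (simp add: integral_distr)
  also have "\<dots> = (LINT s|chain.noise. \<phi> (chain.backward x n s))"
    unfolding solution_law[OF sol] by (simp add: integral_distr)
  finally show "\<bar>(LINT \<omega>|M. \<phi> (Y n \<omega>)) - (LINT y|chain.limit_law 0. \<phi> y)\<bar>
      \<le> C * (chain.displacement x / (1 - sqrt decay)) * sqrt decay ^ n"
    unfolding limit using est(3) by simp
qed

end

theorem theorem2p4:
  fixes M :: "'w measure" and F :: "real \<Rightarrow> 'w measure"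
    and W :: "real \<Rightarrow> 'w \<Rightarrow> real ^ 'm"
    and \<nu> :: "'z measure" and N :: "'w \<Rightarrow> (real \<times> 'z) measure"
    and b :: "real ^ 'd \<Rightarrow> real ^ 'd" and \<sigma> :: "real ^ 'd \<Rightarrow> real ^ 'm ^ 'd"
    and \<gamma> :: "real ^ 'd \<Rightarrow> 'z \<Rightarrow> real ^ 'd"
    and L \<tau> \<theta> :: real
    and Y :: "real ^ 'd \<Rightarrow> nat \<Rightarrow> 'w \<Rightarrow> real ^ 'd"
  assumes noise: "levy_noise M F W \<nu> N"
    and coefficients: "admissible_coefficients \<nu> b \<sigma> \<gamma>"
    and b_continuous: "continuous_on UNIV b"
    and L_pos: "0 < L"
    and dissipative: "\<And>x y. 2 * ((x - y) \<bullet> (b x - b y)) + (norm (\<sigma> x - \<sigma> y))\<^sup>2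
      + (LINT z|\<nu>. (norm (\<gamma> x z - \<gamma> y z))\<^sup>2) \<le> - L * (norm (x - y))\<^sup>2"
    and tau: "0 < \<tau>" "\<tau> < 1"
    and theta: "1 / 2 < \<theta>" "\<theta> \<le> 1"
    and step: "L * \<theta>\<^sup>2 * \<tau> \<le> 3 - 2 * \<theta>"
    and solution: "\<And>x. theta_method_solution M F W \<nu> N b \<sigma> \<gamma> \<tau> \<theta> x (Y x)"
  shows "\<exists>\<pi>. invariant_prob M Y \<pi> \<and> (\<forall>\<pi>'. invariant_prob M Y \<pi>' \<longrightarrow> \<pi>' = \<pi>) \<and>
    exponentially_mixing M \<tau> Y \<pi>"
proof -
  interpret theta_scheme M F W \<nu> N b \<sigma> \<gamma> L \<tau> \<theta>
    using assms by (simp add: theta_scheme_def theta_scheme_axioms_def)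
  let ?\<pi> = "chain.limit_law 0" and ?r = "sqrt decay"
  \<comment> \<open>The rate for which one step of length \<open>\<tau>\<close> costs exactly the contraction factor.\<close>
  define \<rho> where "\<rho> = - ln ?r / \<tau>"
  have r: "0 < ?r" "?r < 1" using decay by auto
  then have \<rho>: "0 < \<rho>" using tau by (simp add: \<rho>_def divide_neg_pos)
  have power: "?r ^ n = exp (- \<rho> * (real n * \<tau>))" for n
  proof -
    have "- \<rho> * (real n * \<tau>) = real n * ln ?r" using tau by (simp add: \<rho>_def)
    then show ?thesis using r by (simp only: exp_of_nat_mult exp_ln)
  qed
  have "exponentially_mixing M \<tau> Y ?\<pi>"
    unfolding exponentially_mixing_def
  proof (intro exI[of _ \<rho>] exI[of _ "\<lambda>x. chain.displacement x / (1 - ?r)"] conjI allI impI \<rho>)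
    show "0 \<le> chain.displacement x / (1 - ?r)" for x using r by simp
    fix \<phi> :: "real ^ 'd \<Rightarrow> real" assume "\<exists>C. C-lipschitz_on UNIV \<phi>"
    then have lip: "(lip_seminorm \<phi>)-lipschitz_on UNIV \<phi>" using lipschitz_lip_seminorm by blast
    show "integrable ?\<pi> \<phi>" by (rule mixing(1)[OF solution lip])
    fix x n
    show "integrable M (\<lambda>\<omega>. \<phi> (Y x n \<omega>))" by (rule mixing(2)[OF solution lip])
    show "\<bar>(LINT \<omega>|M. \<phi> (Y x n \<omega>)) - (LINT y|?\<pi>. \<phi> y)\<bar>
        \<le> chain.displacement x / (1 - ?r) * lip_seminorm \<phi> * exp (- \<rho> * (real n * \<tau>))"
      using mixing(3)[OF solution lip, of x n] by (simp only: power mult.commute[of "lip_seminorm \<phi>"])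
  qed
  moreover have "invariant_prob M Y ?\<pi>"
    by (simp add: invariant_prob_iff_stationary[OF solution] chain.stationary_limit_law)
  moreover have "\<pi>' = ?\<pi>" if "invariant_prob M Y \<pi>'" for \<pi>'
    using that chain.stationary_unique by (simp add: invariant_prob_iff_stationary[OF solution])
  ultimately show ?thesis by blast
qed

end
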